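(* The quantum double torus with parameter $\theta\in\mathbb R$ is strange for $\theta\notin 2\pi\mathbb Z$.
   Context: Compact quantum groups $G$ are described by Hopf $C^*$-algebras $C(G)$ in the sense of Woronowicz. $G$ is classical if $C(G)$ is commutative. A closed subgroup $H\subset G$ is given by a surjective morphism of Hopf $C^*$-algebras $C(G)\to C(H)$. For a discrete group $\Lambda$, $\widehat{\Lambda}$ is given by $C(\widehat{\Lambda})=C^*(\Lambda)$ with $\Delta(g)=g\otimes g$; it is classical iff $\Lambda$ is abelian. $G$ is called strange if it is non-classical and all its group dual subgroups $\widehat{\Lambda}\subset G$ are classical. The quantum double torus (Hajac-Masuda) with parameter $\theta$ is the compact quantum group with function algebra $Q=C(\mathbb T^2)\oplus A_{2\theta}$. Here $C(\mathbb T^2)$ is generated by its standard commuting unitaries $A,D$, and $A_{2\theta}$ is the rotation algebra, i.e. the universal $C^*$-algebra generated by two unitaries $B,C$ satisfying $BC=e^{i\theta}CB$ (all of $A,B,C,D$ are viewed as elements of $Q$, being zero in the other summand). The comultiplication of $Q$ is the one making $V=\begin{pmatrix}A&C\\ B&D\end{pmatrix}$ a corepresentation, i.e. $\Delta(V_{ij})=\sum_kV_{ik}\otimes V_{kj}$. *)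

theory Defs
  imports "HOL-Analysis.Analysis" "HOL-Algebra.Module"
begin

section \<open>Unital complex *-algebras and C*-algebras\<close>

definition complex_ring :: "complex ring" where
  "complex_ring = \<lparr>carrier = UNIV, mult = (*), one = 1, zero = 0, add = (+)\<rparr>"

record 'a star_alg = "(complex, 'a) module" +
  star :: "'a \<Rightarrow> 'a"

record 'a cstar_alg = "'a star_alg" +
  cnorm :: "'a \<Rightarrow> real"

locale star_algebra =
  ring A + Module.module complex_ring A
  for A :: "('a, 'z) star_alg_scheme" (structure) +
  assumes smult_mult_left:
      "\<lbrakk>x \<in> carrier A; y \<in> carrier A\<rbrakk> \<Longrightarrow> (c \<odot> x) \<otimes> y = c \<odot> (x \<otimes> y)"
    and smult_mult_right:
      "\<lbrakk>x \<in> carrier A; y \<in> carrier A\<rbrakk> \<Longrightarrow> x \<otimes> (c \<odot> y) = c \<odot> (x \<otimes> y)"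
    and star_closed: "x \<in> carrier A \<Longrightarrow> star A x \<in> carrier A"
    and star_star: "x \<in> carrier A \<Longrightarrow> star A (star A x) = x"
    and star_add:
      "\<lbrakk>x \<in> carrier A; y \<in> carrier A\<rbrakk> \<Longrightarrow> star A (x \<oplus> y) = star A x \<oplus> star A y"
    and star_smult: "x \<in> carrier A \<Longrightarrow> star A (c \<odot> x) = cnj c \<odot> star A x"
    and star_mult:
      "\<lbrakk>x \<in> carrier A; y \<in> carrier A\<rbrakk> \<Longrightarrow> star A (x \<otimes> y) = star A y \<otimes> star A x"

definition cstar_seminorm :: "('a, 'z) star_alg_scheme \<Rightarrow> ('a \<Rightarrow> real) \<Rightarrow> bool" where
  "cstar_seminorm A p \<longleftrightarrow>
    (\<forall>x\<in>carrier A. 0 \<le> p x) \<and>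
    (\<forall>x\<in>carrier A. \<forall>y\<in>carrier A. p (x \<oplus>\<^bsub>A\<^esub> y) \<le> p x + p y) \<and>
    (\<forall>c. \<forall>x\<in>carrier A. p (c \<odot>\<^bsub>A\<^esub> x) = cmod c * p x) \<and>
    (\<forall>x\<in>carrier A. \<forall>y\<in>carrier A. p (x \<otimes>\<^bsub>A\<^esub> y) \<le> p x * p y) \<and>
    (\<forall>x\<in>carrier A. p (star A x \<otimes>\<^bsub>A\<^esub> x) = (p x)\<^sup>2)"

text \<open>The distance is set to 0 off the carrier because the locale \<open>Metric_space\<close> wants
  symmetry and nonnegativity on the whole type.\<close>

definition cdist :: "('a, 'z) cstar_alg_scheme \<Rightarrow> 'a \<Rightarrow> 'a \<Rightarrow> real" where
  "cdist A x y = (if x \<in> carrier A \<and> y \<in> carrier A then cnorm A (x \<ominus>\<^bsub>A\<^esub> y) else 0)"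

definition cstar_algebra :: "('a, 'z) cstar_alg_scheme \<Rightarrow> bool" where
  "cstar_algebra A \<longleftrightarrow>
    star_algebra A \<and> cstar_seminorm A (cnorm A) \<and>
    (\<forall>x\<in>carrier A. cnorm A x = 0 \<longrightarrow> x = \<zero>\<^bsub>A\<^esub>) \<and>
    Metric_space.mcomplete (carrier A) (cdist A)"

definition star_hom :: "('a, 'y) star_alg_scheme \<Rightarrow> ('b, 'z) star_alg_scheme \<Rightarrow> ('a \<Rightarrow> 'b) set" where
  "star_hom A B = {f \<in> ring_hom A B.
    (\<forall>c. \<forall>x\<in>carrier A. f (c \<odot>\<^bsub>A\<^esub> x) = c \<odot>\<^bsub>B\<^esub> f x) \<and>
    (\<forall>x\<in>carrier A. f (star A x) = star B (f x))}"

definition state :: "('a, 'z) star_alg_scheme \<Rightarrow> ('a \<Rightarrow> complex) \<Rightarrow> bool" where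
  "state A \<phi> \<longleftrightarrow>
    (\<forall>x\<in>carrier A. \<forall>y\<in>carrier A. \<phi> (x \<oplus>\<^bsub>A\<^esub> y) = \<phi> x + \<phi> y) \<and>
    (\<forall>c. \<forall>x\<in>carrier A. \<phi> (c \<odot>\<^bsub>A\<^esub> x) = c * \<phi> x) \<and>
    (\<forall>x\<in>carrier A. \<phi> (star A x \<otimes>\<^bsub>A\<^esub> x) \<in> \<real>\<^sub>\<ge>\<^sub>0) \<and>
    \<phi> \<one>\<^bsub>A\<^esub> = 1"

definition closed_subspace :: "('a, 'z) cstar_alg_scheme \<Rightarrow> 'a set \<Rightarrow> bool" where
  "closed_subspace A W \<longleftrightarrow>
    closedin (Metric_space.mtopology (carrier A) (cdist A)) W \<and> \<zero>\<^bsub>A\<^esub> \<in> W \<and>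
    (\<forall>x\<in>W. \<forall>y\<in>W. x \<oplus>\<^bsub>A\<^esub> y \<in> W) \<and> (\<forall>c. \<forall>x\<in>W. c \<odot>\<^bsub>A\<^esub> x \<in> W)"

definition spans_densely :: "('a, 'z) cstar_alg_scheme \<Rightarrow> 'a set \<Rightarrow> bool" where
  "spans_densely A S \<longleftrightarrow>
    S \<subseteq> carrier A \<and> (\<forall>W. closed_subspace A W \<and> S \<subseteq> W \<longrightarrow> W = carrier A)"


section \<open>Hausdorff completion of a *-algebra in a C*-seminorm\<close>

definition cauchy_seqs :: "('a, 'z) star_alg_scheme \<Rightarrow> ('a \<Rightarrow> real) \<Rightarrow> (nat \<Rightarrow> 'a) set" where
  "cauchy_seqs A p = {X. range X \<subseteq> carrier A \<and>
    (\<forall>e>0. \<exists>N. \<forall>m\<ge>N. \<forall>n\<ge>N. p (X m \<ominus>\<^bsub>A\<^esub> X n) < e)}"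

definition null_rel :: "('a, 'z) star_alg_scheme \<Rightarrow> ('a \<Rightarrow> real) \<Rightarrow> ((nat \<Rightarrow> 'a) \<times> (nat \<Rightarrow> 'a)) set" where
  "null_rel A p = {(X, Y). X \<in> cauchy_seqs A p \<and> Y \<in> cauchy_seqs A p \<and>
    (\<lambda>n. p (X n \<ominus>\<^bsub>A\<^esub> Y n)) \<longlonglongrightarrow> 0}"

definition to_completion ::
  "('a, 'z) star_alg_scheme \<Rightarrow> ('a \<Rightarrow> real) \<Rightarrow> 'a \<Rightarrow> (nat \<Rightarrow> 'a) set" where
  "to_completion A p a = null_rel A p `` {\<lambda>n. a}"

definition completion ::
  "('a, 'z) star_alg_scheme \<Rightarrow> ('a \<Rightarrow> real) \<Rightarrow> ((nat \<Rightarrow> 'a) set) cstar_alg" where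
  "completion A p =
    \<lparr>carrier = cauchy_seqs A p // null_rel A p,
     mult = (\<lambda>S T. \<Union>X\<in>S. \<Union>Y\<in>T. null_rel A p `` {\<lambda>n. X n \<otimes>\<^bsub>A\<^esub> Y n}),
     one = to_completion A p \<one>\<^bsub>A\<^esub>,
     zero = to_completion A p \<zero>\<^bsub>A\<^esub>,
     add = (\<lambda>S T. \<Union>X\<in>S. \<Union>Y\<in>T. null_rel A p `` {\<lambda>n. X n \<oplus>\<^bsub>A\<^esub> Y n}),
     smult = (\<lambda>c S. \<Union>X\<in>S. null_rel A p `` {\<lambda>n. c \<odot>\<^bsub>A\<^esub> X n}),
     star = (\<lambda>S. \<Union>X\<in>S. null_rel A p `` {\<lambda>n. star A (X n)}),
     cnorm = (\<lambda>S. THE r. \<exists>X\<in>S. (\<lambda>n. p (X n)) \<longlonglongrightarrow> r)\<rparr>"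

text \<open>The largest C*-seminorm that kills the elements of \<open>R\<close>. Completing in it gives the
  universal (enveloping) C*-algebra of the quotient of \<open>A\<close> by the relations \<open>R\<close>. In all uses
  below \<open>A\<close> is generated by elements that become unitary, so that the supremum is finite.\<close>

definition universal_seminorm ::
  "('a, 'z) star_alg_scheme \<Rightarrow> 'a set \<Rightarrow> 'a \<Rightarrow> real" where
  "universal_seminorm A R x = Sup {p x | p. cstar_seminorm A p \<and> (\<forall>r\<in>R. p r = 0)}"


section \<open>The *-algebra of a monoid with involution\<close>

record 'm star_monoid = "'m monoid" +
  invol :: "'m \<Rightarrow> 'm"

definition supp :: "('m \<Rightarrow> complex) \<Rightarrow> 'm set" where
  "supp f = {x. f x \<noteq> 0}"

definition delta :: "'m \<Rightarrow> 'm \<Rightarrow> complex" where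
  "delta m = (\<lambda>x. if x = m then 1 else 0)"

definition monoid_algebra :: "('m, 'z) star_monoid_scheme \<Rightarrow> ('m \<Rightarrow> complex) star_alg" where
  "monoid_algebra M =
    \<lparr>carrier = {f. finite (supp f) \<and> supp f \<subseteq> carrier M},
     mult = (\<lambda>f g z. \<Sum>x\<in>supp f. \<Sum>y\<in>supp g. if x \<otimes>\<^bsub>M\<^esub> y = z then f x * g y else 0),
     one = delta \<one>\<^bsub>M\<^esub>,
     zero = (\<lambda>_. 0),
     add = (\<lambda>f g z. f z + g z),
     smult = (\<lambda>c f z. c * f z),
     star = (\<lambda>f z. \<Sum>x\<in>supp f. if invol M x = z then cnj (f x) else 0)\<rparr>"


section \<open>The minimal tensor product of C*-algebras\<close>

definition prod_star_monoid ::
  "('a, 'y) star_alg_scheme \<Rightarrow> ('b, 'z) star_alg_scheme \<Rightarrow> ('a \<times> 'b) star_monoid" where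
  "prod_star_monoid A B =
    \<lparr>carrier = carrier A \<times> carrier B,
     mult = (\<lambda>(a, b) (a', b'). (a \<otimes>\<^bsub>A\<^esub> a', b \<otimes>\<^bsub>B\<^esub> b')),
     one = (\<one>\<^bsub>A\<^esub>, \<one>\<^bsub>B\<^esub>),
     invol = (\<lambda>(a, b). (star A a, star B b))\<rparr>"

text \<open>The free vector space on pairs \<open>(a, b)\<close>, a *-algebra whose quotient by the bilinearity
  relations is the algebraic tensor product. That quotient need not be taken: the spatial
  seminorm below vanishes exactly on the relations, and the completion divides by its kernel.\<close>

definition pre_tensor ::
  "('a, 'y) star_alg_scheme \<Rightarrow> ('b, 'z) star_alg_scheme \<Rightarrow> ('a \<times> 'b \<Rightarrow> complex) star_alg" where
  "pre_tensor A B = monoid_algebra (prod_star_monoid A B)"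

definition tensor_functional ::
  "('a \<Rightarrow> complex) \<Rightarrow> ('b \<Rightarrow> complex) \<Rightarrow> ('a \<times> 'b \<Rightarrow> complex) \<Rightarrow> complex" where
  "tensor_functional \<phi> \<psi> t = (\<Sum>(a, b)\<in>supp t. t (a, b) * \<phi> a * \<psi> b)"

text \<open>The spatial norm: the supremum, over all pairs of states, of the operator norm of \<open>t\<close> in
  the tensor product of the two GNS representations. Here \<open>(\<phi> \<otimes> \<psi>)(y* t* t y)\<close> is
  the square of the norm of \<open>t \<xi>\<close> for the vector \<open>\<xi>\<close> represented by \<open>y\<close>, and such vectors are
  dense.\<close>

definition spatial_seminorm ::
  "('a, 'y) star_alg_scheme \<Rightarrow> ('b, 'z) star_alg_scheme \<Rightarrow> ('a \<times> 'b \<Rightarrow> complex) \<Rightarrow> real" where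
  "spatial_seminorm A B t =
    (let P = pre_tensor A B in
     Sup {sqrt (Re (tensor_functional \<phi> \<psi>
            (star P (t \<otimes>\<^bsub>P\<^esub> y) \<otimes>\<^bsub>P\<^esub> (t \<otimes>\<^bsub>P\<^esub> y)))) | \<phi> \<psi> y.
          state A \<phi> \<and> state B \<psi> \<and> y \<in> carrier P \<and>
          tensor_functional \<phi> \<psi> (star P y \<otimes>\<^bsub>P\<^esub> y) = 1})"

type_synonym ('a, 'b) tensor = "(nat \<Rightarrow> 'a \<times> 'b \<Rightarrow> complex) set"

definition min_tensor ::
  "('a, 'y) star_alg_scheme \<Rightarrow> ('b, 'z) star_alg_scheme \<Rightarrow> ('a, 'b) tensor cstar_alg" where
  "min_tensor A B = completion (pre_tensor A B) (spatial_seminorm A B)"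

definition elem_tensor ::
  "('a, 'y) star_alg_scheme \<Rightarrow> ('b, 'z) star_alg_scheme \<Rightarrow> 'a \<Rightarrow> 'b \<Rightarrow> ('a, 'b) tensor" where
  "elem_tensor A B a b = to_completion (pre_tensor A B) (spatial_seminorm A B) (delta (a, b))"

text \<open>\<open>F\<close> is the map \<open>\<Phi> \<otimes> \<Psi>\<close>; a *-homomorphism between C*-algebras is automatically
  continuous, so \<open>F\<close> is determined on the carrier.\<close>

definition is_tensor_map ::
  "('a, 'v) star_alg_scheme \<Rightarrow> ('b, 'w) star_alg_scheme \<Rightarrow>
   ('c, 'y) star_alg_scheme \<Rightarrow> ('d, 'z) star_alg_scheme \<Rightarrow>
   ('a \<Rightarrow> 'c) \<Rightarrow> ('b \<Rightarrow> 'd) \<Rightarrow> (('a, 'b) tensor \<Rightarrow> ('c, 'd) tensor) \<Rightarrow> bool" where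
  "is_tensor_map A B C D \<Phi> \<Psi> F \<longleftrightarrow>
    F \<in> star_hom (min_tensor A B) (min_tensor C D) \<and>
    (\<forall>a\<in>carrier A. \<forall>b\<in>carrier B. F (elem_tensor A B a b) = elem_tensor C D (\<Phi> a) (\<Psi> b))"


section \<open>Compact quantum groups\<close>

text \<open>A quantum group \<open>G\<close> is given by its function algebra \<open>C(G)\<close> and its comultiplication.\<close>

record 'a quantum_group =
  fun_alg :: "'a cstar_alg"
  comult :: "'a \<Rightarrow> ('a, 'a) tensor"

definition coassociative :: "'a quantum_group \<Rightarrow> bool" where
  "coassociative G \<longleftrightarrow>
    (let Q = fun_alg G; T = min_tensor Q Q in
     \<exists>F1 F2 assoc.
       is_tensor_map Q Q T Q (comult G) id F1 \<and>
       is_tensor_map Q Q Q T id (comult G) F2 \<and>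
       assoc \<in> star_hom (min_tensor T Q) (min_tensor Q T) \<and>
       (\<forall>a\<in>carrier Q. \<forall>b\<in>carrier Q. \<forall>c\<in>carrier Q.
          assoc (elem_tensor T Q (elem_tensor Q Q a b) c) =
          elem_tensor Q T a (elem_tensor Q Q b c)) \<and>
       (\<forall>x\<in>carrier Q. assoc (F1 (comult G x)) = F2 (comult G x)))"

definition compact_quantum_group :: "'a quantum_group \<Rightarrow> bool" where
  "compact_quantum_group G \<longleftrightarrow>
    (let Q = fun_alg G; T = min_tensor Q Q in
     cstar_algebra Q \<and> \<one>\<^bsub>Q\<^esub> \<noteq> \<zero>\<^bsub>Q\<^esub> \<and>
     comult G \<in> star_hom Q T \<and> coassociative G \<and>
     spans_densely T {comult G a \<otimes>\<^bsub>T\<^esub> elem_tensor Q Q b \<one>\<^bsub>Q\<^esub> | a b. a \<in> carrier Q \<and> b \<in> carrier Q} \<and>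
     spans_densely T {comult G a \<otimes>\<^bsub>T\<^esub> elem_tensor Q Q \<one>\<^bsub>Q\<^esub> b | a b. a \<in> carrier Q \<and> b \<in> carrier Q})"

definition classical :: "'a quantum_group \<Rightarrow> bool" where
  "classical G \<longleftrightarrow>
    (\<forall>x\<in>carrier (fun_alg G). \<forall>y\<in>carrier (fun_alg G).
       x \<otimes>\<^bsub>fun_alg G\<^esub> y = y \<otimes>\<^bsub>fun_alg G\<^esub> x)"

definition hopf_morphism :: "'a quantum_group \<Rightarrow> 'b quantum_group \<Rightarrow> ('a \<Rightarrow> 'b) \<Rightarrow> bool" where
  "hopf_morphism G H \<Phi> \<longleftrightarrow>
    \<Phi> \<in> star_hom (fun_alg G) (fun_alg H) \<and>
    (\<exists>F. is_tensor_map (fun_alg G) (fun_alg G) (fun_alg H) (fun_alg H) \<Phi> \<Phi> F \<and>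
      (\<forall>x\<in>carrier (fun_alg G). F (comult G x) = comult H (\<Phi> x)))"

definition closed_subgroup :: "'b quantum_group \<Rightarrow> 'a quantum_group \<Rightarrow> bool" where
  "closed_subgroup H G \<longleftrightarrow>
    (\<exists>\<Phi>. hopf_morphism G H \<Phi> \<and> \<Phi> ` carrier (fun_alg G) = carrier (fun_alg H))"


section \<open>Duals of discrete groups\<close>

definition group_star_monoid :: "'g monoid \<Rightarrow> 'g star_monoid" where
  "group_star_monoid \<Lambda> =
    \<lparr>carrier = carrier \<Lambda>, mult = mult \<Lambda>, one = one \<Lambda>, invol = m_inv \<Lambda>\<rparr>"

definition group_cstar :: "'g monoid \<Rightarrow> ((nat \<Rightarrow> 'g \<Rightarrow> complex) set) cstar_alg" where
  "group_cstar \<Lambda> =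
    (let A = monoid_algebra (group_star_monoid \<Lambda>) in completion A (universal_seminorm A {}))"

definition group_unitary :: "'g monoid \<Rightarrow> 'g \<Rightarrow> (nat \<Rightarrow> 'g \<Rightarrow> complex) set" where
  "group_unitary \<Lambda> g =
    (let A = monoid_algebra (group_star_monoid \<Lambda>) in
     to_completion A (universal_seminorm A {}) (delta g))"

definition is_group_dual :: "'g monoid \<Rightarrow> ((nat \<Rightarrow> 'g \<Rightarrow> complex) set) quantum_group \<Rightarrow> bool" where
  "is_group_dual \<Lambda> H \<longleftrightarrow>
    fun_alg H = group_cstar \<Lambda> \<and>
    comult H \<in> star_hom (group_cstar \<Lambda>) (min_tensor (group_cstar \<Lambda>) (group_cstar \<Lambda>)) \<and>
    (\<forall>g\<in>carrier \<Lambda>. comult H (group_unitary \<Lambda> g) =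
       elem_tensor (group_cstar \<Lambda>) (group_cstar \<Lambda>) (group_unitary \<Lambda> g) (group_unitary \<Lambda> g))"

text \<open>HOL cannot quantify over types inside a formula, so the discrete groups range over those
  with elements in the type \<open>'g\<close>. Strangeness is the statement for every \<open>'g\<close>, that is, a
  statement in which \<open>'g\<close> is a free type variable unrelated to the type of \<open>G\<close>.\<close>

definition strange :: "'g itself \<Rightarrow> 'a quantum_group \<Rightarrow> bool" where
  "strange (_ :: 'g itself) G \<longleftrightarrow>
    \<not> classical G \<and>
    (\<forall>(\<Lambda> :: 'g monoid) H.
       group \<Lambda> \<and> is_group_dual \<Lambda> H \<and> closed_subgroup H G \<longrightarrow> classical H)"


section \<open>The quantum double torus\<close>

abbreviation torus2 :: "(complex \<times> complex) set" where
  "torus2 \<equiv> sphere 0 1 \<times> sphere 0 1"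

text \<open>The algebra of continuous functions on the two-torus; a function on the torus is represented by its extension by zero.\<close>

definition torus_alg :: "(complex \<times> complex \<Rightarrow> complex) cstar_alg" where
  "torus_alg =
    \<lparr>carrier = {f. continuous_on torus2 f \<and> (\<forall>z. z \<notin> torus2 \<longrightarrow> f z = 0)},
     mult = (\<lambda>f g z. f z * g z),
     one = indicator torus2,
     zero = (\<lambda>_. 0),
     add = (\<lambda>f g z. f z + g z),
     smult = (\<lambda>c f z. c * f z),
     star = (\<lambda>f z. cnj (f z)),
     cnorm = (\<lambda>f. SUP z\<in>torus2. cmod (f z))\<rparr>"

definition torus_fst :: "complex \<times> complex \<Rightarrow> complex" where
  "torus_fst z = (if z \<in> torus2 then fst z else 0)"

definition torus_snd :: "complex \<times> complex \<Rightarrow> complex" where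
  "torus_snd z = (if z \<in> torus2 then snd z else 0)"

text \<open>Words in the letters \<open>(s, False)\<close>, standing for \<open>s\<close>, and \<open>(s, True)\<close>, standing for \<open>s*\<close>.\<close>

definition free_star_monoid :: "('s \<times> bool) list star_monoid" where
  "free_star_monoid =
    \<lparr>carrier = UNIV, mult = (@), one = [],
     invol = (\<lambda>w. rev (map (\<lambda>(s, b). (s, \<not> b)) w))\<rparr>"

datatype rot_gen = GenB | GenC

abbreviation free_rot_alg :: "((rot_gen \<times> bool) list \<Rightarrow> complex) star_alg" where
  "free_rot_alg \<equiv> monoid_algebra free_star_monoid"

definition free_gen :: "rot_gen \<Rightarrow> (rot_gen \<times> bool) list \<Rightarrow> complex" where
  "free_gen s = delta [(s, False)]"

definition unitary_relators :: "('a, 'z) star_alg_scheme \<Rightarrow> 'a \<Rightarrow> 'a set" where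
  "unitary_relators A u =
    {star A u \<otimes>\<^bsub>A\<^esub> u \<ominus>\<^bsub>A\<^esub> \<one>\<^bsub>A\<^esub>, u \<otimes>\<^bsub>A\<^esub> star A u \<ominus>\<^bsub>A\<^esub> \<one>\<^bsub>A\<^esub>}"

definition rot_relators :: "real \<Rightarrow> ((rot_gen \<times> bool) list \<Rightarrow> complex) set" where
  "rot_relators \<theta> =
    (let A = free_rot_alg; B = free_gen GenB; C = free_gen GenC in
     unitary_relators A B \<union> unitary_relators A C \<union>
     {(B \<otimes>\<^bsub>A\<^esub> C) \<ominus>\<^bsub>A\<^esub> (exp (\<i> * of_real \<theta>) \<odot>\<^bsub>A\<^esub> (C \<otimes>\<^bsub>A\<^esub> B))})"

type_synonym rot = "(nat \<Rightarrow> (rot_gen \<times> bool) list \<Rightarrow> complex) set"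

text \<open>The universal C*-algebra on unitaries \<open>B, C\<close> with \<open>BC = exp(i\<theta>) CB\<close>.\<close>

definition rotation_alg :: "real \<Rightarrow> rot cstar_alg" where
  "rotation_alg \<theta> = completion free_rot_alg (universal_seminorm free_rot_alg (rot_relators \<theta>))"

definition rot_unitary :: "real \<Rightarrow> rot_gen \<Rightarrow> rot" where
  "rot_unitary \<theta> s =
    to_completion free_rot_alg (universal_seminorm free_rot_alg (rot_relators \<theta>)) (free_gen s)"

definition direct_sum :: "'a cstar_alg \<Rightarrow> 'b cstar_alg \<Rightarrow> ('a \<times> 'b) cstar_alg" where
  "direct_sum A B =
    \<lparr>carrier = carrier A \<times> carrier B,
     mult = (\<lambda>(a, b) (a', b'). (a \<otimes>\<^bsub>A\<^esub> a', b \<otimes>\<^bsub>B\<^esub> b')),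
     one = (\<one>\<^bsub>A\<^esub>, \<one>\<^bsub>B\<^esub>),
     zero = (\<zero>\<^bsub>A\<^esub>, \<zero>\<^bsub>B\<^esub>),
     add = (\<lambda>(a, b) (a', b'). (a \<oplus>\<^bsub>A\<^esub> a', b \<oplus>\<^bsub>B\<^esub> b')),
     smult = (\<lambda>c (a, b). (c \<odot>\<^bsub>A\<^esub> a, c \<odot>\<^bsub>B\<^esub> b)),
     star = (\<lambda>(a, b). (star A a, star B b)),
     cnorm = (\<lambda>(a, b). max (cnorm A a) (cnorm B b))\<rparr>"

type_synonym qdt = "(complex \<times> complex \<Rightarrow> complex) \<times> rot"

definition qdt_alg :: "real \<Rightarrow> qdt cstar_alg" where
  "qdt_alg \<theta> = direct_sum torus_alg (rotation_alg \<theta>)"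

definition qdt_A :: "real \<Rightarrow> qdt" where
  "qdt_A \<theta> = (torus_fst, \<zero>\<^bsub>rotation_alg \<theta>\<^esub>)"

definition qdt_B :: "real \<Rightarrow> qdt" where
  "qdt_B \<theta> = (\<zero>\<^bsub>torus_alg\<^esub>, rot_unitary \<theta> GenB)"

definition qdt_C :: "real \<Rightarrow> qdt" where
  "qdt_C \<theta> = (\<zero>\<^bsub>torus_alg\<^esub>, rot_unitary \<theta> GenC)"

definition qdt_D :: "real \<Rightarrow> qdt" where
  "qdt_D \<theta> = (torus_snd, \<zero>\<^bsub>rotation_alg \<theta>\<^esub>)"

text \<open>The matrix \<open>V\<close> with rows \<open>(A, C)\<close> and \<open>(B, D)\<close>, with indices in \<open>{1, 2}\<close>.\<close>

definition qdt_V :: "real \<Rightarrow> nat \<Rightarrow> nat \<Rightarrow> qdt" where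
  "qdt_V \<theta> i j =
    (if i = 1 then (if j = 1 then qdt_A \<theta> else qdt_C \<theta>)
     else (if j = 1 then qdt_B \<theta> else qdt_D \<theta>))"

text \<open>\<open>A, B, C, D\<close> generate the algebra, so at most one comultiplication (up to its values off
  the carrier) satisfies the last condition.\<close>

definition is_quantum_double_torus :: "real \<Rightarrow> qdt quantum_group \<Rightarrow> bool" where
  "is_quantum_double_torus \<theta> G \<longleftrightarrow>
    compact_quantum_group G \<and> fun_alg G = qdt_alg \<theta> \<and>
    (\<forall>i\<in>{1, 2}. \<forall>j\<in>{1, 2}.
       comult G (qdt_V \<theta> i j) =
       (\<Oplus>\<^bsub>min_tensor (qdt_alg \<theta>) (qdt_alg \<theta>)\<^esub>k\<in>{1, 2}.
          elem_tensor (qdt_alg \<theta>) (qdt_alg \<theta>) (qdt_V \<theta> i k) (qdt_V \<theta> k j)))"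

end

theory Submission
  imports Defs
begin

text \<open>Let \<open>\<Phi>\<close> be the quotient map onto \<open>C\<^sup>*(\<Lambda>)\<close> and let \<open>a, b, c\<close> be the images of \<open>A, B, C\<close>.
  Then \<open>\<Delta>(a) = a \<otimes> a + c \<otimes> b\<close>, and \<open>\<Delta>\<close> is invariant under the flip because it is so on group
  elements; hence \<open>c \<otimes> b = b \<otimes> c\<close>. Applying states shows that \<open>b\<close> and \<open>c\<close> are proportional, up to
  the ideal of elements annihilated by all states, so they commute modulo that ideal. As
  \<open>bc = exp(\<i>\<theta>) cb\<close> with \<open>exp(\<i>\<theta>) \<noteq> 1\<close> and \<open>B, C\<close> are unitaries of the second summand, \<open>\<Phi>\<close> maps
  this summand, which contains all commutators, into the ideal. The canonical trace then shows that \<open>\<Lambda>\<close> is abelian.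

  The C*-seminorms needed for this are suprema of GNS norms of positive functionals, which come from positive semidefinite kernels. This covers the trace of a group algebra, a vector
  state of the rotation algebra (so that this algebra is not zero), and, by Schur's product
  theorem, products of states.\<close>


section \<open>Complex *-algebras\<close>

text \<open>Elements of a C*-algebra are compared only through states, and elements of the minimal
  tensor product only through product states. Identities therefore come out modulo the elements
  killed by all states; that these form a two-sided ideal allows multiplication by adjoints, and the
  trace, a single state, still tells group elements apart. Flip invariance is likewise a statement
  about states: \<open>\<phi> \<otimes> \<psi>\<close> and \<open>\<psi> \<otimes> \<phi>\<close>,
  composed with the comultiplication of the dual, are two states that agree on group elements, and
  continuity makes them equal. The obstacle is that the norms are suprema of sets of reals, which
  carry no information until the sets are bounded. For the spatial norm this requires left
  multiplication to be bounded in every GNS space, with one constant for all states. It follows from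
  writing \<open>4 ||x||^2 - x* x\<close> as \<open>t* t\<close>; the square root comes from a
  contraction available only for small elements, whence 4 in place of 1. A tensor product needs this
  as an identity between kernels, since Schur's theorem speaks of kernels and not of norms.\<close>

lemma complex_ring_simps [simp]:
  "carrier complex_ring = UNIV" "mult complex_ring = (*)" "one complex_ring = 1"
  "zero complex_ring = 0" "add complex_ring = (+)"
  by (simp_all add: complex_ring_def)

lemma cring_complex_ring: "cring complex_ring"
proof (intro cringI abelian_groupI comm_monoidI; simp add: algebra_simps)
  show "\<exists>y. x + y = 0" for x :: complex by (intro exI[of _ "- x"]) simp
qed

lemma complex_ring_uminus [simp]: "\<ominus>\<^bsub>complex_ring\<^esub> c = - c"
proof -
  interpret cring complex_ring by (rule cring_complex_ring)
  show ?thesis using l_neg[of c] by (simp add: eq_neg_iff_add_eq_0)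
qed

text \<open>Additive inverses come from scalar multiplication by -1, so an instance has to supply
  only closure and equational laws.\<close>

lemma star_algebraI:
  fixes A (structure)
  assumes zero: "\<zero> \<in> carrier A" and one: "\<one> \<in> carrier A"
    and add: "\<And>x y. \<lbrakk>x \<in> carrier A; y \<in> carrier A\<rbrakk> \<Longrightarrow> x \<oplus> y \<in> carrier A"
    and mult: "\<And>x y. \<lbrakk>x \<in> carrier A; y \<in> carrier A\<rbrakk> \<Longrightarrow> x \<otimes> y \<in> carrier A"
    and smult: "\<And>c x. x \<in> carrier A \<Longrightarrow> c \<odot> x \<in> carrier A"
    and star: "\<And>x. x \<in> carrier A \<Longrightarrow> star A x \<in> carrier A"
    and add_assoc: "\<And>x y z. \<lbrakk>x \<in> carrier A; y \<in> carrier A; z \<in> carrier A\<rbrakk> \<Longrightarrow> (x \<oplus> y) \<oplus> z = x \<oplus> (y \<oplus> z)"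
    and add_comm: "\<And>x y. \<lbrakk>x \<in> carrier A; y \<in> carrier A\<rbrakk> \<Longrightarrow> x \<oplus> y = y \<oplus> x"
    and add_zero: "\<And>x. x \<in> carrier A \<Longrightarrow> \<zero> \<oplus> x = x"
    and mult_assoc: "\<And>x y z. \<lbrakk>x \<in> carrier A; y \<in> carrier A; z \<in> carrier A\<rbrakk> \<Longrightarrow> (x \<otimes> y) \<otimes> z = x \<otimes> (y \<otimes> z)"
    and one_left: "\<And>x. x \<in> carrier A \<Longrightarrow> \<one> \<otimes> x = x"
    and one_right: "\<And>x. x \<in> carrier A \<Longrightarrow> x \<otimes> \<one> = x"
    and distr_left: "\<And>x y z. \<lbrakk>x \<in> carrier A; y \<in> carrier A; z \<in> carrier A\<rbrakk> \<Longrightarrow> (x \<oplus> y) \<otimes> z = x \<otimes> z \<oplus> y \<otimes> z"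
    and distr_right: "\<And>x y z. \<lbrakk>x \<in> carrier A; y \<in> carrier A; z \<in> carrier A\<rbrakk> \<Longrightarrow> z \<otimes> (x \<oplus> y) = z \<otimes> x \<oplus> z \<otimes> y"
    and smult_zero: "\<And>x. x \<in> carrier A \<Longrightarrow> 0 \<odot> x = \<zero>"
    and smult_one: "\<And>x. x \<in> carrier A \<Longrightarrow> 1 \<odot> x = x"
    and smult_add: "\<And>c x y. \<lbrakk>x \<in> carrier A; y \<in> carrier A\<rbrakk> \<Longrightarrow> c \<odot> (x \<oplus> y) = c \<odot> x \<oplus> c \<odot> y"
    and add_smult: "\<And>c d x. x \<in> carrier A \<Longrightarrow> (c + d) \<odot> x = c \<odot> x \<oplus> d \<odot> x"
    and smult_smult: "\<And>c d x. x \<in> carrier A \<Longrightarrow> (c * d) \<odot> x = c \<odot> (d \<odot> x)"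
    and smult_left: "\<And>c x y. \<lbrakk>x \<in> carrier A; y \<in> carrier A\<rbrakk> \<Longrightarrow> (c \<odot> x) \<otimes> y = c \<odot> (x \<otimes> y)"
    and smult_right: "\<And>c x y. \<lbrakk>x \<in> carrier A; y \<in> carrier A\<rbrakk> \<Longrightarrow> x \<otimes> (c \<odot> y) = c \<odot> (x \<otimes> y)"
    and star_star: "\<And>x. x \<in> carrier A \<Longrightarrow> star A (star A x) = x"
    and star_add: "\<And>x y. \<lbrakk>x \<in> carrier A; y \<in> carrier A\<rbrakk> \<Longrightarrow> star A (x \<oplus> y) = star A x \<oplus> star A y"
    and star_smult: "\<And>c x. x \<in> carrier A \<Longrightarrow> star A (c \<odot> x) = cnj c \<odot> star A x"
    and star_mult: "\<And>x y. \<lbrakk>x \<in> carrier A; y \<in> carrier A\<rbrakk> \<Longrightarrow> star A (x \<otimes> y) = star A y \<otimes> star A x"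
  shows "star_algebra A"
proof -
  have inv: "\<exists>y\<in>carrier A. y \<oplus> x = \<zero>" if x: "x \<in> carrier A" for x
  proof (rule bexI[of _ "(- 1) \<odot> x"])
    have "(- 1) \<odot> x \<oplus> x = (- 1 + 1) \<odot> x"
      using x by (simp only: add_smult smult_one)
    then show "(- 1) \<odot> x \<oplus> x = \<zero>" using x by (simp add: smult_zero)
  qed (use x smult in auto)
  have ag: "abelian_group A"
    by (rule abelian_groupI) (rule assms inv | assumption)+
  have "monoid A"
    by (intro monoidI) (rule assms | assumption)+
  with ag have "ring A"
    by (intro ringI) (rule assms | assumption)+
  moreover have "Module.module complex_ring A"
    by (rule moduleI) (simp_all add: ag cring_complex_ring smult smult_add add_smult smult_smult smult_one)
  ultimately show ?thesis
    by (intro star_algebra.intro star_algebra_axioms.intro) (rule assms | assumption)+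
qed

context star_algebra
begin

lemma is_ring: "ring A" and is_module: "Module.module complex_ring A"
  by unfold_locales

lemmas a_rules = ring.ring_simprules[OF is_ring]

lemma smult_closed [simp, intro]: "x \<in> carrier A \<Longrightarrow> c \<odot> x \<in> carrier A"
  using module.smult_closed[OF is_module] by auto

declare star_closed [simp, intro]

lemma
  assumes "x \<in> carrier A"
  shows zero_smult [simp]: "0 \<odot> x = \<zero>" and one_smult [simp]: "1 \<odot> x = x"
    and add_smult: "(c + d) \<odot> x = c \<odot> x \<oplus> d \<odot> x"
    and smult_smult: "c \<odot> (d \<odot> x) = (c * d) \<odot> x"
    and uminus_smult: "(- c) \<odot> x = \<ominus> (c \<odot> x)"
  using module.smult_l_null[OF is_module assms] module.smult_one[OF is_module assms]
    module.smult_l_distr[OF is_module _ _ assms, of c d]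
    module.smult_assoc1[OF is_module _ _ assms, of c d]
    module.smult_l_minus[OF is_module _ assms, of c]
  by simp_all

lemma smult_zero [simp]: "c \<odot> \<zero> = \<zero>"
  using module.smult_r_null[OF is_module] by auto

lemma smult_add:
  "\<lbrakk>x \<in> carrier A; y \<in> carrier A\<rbrakk> \<Longrightarrow> c \<odot> (x \<oplus> y) = c \<odot> x \<oplus> c \<odot> y"
  using module.smult_r_distr[OF is_module] by auto

lemma uminus_conv: "x \<in> carrier A \<Longrightarrow> \<ominus> x = (- 1) \<odot> x"
  by (simp add: uminus_smult)

lemma minus_conv: "\<lbrakk>x \<in> carrier A; y \<in> carrier A\<rbrakk> \<Longrightarrow> x \<ominus> y = x \<oplus> (- 1) \<odot> y"
  by (simp add: uminus_smult a_rules)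

lemma star_zero [simp]: "star A \<zero> = \<zero>"
  by (metis a_rules(2) star_closed zero_smult star_smult complex_cnj_zero)

lemma star_one [simp]: "star A \<one> = \<one>"
proof -
  have "star A \<one> = star A \<one> \<otimes> star A (star A \<one>)"
    by (simp add: star_star a_rules)
  also have "\<dots> = star A (star A \<one> \<otimes> \<one>)"
    by (subst star_mult) auto
  also have "\<dots> = \<one>" by (simp add: star_star a_rules)
  finally show ?thesis .
qed

lemma star_minus: "\<lbrakk>x \<in> carrier A; y \<in> carrier A\<rbrakk> \<Longrightarrow> star A (x \<ominus> y) = star A x \<ominus> star A y"
  by (simp add: minus_conv star_add star_smult)

lemma minus_self [simp]: "x \<in> carrier A \<Longrightarrow> x \<ominus> x = \<zero>"
  by (simp add: a_rules)

lemma minus_eq_zero_iff: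
  assumes "x \<in> carrier A" "y \<in> carrier A"
  shows "x \<ominus> y = \<zero> \<longleftrightarrow> x = y"
proof
  assume "x \<ominus> y = \<zero>"
  moreover have "x \<ominus> y \<oplus> y = x" using assms by (simp add: a_rules)
  ultimately show "x = y" using assms by (simp add: a_rules)
qed (use assms in simp)

end


section \<open>Positive semidefinite kernels\<close>

text \<open>Membership in \<open>\<real>\<^sub>\<ge>\<^sub>0\<close> includes that the sums are
  real, and over the complex numbers this already forces hermitian symmetry. The first index is the
  conjugate-linear one, to match the kernel \<open>\<omega> (star A x \<otimes> y)\<close>.\<close>

definition psd_kernel :: "'i set \<Rightarrow> ('i \<Rightarrow> 'i \<Rightarrow> complex) \<Rightarrow> bool" where
  "psd_kernel I k \<longleftrightarrow>
    (\<forall>F c. finite F \<and> F \<subseteq> I \<longrightarrow> (\<Sum>i\<in>F. \<Sum>j\<in>F. cnj (c i) * c j * k i j) \<in> \<real>\<^sub>\<ge>\<^sub>0)"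

lemma psd_kernelD:
  "\<lbrakk>psd_kernel I k; finite F; F \<subseteq> I\<rbrakk> \<Longrightarrow> (\<Sum>i\<in>F. \<Sum>j\<in>F. cnj (c i) * c j * k i j) \<in> \<real>\<^sub>\<ge>\<^sub>0"
  by (auto simp: psd_kernel_def)

lemma psd_kernel_subset: "\<lbrakk>psd_kernel I k; J \<subseteq> I\<rbrakk> \<Longrightarrow> psd_kernel J k"
  by (auto simp: psd_kernel_def)

lemma psd_kernel_add:
  "\<lbrakk>psd_kernel I k; psd_kernel I l\<rbrakk> \<Longrightarrow> psd_kernel I (\<lambda>i j. k i j + l i j)"
  by (auto simp: psd_kernel_def distrib_left sum.distrib intro!: nonneg_Reals_add_I)

lemma psd_kernel_mult_const:
  assumes "psd_kernel I k" "0 \<le> r"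
  shows "psd_kernel I (\<lambda>i j. complex_of_real r * k i j)"
  unfolding psd_kernel_def
proof (intro allI impI)
  fix F and c :: "'a \<Rightarrow> complex" assume F: "finite F \<and> F \<subseteq> I"
  have "(\<Sum>i\<in>F. \<Sum>j\<in>F. cnj (c i) * c j * (complex_of_real r * k i j)) =
        complex_of_real r * (\<Sum>i\<in>F. \<Sum>j\<in>F. cnj (c i) * c j * k i j)"
    by (simp add: sum_distrib_left ac_simps)
  then show "(\<Sum>i\<in>F. \<Sum>j\<in>F. cnj (c i) * c j * (complex_of_real r * k i j)) \<in> \<real>\<^sub>\<ge>\<^sub>0"
    using psd_kernelD[OF assms(1), of F c] F assms(2) by (auto intro!: nonneg_Reals_mult_I)
qed

lemma psd_kernel_diag: "\<lbrakk>psd_kernel I k; i \<in> I\<rbrakk> \<Longrightarrow> k i i \<in> \<real>\<^sub>\<ge>\<^sub>0"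
  using psd_kernelD[of I k "{i}" "\<lambda>_. 1"] by simp

text \<open>The indices may coincide; a sum over the set \<open>{i, j}\<close> then has a single
  term, and the two weights add up.\<close>

lemma psd_kernel_pair:
  assumes "psd_kernel I k" "i \<in> I" "j \<in> I"
  shows "cnj a * a * k i i + cnj a * b * k i j + cnj b * a * k j i + cnj b * b * k j j \<in> \<real>\<^sub>\<ge>\<^sub>0"
proof (cases "i = j")
  case True
  have "cnj a * a * k i i + cnj a * b * k i j + cnj b * a * k j i + cnj b * b * k j j =
        cnj (a + b) * (a + b) * k j j"
    by (simp add: True algebra_simps)
  then show ?thesis
    using psd_kernelD[OF assms(1), of "{j}" "\<lambda>_. a + b"] assms(3) by simp
next
  case False
  then show ?thesis
    using psd_kernelD[OF assms(1), of "{i, j}" "\<lambda>x. if x = i then a else b"] assms(2,3)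
    by (simp add: add.assoc)
qed

text \<open>Real sums for the weights (1, 1) make the imaginary parts opposite, and for the weights
  (1, i) they make the real parts equal.\<close>

lemma psd_kernel_hermitian:
  assumes "psd_kernel I k" "i \<in> I" "j \<in> I"
  shows "k j i = cnj (k i j)"
  using psd_kernel_pair[OF assms, of 1 1] psd_kernel_pair[OF assms, of 1 \<i>]
    psd_kernel_diag[OF assms(1,2)] psd_kernel_diag[OF assms(1,3)]
  by (auto simp: complex_nonneg_Reals_iff complex_eq_iff)

lemma psd_kernel_cauchy_schwarz:
  assumes k: "psd_kernel I k" "i \<in> I" "j \<in> I"
  shows "(cmod (k i j))\<^sup>2 \<le> Re (k i i) * Re (k j j)"
proof (cases "k i j = 0")
  case True
  then show ?thesis
    using psd_kernel_diag[OF k(1,2)] psd_kernel_diag[OF k(1,3)]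
    by (simp add: complex_nonneg_Reals_iff)
next
  case False
  define P R z where "P = Re (k i i)" "R = Re (k j j)" "z = k i j"
  have kii: "k i i = of_real P" and kjj: "k j j = of_real R" and R: "0 \<le> R"
    using psd_kernel_diag[OF k(1,2)] psd_kernel_diag[OF k(1,3)]
    by (auto simp: complex_nonneg_Reals_iff complex_eq_iff P_R_z_def)
  have kji: "k j i = cnj z"
    using psd_kernel_hermitian[OF k] by (simp add: P_R_z_def)
  have z: "z \<noteq> 0" "k i j = z" using False by (auto simp: P_R_z_def)
  \<comment> \<open>With the weights 1 and \<open>- s * cnj z\<close> the phase of \<open>z\<close>
    cancels, which leaves a real quadratic polynomial in \<open>s\<close>. Its minimum, at
    \<open>s = 1 / R\<close>, gives the claim.\<close>
  have pos: "0 \<le> P + R * s\<^sup>2 * (cmod z)\<^sup>2 - 2 * s * (cmod z)\<^sup>2" for s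
  proof -
    have "cnj 1 * 1 * k i i + cnj 1 * (- of_real s * cnj z) * k i j
        + cnj (- of_real s * cnj z) * 1 * k j i
        + cnj (- of_real s * cnj z) * (- of_real s * cnj z) * k j j =
        of_real P - 2 * of_real s * (z * cnj z) + of_real R * (of_real s)\<^sup>2 * (z * cnj z)"
      by (simp add: kii kjj kji z(2) algebra_simps power2_eq_square)
    also have "\<dots> = of_real (P + R * s\<^sup>2 * (cmod z)\<^sup>2 - 2 * s * (cmod z)\<^sup>2)"
      by (simp flip: complex_norm_square)
    finally show ?thesis
      using psd_kernel_pair[OF k, of 1 "- of_real s * cnj z"]
      by (metis complex_nonneg_Reals_iff Re_complex_of_real)
  qed
  \<comment> \<open>For \<open>R = 0\<close> the polynomial is affine with negative slope. At the
    point chosen below its value is - P - 2, while P is nonnegative by the value at 0.\<close>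
  have "R \<noteq> 0"
  proof
    assume "R = 0"
    with pos[of "(P + 1) / (cmod z)\<^sup>2"] pos[of 0] z show False by simp
  qed
  with R have "0 < R" by simp
  have "0 \<le> P - (cmod z)\<^sup>2 / R"
    using pos[of "1 / R"] \<open>0 < R\<close> by (simp add: field_simps power2_eq_square)
  then show ?thesis
    using \<open>0 < R\<close> by (simp add: field_simps flip: P_R_z_def)
qed

text \<open>A kernel on indices becomes a kernel on linear combinations of indices taken over
  \<open>F\<close>, which makes the Cauchy-Schwarz inequality available for combinations.\<close>

lemma psd_kernel_lift:
  assumes k: "psd_kernel I k" and F: "finite F" "F \<subseteq> I"
  shows "psd_kernel UNIV (\<lambda>c d. \<Sum>i\<in>F. \<Sum>j\<in>F. cnj (c i) * d j * k i j)"
  unfolding psd_kernel_def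
proof (intro allI impI)
  fix M :: "('a \<Rightarrow> complex) set" and a assume "finite M \<and> M \<subseteq> UNIV"
  define e where "e i = (\<Sum>c\<in>M. a c * c i)" for i
  have "(\<Sum>c\<in>M. \<Sum>d\<in>M. cnj (a c) * a d * (\<Sum>i\<in>F. \<Sum>j\<in>F. cnj (c i) * d j * k i j)) =
        (\<Sum>c\<in>M. \<Sum>i\<in>F. \<Sum>j\<in>F. \<Sum>d\<in>M. cnj (a c) * a d * (cnj (c i) * d j * k i j))"
    unfolding sum_distrib_left
    by (intro sum.cong refl, subst sum.swap, intro sum.cong refl sum.swap)
  also have "\<dots> = (\<Sum>i\<in>F. \<Sum>j\<in>F. \<Sum>c\<in>M. \<Sum>d\<in>M. cnj (a c) * a d * (cnj (c i) * d j * k i j))"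
    by (subst sum.swap, intro sum.cong refl sum.swap)
  also have "\<dots> = (\<Sum>i\<in>F. \<Sum>j\<in>F. cnj (e i) * e j * k i j)"
  proof (intro sum.cong refl)
    fix i j
    show "(\<Sum>c\<in>M. \<Sum>d\<in>M. cnj (a c) * a d * (cnj (c i) * d j * k i j)) = cnj (e i) * e j * k i j"
      unfolding e_def cnj_sum sum_product by (simp add: sum_distrib_left ac_simps)
  qed
  also have "\<dots> \<in> \<real>\<^sub>\<ge>\<^sub>0" by (rule psd_kernelD[OF k F])
  finally show "(\<Sum>c\<in>M. \<Sum>d\<in>M. cnj (a c) * a d * (\<Sum>i\<in>F. \<Sum>j\<in>F. cnj (c i) * d j * k i j)) \<in> \<real>\<^sub>\<ge>\<^sub>0" .
qed

text \<open>When the pivot \<open>k p p\<close> vanishes, so does its row, and the division by zero is harmless.\<close>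

lemma psd_kernel_schur_complement:
  assumes k: "psd_kernel I k" and p: "p \<in> I"
  shows "psd_kernel I (\<lambda>i j. k i j - k i p * k p j / k p p)"
  unfolding psd_kernel_def
proof (intro allI impI)
  fix F and c :: "'a \<Rightarrow> complex" assume "finite F \<and> F \<subseteq> I"
  then have F: "finite F" "F \<subseteq> I" by auto
  define K where "K c d = (\<Sum>i\<in>insert p F. \<Sum>j\<in>insert p F. cnj (c i) * d j * k i j)" for c d
  \<comment> \<open>\<open>p\<close> may or may not lie in \<open>F\<close>. Cutting off the weights
    outside \<open>F\<close> lets every sum run over \<open>insert p F\<close>; \<open>u\<close> is
    the unit vector at \<open>p\<close>.\<close>
  define c' where "c' = (\<lambda>i. if i \<in> F then c i else 0)"
  define u where "u = (\<lambda>i. if i = p then 1 else 0 :: complex)"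
  define s where "s = (\<Sum>j\<in>F. c j * k p j)"
  have K: "psd_kernel UNIV K"
    unfolding K_def using psd_kernel_lift[OF k, of "insert p F"] F p by simp
  have red: "(\<Sum>j\<in>insert p F. c' j * f j) = (\<Sum>j\<in>F. c j * f j)"
    "(\<Sum>j\<in>insert p F. cnj (c' j) * f j) = (\<Sum>j\<in>F. cnj (c j) * f j)" for f
    by (rule sum.mono_neutral_cong_right; use F in \<open>auto simp: c'_def\<close>)+
  have redu: "(\<Sum>j\<in>insert p F. u j * f j) = f p" "(\<Sum>j\<in>insert p F. cnj (u j) * f j) = f p" for f
    by (subst sum.mono_neutral_cong_right[where S = "{p}" and h = f]; use F in \<open>auto simp: u_def\<close>)+
  have Kalt: "K c d = (\<Sum>i\<in>insert p F. cnj (c i) * (\<Sum>j\<in>insert p F. d j * k i j))" for c d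
    by (simp add: K_def sum_distrib_left mult.assoc del: sum.insert)
  have Kcc: "K c' c' = (\<Sum>i\<in>F. \<Sum>j\<in>F. cnj (c i) * c j * k i j)"
    unfolding Kalt red by (simp add: sum_distrib_left mult.assoc)
  have Kuc: "K u c' = s" and Kuu: "K u u = k p p"
    unfolding Kalt red redu by (simp_all add: s_def)
  have "(\<Sum>i\<in>F. \<Sum>j\<in>F. cnj (c i) * c j * (k i j - k i p * k p j / k p p)) =
        K c' c' - (\<Sum>i\<in>F. cnj (c i) * k i p) * s / k p p"
    unfolding Kcc s_def right_diff_distrib sum_subtractf sum_product sum_divide_distrib
    by (simp add: ac_simps)
  also have "(\<Sum>i\<in>F. cnj (c i) * k i p) = cnj s"
    unfolding s_def cnj_sum complex_cnj_mult
    using psd_kernel_hermitian[OF k p] F by (intro sum.cong) auto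
  finally have eq: "(\<Sum>i\<in>F. \<Sum>j\<in>F. cnj (c i) * c j * (k i j - k i p * k p j / k p p)) =
        K c' c' - (cmod s)\<^sup>2 / k p p"
    using complex_norm_square[of s] by (simp add: mult.commute)
  have kpp: "k p p = of_real (Re (k p p))" "0 \<le> Re (k p p)"
    using psd_kernel_diag[OF k p] by (auto simp: complex_nonneg_Reals_iff complex_eq_iff)
  have Kr: "K c' c' = of_real (Re (K c' c'))" "0 \<le> Re (K c' c')"
    using psd_kernel_diag[OF K, of c'] by (auto simp: complex_nonneg_Reals_iff complex_eq_iff)
  \<comment> \<open>Cauchy-Schwarz for \<open>u\<close> and \<open>c'\<close>, divided by
    \<open>k p p\<close>, is the required inequality.\<close>
  have "(cmod s)\<^sup>2 \<le> Re (k p p) * Re (K c' c')"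
    using psd_kernel_cauchy_schwarz[OF K, of u c'] by (simp add: Kuc Kuu)
  then have "(cmod s)\<^sup>2 / Re (k p p) \<le> Re (K c' c')"
    using kpp(2) Kr(2) by (cases "Re (k p p) = 0") (auto simp: field_simps)
  moreover have "K c' c' - (cmod s)\<^sup>2 / k p p = of_real (Re (K c' c') - (cmod s)\<^sup>2 / Re (k p p))"
    by (subst kpp(1), subst Kr(1)) simp
  ultimately show "(\<Sum>i\<in>F. \<Sum>j\<in>F. cnj (c i) * c j * (k i j - k i p * k p j / k p p)) \<in> \<real>\<^sub>\<ge>\<^sub>0"
    unfolding eq by (simp only: nonneg_Reals_of_real_iff)
qed

text \<open>Induction on the finite set, removing a pivot \<open>p\<close>. Here \<open>k\<close> is
  the sum of two parts. The Schur complement \<open>k'\<close> has vanishing row and column at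
  \<open>p\<close>, so the induction hypothesis applies to the remaining indices. The other part has
  rank at most one, and its product with \<open>l\<close> is the form of \<open>l\<close> with the
  weights \<open>c i * k p i\<close>, divided by \<open>k p p\<close>.\<close>

theorem psd_kernel_schur_product:
  assumes "psd_kernel I k" "psd_kernel I l"
  shows "psd_kernel I (\<lambda>i j. k i j * l i j)"
  unfolding psd_kernel_def
proof (intro allI impI)
  fix F and c :: "'a \<Rightarrow> complex" assume "finite F \<and> F \<subseteq> I"
  then have "finite F" "psd_kernel F k" "psd_kernel F l"
    using assms by (auto intro: psd_kernel_subset)
  then show "(\<Sum>i\<in>F. \<Sum>j\<in>F. cnj (c i) * c j * (k i j * l i j)) \<in> \<real>\<^sub>\<ge>\<^sub>0"
  \<comment> \<open>\<open>k\<close> varies because the induction step passes to its Schur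
    complement.\<close>
  proof (induction F arbitrary: k)
    case (insert p F)
    define k' where "k' = (\<lambda>i j. k i j - k i p * k p j / k p p)"
    have k': "psd_kernel (insert p F) k'"
      unfolding k'_def using psd_kernel_schur_complement[OF insert.prems(1)] by simp
    have row: "k' p j = 0" and col: "k' j p = 0" if "j \<in> insert p F" for j
    proof -
      show "k' p j = 0"
        using psd_kernel_cauchy_schwarz[OF insert.prems(1), of p j] that
        by (cases "k p p = 0") (auto simp: k'_def)
      then show "k' j p = 0"
        using psd_kernel_hermitian[OF k', of p j] that by simp
    qed
    have "(\<Sum>i\<in>insert p F. \<Sum>j\<in>insert p F. cnj (c i) * c j * (k' i j * l i j)) =
          (\<Sum>i\<in>F. \<Sum>j\<in>F. cnj (c i) * c j * (k' i j * l i j))"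
      using insert.hyps row col by simp
    also have "\<dots> \<in> \<real>\<^sub>\<ge>\<^sub>0"
      using insert.IH[of k'] psd_kernel_subset[OF k'] insert.prems psd_kernel_subset by blast
    finally have 1: "(\<Sum>i\<in>insert p F. \<Sum>j\<in>insert p F. cnj (c i) * c j * (k' i j * l i j)) \<in> \<real>\<^sub>\<ge>\<^sub>0" .
    have "(\<Sum>i\<in>insert p F. \<Sum>j\<in>insert p F. cnj (c i * k p i) * (c j * k p j) * l i j) / k p p \<in> \<real>\<^sub>\<ge>\<^sub>0"
      using psd_kernelD[OF insert.prems(2), of "insert p F" "\<lambda>i. c i * k p i"] insert.hyps
        psd_kernel_diag[OF insert.prems(1), of p]
      by (intro nonneg_Reals_divide_I) auto
    moreover have "(\<Sum>i\<in>insert p F. \<Sum>j\<in>insert p F. cnj (c i * k p i) * (c j * k p j) * l i j) / k p p =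
        (\<Sum>i\<in>insert p F. \<Sum>j\<in>insert p F. cnj (c i) * c j * ((k i p * k p j / k p p) * l i j))"
      unfolding sum_divide_distrib
    proof (intro sum.cong refl)
      fix i j assume "i \<in> insert p F"
      then have "k i p = cnj (k p i)"
        using psd_kernel_hermitian[OF insert.prems(1), of p i] by simp
      then show "cnj (c i * k p i) * (c j * k p j) * l i j / k p p =
          cnj (c i) * c j * ((k i p * k p j / k p p) * l i j)" by simp
    qed
    ultimately have "(\<Sum>i\<in>insert p F. \<Sum>j\<in>insert p F. cnj (c i) * c j * (k' i j * l i j)) +
        (\<Sum>i\<in>insert p F. \<Sum>j\<in>insert p F. cnj (c i) * c j * ((k i p * k p j / k p p) * l i j)) \<in> \<real>\<^sub>\<ge>\<^sub>0"
      using nonneg_Reals_add_I[OF 1] by simp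
    then show ?case
      unfolding k'_def sum.distrib[symmetric] by (simp add: algebra_simps del: sum.insert)
  qed simp
qed

text \<open>Points with the same image are merged: \<open>e\<close> adds up their weights.\<close>

lemma psd_kernel_pullback:
  assumes k: "psd_kernel I k" and f: "f ` J \<subseteq> I"
  shows "psd_kernel J (\<lambda>x y. k (f x) (f y))"
  unfolding psd_kernel_def
proof (intro allI impI)
  fix F and c :: "'b \<Rightarrow> complex" assume F: "finite F \<and> F \<subseteq> J"
  define e where "e u = (\<Sum>x | x \<in> F \<and> f x = u. c x)" for u
  have gen: "(\<Sum>x\<in>F. c x * g (f x)) = (\<Sum>u\<in>f ` F. e u * g u)"
    "(\<Sum>x\<in>F. cnj (c x) * g (f x)) = (\<Sum>u\<in>f ` F. cnj (e u) * g u)" for g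
    by (subst sum.image_gen[where g = f], use F in simp, simp add: e_def sum_distrib_right)+
  have "(\<Sum>x\<in>F. \<Sum>y\<in>F. cnj (c x) * c y * k (f x) (f y)) =
      (\<Sum>x\<in>F. cnj (c x) * (\<Sum>y\<in>F. c y * k (f x) (f y)))"
    by (simp add: sum_distrib_left mult.assoc)
  also have "\<dots> = (\<Sum>u\<in>f ` F. cnj (e u) * (\<Sum>v\<in>f ` F. e v * k u v))"
    unfolding gen(1) by (rule gen(2))
  also have "\<dots> = (\<Sum>u\<in>f ` F. \<Sum>v\<in>f ` F. cnj (e u) * e v * k u v)"
    by (simp add: sum_distrib_left mult.assoc)
  also have "\<dots> \<in> \<real>\<^sub>\<ge>\<^sub>0"
    using F f by (intro psd_kernelD[OF k]) auto
  finally show "(\<Sum>x\<in>F. \<Sum>y\<in>F. cnj (c x) * c y * k (f x) (f y)) \<in> \<real>\<^sub>\<ge>\<^sub>0" .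
qed

lemma psd_kernel_cong:
  "\<lbrakk>psd_kernel I k; \<And>x y. \<lbrakk>x \<in> I; y \<in> I\<rbrakk> \<Longrightarrow> k x y = l x y\<rbrakk> \<Longrightarrow> psd_kernel I l"
proof -
  assume k: "psd_kernel I k" and eq: "\<And>x y. \<lbrakk>x \<in> I; y \<in> I\<rbrakk> \<Longrightarrow> k x y = l x y"
  have "(\<Sum>i\<in>F. \<Sum>j\<in>F. cnj (c i) * c j * l i j) = (\<Sum>i\<in>F. \<Sum>j\<in>F. cnj (c i) * c j * k i j)"
    if "F \<subseteq> I" for F c
    using eq that by (intro sum.cong refl) (auto simp: subset_iff)
  with k show "psd_kernel I l" by (simp add: psd_kernel_def)
qed

lemma cnj_mult_nonneg: "cnj z * z \<in> \<real>\<^sub>\<ge>\<^sub>0"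
  by (simp add: complex_nonneg_Reals_iff)

lemma psd_kernel_rank_one: "psd_kernel I (\<lambda>i j. cnj (a i) * a j)"
  unfolding psd_kernel_def
proof (intro allI impI)
  fix F and c :: "'a \<Rightarrow> complex"
  have "(\<Sum>i\<in>F. \<Sum>j\<in>F. cnj (c i) * c j * (cnj (a i) * a j)) = cnj (\<Sum>i\<in>F. c i * a i) * (\<Sum>j\<in>F. c j * a j)"
    unfolding cnj_sum sum_product by (simp add: ac_simps)
  then show "(\<Sum>i\<in>F. \<Sum>j\<in>F. cnj (c i) * c j * (cnj (a i) * a j)) \<in> \<real>\<^sub>\<ge>\<^sub>0"
    by (simp only: cnj_mult_nonneg)
qed

lemma psd_kernel_of_bool_eq: "psd_kernel I (\<lambda>i j. of_bool (i = j))"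
  unfolding psd_kernel_def
proof (intro allI impI)
  fix F and c :: "'a \<Rightarrow> complex" assume F: "finite F \<and> F \<subseteq> I"
  have "(\<Sum>i\<in>F. \<Sum>j\<in>F. cnj (c i) * c j * of_bool (i = j)) = (\<Sum>i\<in>F. cnj (c i) * c i)"
    using F by (simp add: of_bool_def if_distrib[of "(*) _"] cong: if_cong)
  also have "\<dots> \<in> \<real>\<^sub>\<ge>\<^sub>0"
    using F cnj_mult_nonneg by (induction F rule: infinite_finite_induct) (auto intro: nonneg_Reals_add_I)
  finally show "(\<Sum>i\<in>F. \<Sum>j\<in>F. cnj (c i) * c j * of_bool (i = j)) \<in> \<real>\<^sub>\<ge>\<^sub>0" .
qed

text \<open>The Gram kernel of the vectors \<open>a i\<close> times the basis vector with index
  \<open>k i\<close>, the shape in which words act on a basis vector in the rotation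
  algebra.\<close>

lemma psd_kernel_index: "psd_kernel I (\<lambda>i j. of_bool (k i = k j) * (cnj (a i) * a j))"
  by (rule psd_kernel_schur_product[OF psd_kernel_pullback[OF psd_kernel_of_bool_eq, of k I UNIV]
        psd_kernel_rank_one]) simp


section \<open>Positive functionals\<close>

definition positive_functional :: "('a, 'z) star_alg_scheme \<Rightarrow> ('a \<Rightarrow> complex) \<Rightarrow> bool" where
  "positive_functional A \<omega> \<longleftrightarrow>
    (\<forall>x\<in>carrier A. \<forall>y\<in>carrier A. \<omega> (x \<oplus>\<^bsub>A\<^esub> y) = \<omega> x + \<omega> y) \<and>
    (\<forall>c. \<forall>x\<in>carrier A. \<omega> (c \<odot>\<^bsub>A\<^esub> x) = c * \<omega> x) \<and>
    (\<forall>x\<in>carrier A. \<omega> (star A x \<otimes>\<^bsub>A\<^esub> x) \<in> \<real>\<^sub>\<ge>\<^sub>0)"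

lemma state_iff: "state A \<phi> \<longleftrightarrow> positive_functional A \<phi> \<and> \<phi> \<one>\<^bsub>A\<^esub> = 1"
  by (auto simp: state_def positive_functional_def)

definition gns_norm :: "('a, 'z) star_alg_scheme \<Rightarrow> ('a \<Rightarrow> complex) \<Rightarrow> 'a \<Rightarrow> real" where
  "gns_norm A \<omega> x = sqrt (Re (\<omega> (star A x \<otimes>\<^bsub>A\<^esub> x)))"

locale star_algebra_functional = star_algebra +
  fixes \<omega> :: "'a \<Rightarrow> complex"
  assumes pos: "positive_functional A \<omega>"

lemmas star_algebra_functionalI =
  star_algebra_functional.intro[OF _ star_algebra_functional_axioms.intro]

context star_algebra_functional
begin

lemma add: "\<lbrakk>x \<in> carrier A; y \<in> carrier A\<rbrakk> \<Longrightarrow> \<omega> (x \<oplus> y) = \<omega> x + \<omega> y"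
  and smult: "x \<in> carrier A \<Longrightarrow> \<omega> (c \<odot> x) = c * \<omega> x"
  and star_mult_nonneg: "x \<in> carrier A \<Longrightarrow> \<omega> (star A x \<otimes> x) \<in> \<real>\<^sub>\<ge>\<^sub>0"
  using pos by (auto simp: positive_functional_def)

lemma zero: "\<omega> \<zero> = 0"
  using smult[of \<one> 0] by simp

lemma minus: "\<lbrakk>x \<in> carrier A; y \<in> carrier A\<rbrakk> \<Longrightarrow> \<omega> (x \<ominus> y) = \<omega> x - \<omega> y"
  by (simp add: minus_conv add smult)

text \<open>The combination is recorded through its pairings under \<open>\<omega>\<close>, on both
  sides, so that no finite sums have to be formed inside the algebra.\<close>

lemma ex_linear_combination:
  assumes "finite F" "F \<subseteq> carrier A"
  shows "\<exists>z\<in>carrier A. \<forall>w\<in>carrier A. \<omega> (w \<otimes> z) = (\<Sum>x\<in>F. c x * \<omega> (w \<otimes> x)) \<and>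
    \<omega> (star A z \<otimes> w) = (\<Sum>x\<in>F. cnj (c x) * \<omega> (star A x \<otimes> w))"
  using assms
proof (induction F)
  case empty
  show ?case by (rule bexI[of _ \<zero>]) (auto simp: a_rules zero)
next
  case (insert x F)
  then obtain z where "z \<in> carrier A" "x \<in> carrier A"
    "\<forall>w\<in>carrier A. \<omega> (w \<otimes> z) = (\<Sum>x\<in>F. c x * \<omega> (w \<otimes> x)) \<and>
      \<omega> (star A z \<otimes> w) = (\<Sum>x\<in>F. cnj (c x) * \<omega> (star A x \<otimes> w))"
    by auto
  with insert.hyps show ?case
    by (intro bexI[of _ "c x \<odot> x \<oplus> z"])
       (auto simp: add smult smult_mult_left smult_mult_right star_add star_smult a_rules)
qed

lemma psd_kernel: "psd_kernel (carrier A) (\<lambda>x y. \<omega> (star A x \<otimes> y))"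
  unfolding psd_kernel_def
proof (intro allI impI)
  fix F and c :: "'a \<Rightarrow> complex" assume F: "finite F \<and> F \<subseteq> carrier A"
  then obtain z where z: "z \<in> carrier A"
    "\<forall>w\<in>carrier A. \<omega> (w \<otimes> z) = (\<Sum>x\<in>F. c x * \<omega> (w \<otimes> x)) \<and>
      \<omega> (star A z \<otimes> w) = (\<Sum>x\<in>F. cnj (c x) * \<omega> (star A x \<otimes> w))"
    using ex_linear_combination[of F c] by blast
  have "\<omega> (star A z \<otimes> z) = (\<Sum>x\<in>F. cnj (c x) * \<omega> (star A x \<otimes> z))"
    using z by blast
  also have "\<dots> = (\<Sum>x\<in>F. cnj (c x) * (\<Sum>y\<in>F. c y * \<omega> (star A x \<otimes> y)))"
    using z F by (intro sum.cong) (auto simp: subset_iff)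
  also have "\<dots> = (\<Sum>x\<in>F. \<Sum>y\<in>F. cnj (c x) * c y * \<omega> (star A x \<otimes> y))"
    by (simp add: sum_distrib_left mult.assoc)
  finally show "(\<Sum>x\<in>F. \<Sum>y\<in>F. cnj (c x) * c y * \<omega> (star A x \<otimes> y)) \<in> \<real>\<^sub>\<ge>\<^sub>0"
    using star_mult_nonneg[OF z(1)] by (simp only:)
qed

lemma hermitian:
  "\<lbrakk>x \<in> carrier A; y \<in> carrier A\<rbrakk> \<Longrightarrow> \<omega> (star A y \<otimes> x) = cnj (\<omega> (star A x \<otimes> y))"
  by (rule psd_kernel_hermitian[OF psd_kernel])

lemma star: "x \<in> carrier A \<Longrightarrow> \<omega> (star A x) = cnj (\<omega> x)"
  using hermitian[of \<one> x] by (simp add: a_rules)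

lemma gns_norm_nonneg: "x \<in> carrier A \<Longrightarrow> 0 \<le> gns_norm A \<omega> x"
  using star_mult_nonneg[of x] by (simp add: gns_norm_def complex_nonneg_Reals_iff)

lemma gns_norm_square: "x \<in> carrier A \<Longrightarrow> (gns_norm A \<omega> x)\<^sup>2 = Re (\<omega> (star A x \<otimes> x))"
  using star_mult_nonneg[of x] by (simp add: gns_norm_def complex_nonneg_Reals_iff)

lemma star_mult_eq: "x \<in> carrier A \<Longrightarrow> \<omega> (star A x \<otimes> x) = of_real ((gns_norm A \<omega> x)\<^sup>2)"
  using star_mult_nonneg[of x]
  by (auto simp: gns_norm_square complex_nonneg_Reals_iff complex_eq_iff simp del: of_real_power)

lemma cauchy_schwarz:
  assumes "x \<in> carrier A" "y \<in> carrier A"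
  shows "cmod (\<omega> (star A x \<otimes> y)) \<le> gns_norm A \<omega> x * gns_norm A \<omega> y"
proof (rule power2_le_imp_le)
  show "(cmod (\<omega> (star A x \<otimes> y)))\<^sup>2 \<le> (gns_norm A \<omega> x * gns_norm A \<omega> y)\<^sup>2"
    using psd_kernel_cauchy_schwarz[OF psd_kernel assms] assms
    by (simp only: power_mult_distrib gns_norm_square)
qed (use assms gns_norm_nonneg in simp)

lemma gns_norm_smult: "x \<in> carrier A \<Longrightarrow> gns_norm A \<omega> (c \<odot> x) = cmod c * gns_norm A \<omega> x"
proof -
  assume x: "x \<in> carrier A"
  have "\<omega> (star A (c \<odot> x) \<otimes> (c \<odot> x)) = (c * cnj c) * \<omega> (star A x \<otimes> x)"
    using x by (simp add: star_smult smult_mult_left smult_mult_right smult)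
  also have "c * cnj c = of_real ((cmod c)\<^sup>2)" by (rule complex_norm_square[symmetric])
  finally show ?thesis
    by (simp add: gns_norm_def real_sqrt_mult del: of_real_power)
qed

lemma gns_norm_triangle:
  assumes "x \<in> carrier A" "y \<in> carrier A"
  shows "gns_norm A \<omega> (x \<oplus> y) \<le> gns_norm A \<omega> x + gns_norm A \<omega> y"
proof (rule power2_le_imp_le)
  have "(gns_norm A \<omega> (x \<oplus> y))\<^sup>2 =
      Re (\<omega> (star A x \<otimes> x)) + Re (\<omega> (star A x \<otimes> y)) + Re (\<omega> (star A y \<otimes> x)) + Re (\<omega> (star A y \<otimes> y))"
    using assms by (simp add: gns_norm_square star_add a_rules add)
  also have "\<dots> \<le> (gns_norm A \<omega> x + gns_norm A \<omega> y)\<^sup>2"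
    using complex_Re_le_cmod[of "\<omega> (star A x \<otimes> y)"] complex_Re_le_cmod[of "\<omega> (star A y \<otimes> x)"]
      cauchy_schwarz[OF assms] cauchy_schwarz[OF assms(2,1)] assms
    by (simp add: power2_sum gns_norm_square algebra_simps)
  finally show "(gns_norm A \<omega> (x \<oplus> y))\<^sup>2 \<le> (gns_norm A \<omega> x + gns_norm A \<omega> y)\<^sup>2" .
qed (use assms gns_norm_nonneg in auto)

end

section \<open>C*-seminorms from families of positive functionals\<close>

lemma (in star_algebra) cstar_seminormI:
  assumes nonneg: "\<And>x. x \<in> carrier A \<Longrightarrow> 0 \<le> p x"
    and add: "\<And>x y. \<lbrakk>x \<in> carrier A; y \<in> carrier A\<rbrakk> \<Longrightarrow> p (x \<oplus> y) \<le> p x + p y"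
    and smult: "\<And>c x. x \<in> carrier A \<Longrightarrow> p (c \<odot> x) \<le> cmod c * p x"
    and mult: "\<And>x y. \<lbrakk>x \<in> carrier A; y \<in> carrier A\<rbrakk> \<Longrightarrow> p (x \<otimes> y) \<le> p x * p y"
    and square: "\<And>x. x \<in> carrier A \<Longrightarrow> (p x)\<^sup>2 \<le> p (star A x \<otimes> x)"
  shows "cstar_seminorm A p"
proof -
  \<comment> \<open>From \<open>(p x)\<^sup>2 \<le> p (star A x \<otimes> x) \<le> p (star A x) * p
    x\<close>. Applied also to \<open>star A x\<close>, this makes the star isometric and turns the
    inequality for squares into the C*-identity.\<close>
  have star_le: "p x \<le> p (star A x)" if x: "x \<in> carrier A" for x
  proof (cases "p x = 0")
    case True
    then show ?thesis using x nonneg[of "star A x"] by simp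
  next
    case False
    then have "p x * p x \<le> p (star A x) * p x"
      using square[OF x] mult[of "star A x" x] x by (simp add: power2_eq_square)
    then show ?thesis using False nonneg[OF x] by simp
  qed
  have "p (star A x \<otimes> x) = (p x)\<^sup>2" if x: "x \<in> carrier A" for x
    using star_le[OF x] star_le[of "star A x"] square[OF x] mult[of "star A x" x] x
    by (simp add: star_star power2_eq_square)
  moreover have "p (c \<odot> x) = cmod c * p x" if x: "x \<in> carrier A" for c x
  proof (cases "c = 0")
    case True
    then show ?thesis using smult[OF x, of 0] nonneg[of "\<zero>"] x by simp
  next
    case False
    have "p x \<le> cmod (inverse c) * p (c \<odot> x)"
      using smult[of "c \<odot> x" "inverse c"] x False by (simp add: smult_smult)
    then have "cmod c * p x \<le> p (c \<odot> x)"
      using False by (simp add: norm_divide field_simps)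
    then show ?thesis using smult[OF x, of c] by simp
  qed
  ultimately show ?thesis
    using nonneg add mult by (simp add: cstar_seminorm_def)
qed

text \<open>The supremum of the operator norms of \<open>t\<close> in the GNS representations of the
  functionals in \<open>W\<close>. The normalization of \<open>y\<close> is written as in
  \<open>spatial_seminorm\<close>, which thereby becomes an instance.\<close>

definition functional_seminorm ::
  "('a, 'z) star_alg_scheme \<Rightarrow> ('a \<Rightarrow> complex) set \<Rightarrow> 'a \<Rightarrow> real" where
  "functional_seminorm A W t =
    Sup {gns_norm A \<omega> (t \<otimes>\<^bsub>A\<^esub> y) | \<omega> y. \<omega> \<in> W \<and> y \<in> carrier A \<and> \<omega> (star A y \<otimes>\<^bsub>A\<^esub> y) = 1}"

text \<open>\<open>bounded\<close> asks for a constant that serves all functionals at once, since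
  the supremum in \<open>functional_seminorm\<close> runs over all of them. \<open>unital\<close>
  keeps the set under that supremum nonempty and provides the test vector 1.\<close>

locale functional_family = star_algebra +
  fixes W :: "('a \<Rightarrow> complex) set"
  assumes positive: "\<omega> \<in> W \<Longrightarrow> positive_functional A \<omega>"
    and bounded: "t \<in> carrier A \<Longrightarrow>
      \<exists>K. \<forall>\<omega>\<in>W. \<forall>y\<in>carrier A. gns_norm A \<omega> (t \<otimes> y) \<le> K * gns_norm A \<omega> y"
    and unital: "\<exists>\<omega>\<in>W. \<omega> \<one> = 1"
begin

abbreviation p where "p \<equiv> functional_seminorm A W"

lemma functional: "\<omega> \<in> W \<Longrightarrow> star_algebra_functional A \<omega>"
  by (simp add: positive star_algebra_axioms star_algebra_functionalI)

lemma gns_norm_eq_1: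
  assumes "\<omega> \<in> W" "y \<in> carrier A"
  shows "\<omega> (star A y \<otimes> y) = 1 \<longleftrightarrow> gns_norm A \<omega> y = 1"
proof -
  interpret star_algebra_functional A \<omega> using assms(1) by (rule functional)
  show ?thesis
    using gns_norm_nonneg[OF assms(2)]
    by (simp add: star_mult_eq[OF assms(2)] power2_eq_1_iff del: of_real_power)
qed

lemma gns_norm_mult_le:
  assumes \<omega>: "\<omega> \<in> W" and t: "t \<in> carrier A" and y: "y \<in> carrier A"
  shows "gns_norm A \<omega> (t \<otimes> y) \<le> p t * gns_norm A \<omega> y"
proof -
  interpret star_algebra_functional A \<omega> using \<omega> by (rule functional)
  obtain K where K: "\<And>\<omega> y. \<lbrakk>\<omega> \<in> W; y \<in> carrier A\<rbrakk> \<Longrightarrow> gns_norm A \<omega> (t \<otimes> y) \<le> K * gns_norm A \<omega> y"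
    using bounded[OF t] by blast
  show ?thesis
  proof (cases "gns_norm A \<omega> y = 0")
    \<comment> \<open>A vector of norm 0 cannot be normalized, but the bound by \<open>K\<close>
      shows that its image has norm 0 as well.\<close>
    case True
    then show ?thesis using K[OF \<omega> y] by simp
  next
    case False
    define r where "r = gns_norm A \<omega> y"
    have r: "r > 0" using False gns_norm_nonneg[OF y] by (simp add: r_def)
    define y' where "y' = of_real (1 / r) \<odot> y"
    have y': "y' \<in> carrier A" using y by (simp add: y'_def)
    have "gns_norm A \<omega> y' = 1"
      using r y by (simp add: y'_def gns_norm_smult norm_divide flip: r_def)
    then have "gns_norm A \<omega> (t \<otimes> y') \<in>
        {gns_norm A \<omega> (t \<otimes> y) | \<omega> y. \<omega> \<in> W \<and> y \<in> carrier A \<and> \<omega> (star A y \<otimes> y) = 1}"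
      using \<omega> y' gns_norm_eq_1 by blast
    moreover have "bdd_above {gns_norm A \<omega> (t \<otimes> y) | \<omega> y. \<omega> \<in> W \<and> y \<in> carrier A \<and> \<omega> (star A y \<otimes> y) = 1}"
      using K gns_norm_eq_1 by (intro bdd_aboveI[of _ K]) fastforce
    ultimately have "gns_norm A \<omega> (t \<otimes> y') \<le> p t"
      unfolding functional_seminorm_def by (rule cSup_upper)
    moreover have "gns_norm A \<omega> (t \<otimes> y') = gns_norm A \<omega> (t \<otimes> y) / r"
      using r t y by (simp add: y'_def smult_mult_right gns_norm_smult norm_divide)
    ultimately show ?thesis
      using r by (simp add: field_simps flip: r_def)
  qed
qed

lemma seminorm_le:
  assumes "t \<in> carrier A"
    and "\<And>\<omega> y. \<lbrakk>\<omega> \<in> W; y \<in> carrier A\<rbrakk> \<Longrightarrow> gns_norm A \<omega> (t \<otimes> y) \<le> M * gns_norm A \<omega> y"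
  shows "p t \<le> M"
  unfolding functional_seminorm_def
proof (rule cSup_least)
  show "{gns_norm A \<omega> (t \<otimes> y) | \<omega> y. \<omega> \<in> W \<and> y \<in> carrier A \<and> \<omega> (star A y \<otimes> y) = 1} \<noteq> {}"
    using unital by (auto intro!: exI[of _ \<one>] simp: a_rules)
qed (use assms gns_norm_eq_1 in fastforce)

lemma gns_norm_le: "\<lbrakk>\<omega> \<in> W; \<omega> \<one> = 1; t \<in> carrier A\<rbrakk> \<Longrightarrow> gns_norm A \<omega> t \<le> p t"
  using gns_norm_mult_le[of \<omega> t \<one>] by (simp add: gns_norm_def a_rules)

lemma cmod_le: "\<lbrakk>\<omega> \<in> W; \<omega> \<one> = 1; t \<in> carrier A\<rbrakk> \<Longrightarrow> cmod (\<omega> t) \<le> p t"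
  using star_algebra_functional.cauchy_schwarz[OF functional, of \<omega> \<one> t] gns_norm_le[of \<omega> t]
  by (simp add: gns_norm_def a_rules)

lemma seminorm_nonneg: "t \<in> carrier A \<Longrightarrow> 0 \<le> p t"
  using unital gns_norm_le star_algebra_functional.gns_norm_nonneg[OF functional] order_trans by blast

theorem cstar_seminorm_functional: "cstar_seminorm A p"
proof (rule cstar_seminormI)
  fix c t assume t: "t \<in> carrier A"
  show "p (c \<odot> t) \<le> cmod c * p t"
  proof (rule seminorm_le)
    fix \<omega> y assume \<omega>: "\<omega> \<in> W" and y: "y \<in> carrier A"
    interpret star_algebra_functional A \<omega> using \<omega> by (rule functional)
    show "gns_norm A \<omega> (c \<odot> t \<otimes> y) \<le> cmod c * p t * gns_norm A \<omega> y"
      using gns_norm_mult_le[OF \<omega> t y] t y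
      by (simp add: smult_mult_left gns_norm_smult mult.assoc mult_left_mono)
  qed (use t in simp)
next
  fix s t assume s: "s \<in> carrier A" and t: "t \<in> carrier A"
  show "p (s \<otimes> t) \<le> p s * p t"
  proof (rule seminorm_le)
    fix \<omega> y assume \<omega>: "\<omega> \<in> W" and y: "y \<in> carrier A"
    have "gns_norm A \<omega> (s \<otimes> t \<otimes> y) \<le> p s * gns_norm A \<omega> (t \<otimes> y)"
      using gns_norm_mult_le[OF \<omega> s, of "t \<otimes> y"] s t y by (simp add: a_rules)
    also have "\<dots> \<le> p s * (p t * gns_norm A \<omega> y)"
      using gns_norm_mult_le[OF \<omega> t y] seminorm_nonneg[OF s] by (rule mult_left_mono)
    finally show "gns_norm A \<omega> (s \<otimes> t \<otimes> y) \<le> p s * p t * gns_norm A \<omega> y"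
      by (simp add: mult.assoc)
  qed (use s t in simp)
  show "p (s \<oplus> t) \<le> p s + p t"
  proof (rule seminorm_le)
    fix \<omega> y assume \<omega>: "\<omega> \<in> W" and y: "y \<in> carrier A"
    interpret star_algebra_functional A \<omega> using \<omega> by (rule functional)
    have "gns_norm A \<omega> ((s \<oplus> t) \<otimes> y) \<le> gns_norm A \<omega> (s \<otimes> y) + gns_norm A \<omega> (t \<otimes> y)"
      using gns_norm_triangle[of "s \<otimes> y" "t \<otimes> y"] s t y by (simp add: a_rules)
    then show "gns_norm A \<omega> ((s \<oplus> t) \<otimes> y) \<le> (p s + p t) * gns_norm A \<omega> y"
      using gns_norm_mult_le[OF \<omega> s y] gns_norm_mult_le[OF \<omega> t y] by (simp add: distrib_right)
  qed (use s t in simp)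
next
  fix t assume t: "t \<in> carrier A"
  have nonneg: "0 \<le> p (star A t \<otimes> t)" using t by (intro seminorm_nonneg) simp
  have "p t \<le> sqrt (p (star A t \<otimes> t))"
  proof (rule seminorm_le[OF t])
    fix \<omega> y assume \<omega>: "\<omega> \<in> W" and y: "y \<in> carrier A"
    interpret star_algebra_functional A \<omega> using \<omega> by (rule functional)
    have "(gns_norm A \<omega> (t \<otimes> y))\<^sup>2 = Re (\<omega> (star A y \<otimes> (star A t \<otimes> t \<otimes> y)))"
      using t y by (simp add: gns_norm_square star_mult a_rules)
    also have "\<dots> \<le> cmod (\<omega> (star A y \<otimes> (star A t \<otimes> t \<otimes> y)))"
      by (rule complex_Re_le_cmod)
    also have "\<dots> \<le> gns_norm A \<omega> y * gns_norm A \<omega> (star A t \<otimes> t \<otimes> y)"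
      using t y by (intro cauchy_schwarz) auto
    also have "\<dots> \<le> gns_norm A \<omega> y * (p (star A t \<otimes> t) * gns_norm A \<omega> y)"
      using t y \<omega> by (intro mult_left_mono gns_norm_mult_le gns_norm_nonneg) auto
    also have "\<dots> = (sqrt (p (star A t \<otimes> t)) * gns_norm A \<omega> y)\<^sup>2"
      using nonneg by (simp add: power_mult_distrib power2_eq_square)
    finally show "gns_norm A \<omega> (t \<otimes> y) \<le> sqrt (p (star A t \<otimes> t)) * gns_norm A \<omega> y"
      by (rule power2_le_imp_le) (use nonneg y gns_norm_nonneg in simp)
  qed
  then show "(p t)\<^sup>2 \<le> p (star A t \<otimes> t)"
    using power_mono[of "p t" "sqrt (p (star A t \<otimes> t))" 2] seminorm_nonneg[OF t] nonneg by simp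
qed (rule seminorm_nonneg)

end

section \<open>The ideal of elements annihilated by all states\<close>

definition state_null :: "('a, 'z) star_alg_scheme \<Rightarrow> 'a set" where
  "state_null A = {x \<in> carrier A. \<forall>\<phi>. state A \<phi> \<longrightarrow> \<phi> x = 0}"

context star_algebra
begin

lemma state_functional: "state A \<phi> \<Longrightarrow> star_algebra_functional A \<phi>"
  by (simp add: state_iff star_algebra_axioms star_algebra_functionalI)

lemma state_null_smult: "x \<in> state_null A \<Longrightarrow> c \<odot> x \<in> state_null A"
  by (simp add: state_null_def star_algebra_functional.smult[OF state_functional])

lemma state_null_minus: "\<lbrakk>x \<in> state_null A; y \<in> state_null A\<rbrakk> \<Longrightarrow> x \<ominus> y \<in> state_null A"
  by (auto simp: state_null_def star_algebra_functional.minus[OF state_functional])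

text \<open>If \<open>y\<close> is not a null vector, the functional
  \<open>z \<mapsto> \<phi> (star A y \<otimes> (z \<otimes> y))\<close> is a positive multiple of a
  state and so kills \<open>x\<close>. For a null vector the Cauchy-Schwarz inequality gives the
  claim.\<close>

lemma state_null_conj:
  assumes x: "x \<in> state_null A" and \<phi>: "state A \<phi>" and y: "y \<in> carrier A"
  shows "\<phi> (star A y \<otimes> (x \<otimes> y)) = 0"
proof -
  interpret star_algebra_functional A \<phi> using \<phi> by (rule state_functional)
  have xA: "x \<in> carrier A" using x by (simp add: state_null_def)
  define r where "r = gns_norm A \<phi> y"
  show ?thesis
  proof (cases "r = 0")
    case True
    then show ?thesis
      using cauchy_schwarz[OF y, of "x \<otimes> y"] xA y by (simp add: r_def)
  next
    case False
    define \<psi> where "\<psi> z = of_real (1 / r\<^sup>2) * \<phi> (star A y \<otimes> (z \<otimes> y))" for z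
    have "state A \<psi>"
      unfolding state_def
    proof (intro conjI ballI allI)
      fix u v assume "u \<in> carrier A" "v \<in> carrier A"
      then show "\<psi> (u \<oplus> v) = \<psi> u + \<psi> v"
        using y by (simp add: \<psi>_def a_rules add distrib_left)
    next
      fix c u assume "u \<in> carrier A"
      then show "\<psi> (c \<odot> u) = c * \<psi> u"
        using y by (simp add: \<psi>_def smult_mult_left smult_mult_right smult)
    next
      fix u assume u: "u \<in> carrier A"
      have "\<psi> (star A u \<otimes> u) = of_real (1 / r\<^sup>2) * \<phi> (star A (u \<otimes> y) \<otimes> (u \<otimes> y))"
        using u y by (simp add: \<psi>_def star_mult a_rules)
      also have "\<dots> = of_real (1 / r\<^sup>2 * (gns_norm A \<phi> (u \<otimes> y))\<^sup>2)"
        using u y by (simp add: star_mult_eq)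
      finally show "\<psi> (star A u \<otimes> u) \<in> \<real>\<^sub>\<ge>\<^sub>0"
        by (simp only: nonneg_Reals_of_real_iff) simp
    next
      show "\<psi> \<one> = 1"
        using y False star_mult_eq[OF y] by (simp add: \<psi>_def a_rules flip: r_def)
    qed
    then have "\<psi> x = 0" using x by (simp add: state_null_def)
    then show ?thesis using False by (simp add: \<psi>_def)
  qed
qed

text \<open>Polarization: the sesquilinear form
  \<open>\<phi> (star A u \<otimes> (x \<otimes> z))\<close> vanishes on the diagonal by
  \<open>state_null_conj\<close>, and the vectors u + z and u + i z recover its values off the
  diagonal. This makes \<open>state_null\<close> a two-sided ideal.\<close>

lemma state_null_mult:
  assumes x: "x \<in> state_null A" and y: "y \<in> carrier A" and z: "z \<in> carrier A"
  shows "y \<otimes> (x \<otimes> z) \<in> state_null A"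
proof -
  have xA: "x \<in> carrier A" using x by (simp add: state_null_def)
  have "\<phi> (y \<otimes> (x \<otimes> z)) = 0" if \<phi>: "state A \<phi>" for \<phi>
  proof -
    interpret star_algebra_functional A \<phi> using \<phi> by (rule state_functional)
    \<comment> \<open>\<open>star A u = y\<close> puts the left factor into the form of a vector, so
      that it can be added to \<open>z\<close>.\<close>
    define u where "u = star A y"
    have u: "u \<in> carrier A" "star A u = y" using y by (simp_all add: u_def star_star)
    note uu = state_null_conj[OF x \<phi> u(1), unfolded u(2)]
    note zz = state_null_conj[OF x \<phi> z]
    have "\<phi> (star A (u \<oplus> z) \<otimes> (x \<otimes> (u \<oplus> z))) =
      \<phi> (y \<otimes> (x \<otimes> u)) + \<phi> (y \<otimes> (x \<otimes> z)) + (\<phi> (star A z \<otimes> (x \<otimes> u)) + \<phi> (star A z \<otimes> (x \<otimes> z)))"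
      using xA y z u by (simp add: star_add a_rules add)
    then have 1: "\<phi> (y \<otimes> (x \<otimes> z)) + \<phi> (star A z \<otimes> (x \<otimes> u)) = 0"
      using state_null_conj[OF x \<phi>, of "u \<oplus> z"] u z uu zz by simp
    have "\<phi> (star A (u \<oplus> \<i> \<odot> z) \<otimes> (x \<otimes> (u \<oplus> \<i> \<odot> z))) =
      \<phi> (y \<otimes> (x \<otimes> u)) + \<i> * \<phi> (y \<otimes> (x \<otimes> z)) +
      (- \<i> * \<phi> (star A z \<otimes> (x \<otimes> u)) - \<i> * (\<i> * \<phi> (star A z \<otimes> (x \<otimes> z))))"
      using xA y z u
      by (simp add: star_add star_smult a_rules add smult smult_mult_left smult_mult_right
          algebra_simps)
    then have "\<i> * (\<phi> (y \<otimes> (x \<otimes> z)) - \<phi> (star A z \<otimes> (x \<otimes> u))) = 0"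
      using state_null_conj[OF x \<phi>, of "u \<oplus> \<i> \<odot> z"] u z uu zz by (simp add: algebra_simps)
    with 1 show ?thesis by simp
  qed
  then show ?thesis using xA y z by (simp add: state_null_def)
qed

end


section \<open>Completions\<close>

locale cstar_seminormed = star_algebra +
  fixes p :: "'a \<Rightarrow> real"
  assumes cstar_seminorm: "cstar_seminorm A p"

lemmas cstar_seminormedI = cstar_seminormed.intro[OF _ cstar_seminormed_axioms.intro]

context cstar_seminormed
begin

lemma p_nonneg: "x \<in> carrier A \<Longrightarrow> 0 \<le> p x"
  and p_add: "\<lbrakk>x \<in> carrier A; y \<in> carrier A\<rbrakk> \<Longrightarrow> p (x \<oplus> y) \<le> p x + p y"
  and p_smult: "x \<in> carrier A \<Longrightarrow> p (c \<odot> x) = cmod c * p x"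
  and p_mult: "\<lbrakk>x \<in> carrier A; y \<in> carrier A\<rbrakk> \<Longrightarrow> p (x \<otimes> y) \<le> p x * p y"
  and p_star_mult: "x \<in> carrier A \<Longrightarrow> p (star A x \<otimes> x) = (p x)\<^sup>2"
  using cstar_seminorm by (simp_all add: cstar_seminorm_def)

lemma p_zero [simp]: "p \<zero> = 0"
  using p_smult[of \<one> 0] by simp

lemma p_uminus: "x \<in> carrier A \<Longrightarrow> p (\<ominus> x) = p x"
  by (simp add: uminus_conv p_smult)

lemma p_minus_commute: "\<lbrakk>x \<in> carrier A; y \<in> carrier A\<rbrakk> \<Longrightarrow> p (x \<ominus> y) = p (y \<ominus> x)"
  using p_uminus[of "x \<ominus> y"] by (simp add: a_rules)

lemma p_minus_triangle:
  assumes "x \<in> carrier A" "y \<in> carrier A" "z \<in> carrier A"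
  shows "p (x \<ominus> z) \<le> p (x \<ominus> y) + p (y \<ominus> z)"
proof -
  have "x \<ominus> z = (x \<ominus> y) \<oplus> (y \<ominus> z)"
    using assms by (simp add: a_rules)
  then show ?thesis using p_add[of "x \<ominus> y" "y \<ominus> z"] assms by simp
qed

lemma p_diff_le: "\<lbrakk>x \<in> carrier A; y \<in> carrier A\<rbrakk> \<Longrightarrow> \<bar>p x - p y\<bar> \<le> p (x \<ominus> y)"
  using p_minus_triangle[of x y \<zero>] p_minus_triangle[of y x \<zero>] p_minus_commute[of x y]
  by (simp add: a_rules)

lemma p_star: assumes "x \<in> carrier A" shows "p (star A x) = p x"
proof -
  have le: "p x \<le> p (star A x)" if "x \<in> carrier A" for x
  proof (cases "p x = 0")
    case True
    then show ?thesis using p_nonneg[of "star A x"] that by simp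
  next
    case False
    have "p x * p x \<le> p (star A x) * p x"
      using p_star_mult[OF that] p_mult[of "star A x" x] that by (simp add: power2_eq_square)
    then show ?thesis using False p_nonneg[OF that] by simp
  qed
  show ?thesis using le[OF assms] le[of "star A x"] assms by (simp add: star_star)
qed

lemma p_add_diff_le:
  assumes "x \<in> carrier A" "y \<in> carrier A" "x' \<in> carrier A" "y' \<in> carrier A"
  shows "p ((x \<oplus> y) \<ominus> (x' \<oplus> y')) \<le> p (x \<ominus> x') + p (y \<ominus> y')"
proof -
  have "(x \<oplus> y) \<ominus> (x' \<oplus> y') = (x \<ominus> x') \<oplus> (y \<ominus> y')"
    using assms by (simp add: a_rules)
  then show ?thesis using p_add[of "x \<ominus> x'" "y \<ominus> y'"] assms by simp
qed

lemma p_mult_diff_le: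
  assumes "x \<in> carrier A" "y \<in> carrier A" "x' \<in> carrier A" "y' \<in> carrier A"
  shows "p ((x \<otimes> y) \<ominus> (x' \<otimes> y')) \<le> p (x \<ominus> x') * p y + p x' * p (y \<ominus> y')"
proof -
  have "(x \<otimes> y) \<ominus> (x' \<otimes> y') = (x \<ominus> x') \<otimes> y \<oplus> x' \<otimes> (y \<ominus> y')"
    using assms by (simp add: a_rules)
  then show ?thesis
    using p_add[of "(x \<ominus> x') \<otimes> y" "x' \<otimes> (y \<ominus> y')"] p_mult[of "x \<ominus> x'" y]
      p_mult[of x' "y \<ominus> y'"] assms by simp
qed

lemma p_smult_diff: "\<lbrakk>x \<in> carrier A; y \<in> carrier A\<rbrakk> \<Longrightarrow> p ((c \<odot> x) \<ominus> (c \<odot> y)) = cmod c * p (x \<ominus> y)"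
proof -
  assume xy: "x \<in> carrier A" "y \<in> carrier A"
  then have "(c \<odot> x) \<ominus> (c \<odot> y) = c \<odot> (x \<ominus> y)"
    by (simp add: minus_conv smult_add smult_smult)
  then show ?thesis using xy by (simp add: p_smult)
qed

lemma p_star_diff: "\<lbrakk>x \<in> carrier A; y \<in> carrier A\<rbrakk> \<Longrightarrow> p (star A x \<ominus> star A y) = p (x \<ominus> y)"
  by (simp add: p_star flip: star_minus)

abbreviation "Cauchy_A \<equiv> cauchy_seqs A p"
abbreviation "Compl \<equiv> completion A p"
abbreviation "\<iota> \<equiv> to_completion A p"
definition cls :: "(nat \<Rightarrow> 'a) \<Rightarrow> (nat \<Rightarrow> 'a) set" where "cls X = null_rel A p `` {X}"

lemma cauchyD: "X \<in> Cauchy_A \<Longrightarrow> X n \<in> carrier A"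
  by (auto simp: cauchy_seqs_def)

lemma cauchyD2: "\<lbrakk>X \<in> Cauchy_A; 0 < e\<rbrakk> \<Longrightarrow> \<exists>N. \<forall>m\<ge>N. \<forall>n\<ge>N. p (X m \<ominus> X n) < e"
  by (simp add: cauchy_seqs_def)

lemma cauchyI:
  assumes "\<And>n. X n \<in> carrier A" "\<And>e. 0 < e \<Longrightarrow> \<exists>N. \<forall>m\<ge>N. \<forall>n\<ge>N. p (X m \<ominus> X n) < e"
  shows "X \<in> Cauchy_A"
  using assms by (auto simp: cauchy_seqs_def)

lemma cauchy_const: "a \<in> carrier A \<Longrightarrow> (\<lambda>n. a) \<in> Cauchy_A"
  by (auto intro!: cauchyI)

lemma cauchy_le:
  assumes "X \<in> Cauchy_A" "Y \<in> Cauchy_A" "\<And>n. Z n \<in> carrier A" "0 \<le> K" "0 \<le> L"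
    and le: "\<And>m n. p (Z m \<ominus> Z n) \<le> K * p (X m \<ominus> X n) + L * p (Y m \<ominus> Y n)"
  shows "Z \<in> Cauchy_A"
proof (rule cauchyI)
  fix e :: real assume e: "0 < e"
  \<comment> \<open>The summand 1 keeps the denominator positive when
    \<open>K = L = 0\<close>.\<close>
  define d where "d = e / (K + L + 1)"
  have d: "0 < d" "(K + L) * d < e" using e assms(4,5) by (auto simp: d_def field_simps)
  obtain M N where "\<forall>m\<ge>M. \<forall>n\<ge>M. p (X m \<ominus> X n) < d" "\<forall>m\<ge>N. \<forall>n\<ge>N. p (Y m \<ominus> Y n) < d"
    using cauchyD2[OF assms(1) d(1)] cauchyD2[OF assms(2) d(1)] by blast
  then have "p (Z m \<ominus> Z n) < e" if "m \<ge> max M N" "n \<ge> max M N" for m n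
    using le[of m n] that d(2) mult_left_mono[of "p (X m \<ominus> X n)" d K]
      mult_left_mono[of "p (Y m \<ominus> Y n)" d L] assms(4,5)
    by (fastforce simp: distrib_right)
  then show "\<exists>N. \<forall>m\<ge>N. \<forall>n\<ge>N. p (Z m \<ominus> Z n) < e" by blast
qed (use assms in auto)

lemma convergent_p_minus:
  assumes X: "X \<in> Cauchy_A" and Y: "Y \<in> Cauchy_A"
  shows "convergent (\<lambda>n. p (X n \<ominus> Y n))"
proof -
  have "\<bar>p (X m \<ominus> Y m) - p (X n \<ominus> Y n)\<bar> \<le> p (X m \<ominus> X n) + p (Y m \<ominus> Y n)" for m n
  proof -
    have "(X m \<ominus> Y m) \<ominus> (X n \<ominus> Y n) = (X m \<ominus> X n) \<ominus> (Y m \<ominus> Y n)"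
      using cauchyD[OF X] cauchyD[OF Y] by (simp add: a_rules)
    then show ?thesis
      using p_diff_le[of "X m \<ominus> Y m" "X n \<ominus> Y n"] p_add[of "X m \<ominus> X n" "\<ominus> (Y m \<ominus> Y n)"]
        p_uminus[of "Y m \<ominus> Y n"] cauchyD[OF X] cauchyD[OF Y]
      by (simp add: a_rules(14)[of "X m \<ominus> X n" "Y m \<ominus> Y n"])
  qed
  moreover have "\<exists>N. \<forall>m\<ge>N. \<forall>n\<ge>N. p (X m \<ominus> X n) + p (Y m \<ominus> Y n) < e" if "0 < e" for e
  proof -
    obtain M N where "\<forall>m\<ge>M. \<forall>n\<ge>M. p (X m \<ominus> X n) < e / 2" "\<forall>m\<ge>N. \<forall>n\<ge>N. p (Y m \<ominus> Y n) < e / 2"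
      using cauchyD2[OF X, of "e / 2"] cauchyD2[OF Y, of "e / 2"] \<open>0 < e\<close> by auto
    then show ?thesis by (intro exI[of _ "max M N"]) fastforce
  qed
  ultimately have "Cauchy (\<lambda>n. p (X n \<ominus> Y n))"
    unfolding Cauchy_def dist_real_def by (meson order_le_less_trans)
  then show ?thesis by (rule Cauchy_convergent)
qed

lemma convergent_p: "X \<in> Cauchy_A \<Longrightarrow> convergent (\<lambda>n. p (X n))"
  using convergent_p_minus[of X "\<lambda>n. \<zero>"] cauchy_const[of \<zero>] cauchyD[of X] by (simp add: a_rules)

lemma p_bounded:
  assumes "X \<in> Cauchy_A" obtains K where "0 < K" "\<And>n. p (X n) \<le> K"
proof -
  obtain K where "0 < K" "\<And>n. norm (p (X n)) \<le> K"
    using convergent_imp_Bseq[OF convergent_p[OF assms]] by (rule BseqE) blast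
  then show thesis using that[of K] by (force simp: abs_le_iff)
qed

lemma null_rel_iff:
  "(X, Y) \<in> null_rel A p \<longleftrightarrow> X \<in> Cauchy_A \<and> Y \<in> Cauchy_A \<and> (\<lambda>n. p (X n \<ominus> Y n)) \<longlonglongrightarrow> 0"
  by (simp add: null_rel_def)

lemma null_relI:
  assumes "X \<in> Cauchy_A" "Y \<in> Cauchy_A" "\<And>n. p (X n \<ominus> Y n) \<le> f n" "f \<longlonglongrightarrow> 0"
  shows "(X, Y) \<in> null_rel A p"
proof -
  have "(\<lambda>n. p (X n \<ominus> Y n)) \<longlonglongrightarrow> 0"
  proof (rule tendsto_sandwich[OF _ _ tendsto_const assms(4)])
    show "\<forall>\<^sub>F n in sequentially. 0 \<le> p (X n \<ominus> Y n)"
      using cauchyD[OF assms(1)] cauchyD[OF assms(2)] by (simp add: p_nonneg)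
    show "\<forall>\<^sub>F n in sequentially. p (X n \<ominus> Y n) \<le> f n"
      using assms(3) by simp
  qed
  then show ?thesis using assms by (simp add: null_rel_iff)
qed

lemma equiv_null_rel: "equiv Cauchy_A (null_rel A p)"
proof (rule equivI)
  show "null_rel A p \<subseteq> Cauchy_A \<times> Cauchy_A" by (auto simp: null_rel_def)
  show "refl_on Cauchy_A (null_rel A p)"
    by (auto simp: refl_on_def null_rel_def cauchyD)
  show "sym (null_rel A p)"
    by (auto simp: sym_def null_rel_def cauchyD p_minus_commute)
  show "trans (null_rel A p)"
  proof (rule transI)
    fix X Y Z assume *: "(X, Y) \<in> null_rel A p" "(Y, Z) \<in> null_rel A p"
    then have "(\<lambda>n. p (X n \<ominus> Y n) + p (Y n \<ominus> Z n)) \<longlonglongrightarrow> 0"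
      by (intro tendsto_add_zero) (auto simp: null_rel_iff)
    with * show "(X, Z) \<in> null_rel A p"
      by (intro null_relI[where f = "\<lambda>n. p (X n \<ominus> Y n) + p (Y n \<ominus> Z n)"] p_minus_triangle)
         (auto simp: null_rel_iff cauchyD)
  qed
qed

lemma cls_eq_iff:
  "\<lbrakk>X \<in> Cauchy_A; Y \<in> Cauchy_A\<rbrakk> \<Longrightarrow> cls X = cls Y \<longleftrightarrow> (\<lambda>n. p (X n \<ominus> Y n)) \<longlonglongrightarrow> 0"
  unfolding cls_def using eq_equiv_class_iff[OF equiv_null_rel] by (simp add: null_rel_iff)

lemma cls_eqI:
  assumes "(X, Y) \<in> null_rel A p" shows "cls X = cls Y"
  unfolding cls_def using equiv_class_eq[OF equiv_null_rel assms] .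

lemma carrier_completion: "carrier Compl = cls ` Cauchy_A"
  by (auto simp: completion_def cls_def quotient_def)

lemma cls_closed [simp, intro]: "X \<in> Cauchy_A \<Longrightarrow> cls X \<in> carrier Compl"
  by (simp add: carrier_completion)

lemma completionE:
  assumes "S \<in> carrier Compl" obtains X where "X \<in> Cauchy_A" "S = cls X"
  using assms by (auto simp: carrier_completion)

text \<open>The operations in \<open>completion\<close> are unions over all representatives. When
  the set under the union does not depend on the representative, the union is that set.\<close>

lemma UN_cls:
  assumes "X \<in> Cauchy_A" "\<And>X'. (X, X') \<in> null_rel A p \<Longrightarrow> f X' = f X"
  shows "(\<Union>X'\<in>cls X. f X') = f X"
proof -
  have "X \<in> cls X" unfolding cls_def using equiv_class_self[OF equiv_null_rel assms(1)] .
  show ?thesis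
  proof (rule SUP_eq_const)
    show "cls X \<noteq> {}" using \<open>X \<in> cls X\<close> by blast
    show "f X' = f X" if "X' \<in> cls X" for X'
      using assms(2) that by (simp add: cls_def)
  qed
qed

lemma UN_cls2:
  assumes X: "X \<in> Cauchy_A" and Y: "Y \<in> Cauchy_A"
    and cong: "\<And>X' Y'. \<lbrakk>(X, X') \<in> null_rel A p; (Y, Y') \<in> null_rel A p\<rbrakk> \<Longrightarrow> f X' Y' = f X Y"
  shows "(\<Union>X'\<in>cls X. \<Union>Y'\<in>cls Y. f X' Y') = f X Y"
proof -
  have YY: "(Y, Y) \<in> null_rel A p" using Y by (simp add: null_rel_iff cauchyD)
  have "(\<Union>Y'\<in>cls Y. f X' Y') = f X' Y" if "(X, X') \<in> null_rel A p" for X'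
    by (intro UN_cls Y) (simp add: cong[OF that] YY)
  then have "(\<Union>X'\<in>cls X. \<Union>Y'\<in>cls Y. f X' Y') = (\<Union>X'\<in>cls X. f X' Y)"
    by (intro SUP_cong refl) (simp add: cls_def)
  also have "\<dots> = f X Y" by (intro UN_cls X cong YY)
  finally show ?thesis .
qed

lemma add_cauchy: "\<lbrakk>X \<in> Cauchy_A; Y \<in> Cauchy_A\<rbrakk> \<Longrightarrow> (\<lambda>n. X n \<oplus> Y n) \<in> Cauchy_A"
  by (rule cauchy_le[of X Y _ 1 1]) (auto simp: cauchyD intro: p_add_diff_le)

lemma mult_cauchy:
  assumes "X \<in> Cauchy_A" "Y \<in> Cauchy_A" shows "(\<lambda>n. X n \<otimes> Y n) \<in> Cauchy_A"
proof -
  obtain K L where K: "0 < K" "\<And>n. p (X n) \<le> K" and L: "0 < L" "\<And>n. p (Y n) \<le> L"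
    using p_bounded assms by metis
  show ?thesis
  proof (rule cauchy_le[OF assms, of _ L K])
    fix m n
    have "p (X m \<otimes> Y m \<ominus> X n \<otimes> Y n) \<le> p (X m \<ominus> X n) * p (Y m) + p (X n) * p (Y m \<ominus> Y n)"
      using assms by (intro p_mult_diff_le cauchyD)
    also have "\<dots> \<le> p (X m \<ominus> X n) * L + K * p (Y m \<ominus> Y n)"
      using assms K L by (intro add_mono mult_left_mono mult_right_mono p_nonneg) (auto simp: cauchyD)
    finally show "p (X m \<otimes> Y m \<ominus> X n \<otimes> Y n) \<le> L * p (X m \<ominus> X n) + K * p (Y m \<ominus> Y n)"
      by (simp add: mult.commute)
  qed (use assms K L cauchyD in auto)
qed

lemma smult_cauchy: "X \<in> Cauchy_A \<Longrightarrow> (\<lambda>n. c \<odot> X n) \<in> Cauchy_A"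
  by (rule cauchy_le[of X X _ "cmod c" 0]) (auto simp: cauchyD p_smult_diff)

lemma star_cauchy: "X \<in> Cauchy_A \<Longrightarrow> (\<lambda>n. star A (X n)) \<in> Cauchy_A"
  by (rule cauchy_le[of X X _ 1 0]) (auto simp: cauchyD p_star_diff)

lemma to_completion_cls: "\<iota> a = cls (\<lambda>n. a)"
  by (simp add: to_completion_def cls_def)

lemma one_completion: "\<one>\<^bsub>Compl\<^esub> = cls (\<lambda>n. \<one>)"
  and zero_completion: "\<zero>\<^bsub>Compl\<^esub> = cls (\<lambda>n. \<zero>)"
  by (simp_all add: completion_def to_completion_cls)

lemma add_completion:
  assumes X: "X \<in> Cauchy_A" and Y: "Y \<in> Cauchy_A"
  shows "cls X \<oplus>\<^bsub>Compl\<^esub> cls Y = cls (\<lambda>n. X n \<oplus> Y n)"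
proof -
  have "cls (\<lambda>n. X' n \<oplus> Y' n) = cls (\<lambda>n. X n \<oplus> Y n)"
    if "(X, X') \<in> null_rel A p" "(Y, Y') \<in> null_rel A p" for X' Y'
  proof -
    have "(\<lambda>n. p (X n \<ominus> X' n) + p (Y n \<ominus> Y' n)) \<longlonglongrightarrow> 0"
      using that by (intro tendsto_add_zero) (auto simp: null_rel_iff)
    then have "((\<lambda>n. X n \<oplus> Y n), (\<lambda>n. X' n \<oplus> Y' n)) \<in> null_rel A p"
      using that by (intro null_relI[where f = "\<lambda>n. p (X n \<ominus> X' n) + p (Y n \<ominus> Y' n)"] p_add_diff_le)
         (auto simp: null_rel_iff cauchyD add_cauchy)
    then show ?thesis using cls_eqI by metis
  qed
  from UN_cls2[OF X Y, of "\<lambda>U V. cls (\<lambda>n. U n \<oplus> V n)", OF this] show ?thesis by (simp add: completion_def cls_def)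
qed

lemma mult_completion:
  assumes X: "X \<in> Cauchy_A" and Y: "Y \<in> Cauchy_A"
  shows "cls X \<otimes>\<^bsub>Compl\<^esub> cls Y = cls (\<lambda>n. X n \<otimes> Y n)"
proof -
  have "cls (\<lambda>n. X' n \<otimes> Y' n) = cls (\<lambda>n. X n \<otimes> Y n)"
    if "(X, X') \<in> null_rel A p" "(Y, Y') \<in> null_rel A p" for X' Y'
  proof -
    have X': "X' \<in> Cauchy_A" and Y': "Y' \<in> Cauchy_A" using that by (auto simp: null_rel_iff)
    obtain K L where K: "0 < K" "\<And>n. p (X' n) \<le> K" and L: "0 < L" "\<And>n. p (Y n) \<le> L"
      using p_bounded X' Y by metis
    have "(\<lambda>n. p (X n \<ominus> X' n) * L + K * p (Y n \<ominus> Y' n)) \<longlonglongrightarrow> 0 * L + K * 0"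
      using that by (intro tendsto_intros) (auto simp: null_rel_iff)
    moreover have "p (X n \<otimes> Y n \<ominus> X' n \<otimes> Y' n) \<le> p (X n \<ominus> X' n) * L + K * p (Y n \<ominus> Y' n)" for n
    proof -
      have "p (X n \<otimes> Y n \<ominus> X' n \<otimes> Y' n) \<le> p (X n \<ominus> X' n) * p (Y n) + p (X' n) * p (Y n \<ominus> Y' n)"
        using X Y X' Y' by (intro p_mult_diff_le cauchyD)
      also have "\<dots> \<le> p (X n \<ominus> X' n) * L + K * p (Y n \<ominus> Y' n)"
        using X Y X' Y' K L by (intro add_mono mult_left_mono mult_right_mono p_nonneg) (auto simp: cauchyD)
      finally show ?thesis .
    qed
    ultimately have "((\<lambda>n. X n \<otimes> Y n), (\<lambda>n. X' n \<otimes> Y' n)) \<in> null_rel A p"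
      using X Y X' Y' by (intro null_relI[where f = "\<lambda>n. p (X n \<ominus> X' n) * L + K * p (Y n \<ominus> Y' n)"] mult_cauchy) auto
    then show ?thesis using cls_eqI by metis
  qed
  from UN_cls2[OF X Y, of "\<lambda>U V. cls (\<lambda>n. U n \<otimes> V n)", OF this] show ?thesis by (simp add: completion_def cls_def)
qed

lemma smult_completion:
  assumes X: "X \<in> Cauchy_A"
  shows "c \<odot>\<^bsub>Compl\<^esub> cls X = cls (\<lambda>n. c \<odot> X n)"
proof -
  have "cls (\<lambda>n. c \<odot> X' n) = cls (\<lambda>n. c \<odot> X n)" if "(X, X') \<in> null_rel A p" for X'
    using that tendsto_mult_right[of "\<lambda>n. p (X n \<ominus> X' n)" 0 sequentially "cmod c"]
    by (subst eq_commute, subst cls_eq_iff)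
       (auto simp: null_rel_iff smult_cauchy p_smult_diff cauchyD mult.commute)
  then have "(\<Union>X'\<in>cls X. cls (\<lambda>n. c \<odot> X' n)) = cls (\<lambda>n. c \<odot> X n)"
    by (intro UN_cls X) auto
  then show ?thesis by (simp add: completion_def cls_def)
qed

lemma star_completion:
  assumes X: "X \<in> Cauchy_A"
  shows "star Compl (cls X) = cls (\<lambda>n. star A (X n))"
proof -
  have "cls (\<lambda>n. star A (X' n)) = cls (\<lambda>n. star A (X n))" if "(X, X') \<in> null_rel A p" for X'
    using that
    by (subst eq_commute, subst cls_eq_iff)
       (auto simp: null_rel_iff star_cauchy p_star_diff cauchyD)
  then have "(\<Union>X'\<in>cls X. cls (\<lambda>n. star A (X' n))) = cls (\<lambda>n. star A (X n))"
    by (intro UN_cls X) auto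
  then show ?thesis by (simp add: completion_def cls_def)
qed

text \<open>Equivalent sequences have the same limit of seminorms, so the definite description
  behind \<open>cnorm\<close> is met. In the form of a limit, the estimates for \<open>p\<close>
  pass termwise to the completion.\<close>

lemma cnorm_completion:
  assumes X: "X \<in> Cauchy_A"
  shows "(\<lambda>n. p (X n)) \<longlonglongrightarrow> cnorm Compl (cls X)"
proof -
  obtain r where r: "(\<lambda>n. p (X n)) \<longlonglongrightarrow> r"
    using convergent_p[OF X] by (auto simp: convergent_def)
  have *: "s = r" if "(X, Y) \<in> null_rel A p" "(\<lambda>n. p (Y n)) \<longlonglongrightarrow> s" for Y s
  proof -
    have "(\<lambda>n. p (X n) - p (Y n)) \<longlonglongrightarrow> 0"
    proof (rule Lim_null_comparison)
      show "(\<lambda>n. p (X n \<ominus> Y n)) \<longlonglongrightarrow> 0" using that by (simp add: null_rel_iff)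
      show "\<forall>\<^sub>F n in sequentially. norm (p (X n) - p (Y n)) \<le> p (X n \<ominus> Y n)"
        using that by (intro always_eventually allI) (auto simp: null_rel_iff cauchyD intro: p_diff_le)
    qed
    then have "r - s = 0"
      using LIMSEQ_unique[OF tendsto_diff[OF r that(2)]] by blast
    then show ?thesis by simp
  qed
  have "X \<in> cls X" unfolding cls_def using equiv_class_self[OF equiv_null_rel X] .
  have "(THE r. \<exists>X'\<in>cls X. (\<lambda>n. p (X' n)) \<longlonglongrightarrow> r) = r"
  proof (rule the_equality)
    show "\<exists>X'\<in>cls X. (\<lambda>n. p (X' n)) \<longlonglongrightarrow> r" using r \<open>X \<in> cls X\<close> by blast
    show "s = r" if "\<exists>X'\<in>cls X. (\<lambda>n. p (X' n)) \<longlonglongrightarrow> s" for s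
      using that * by (auto simp: cls_def)
  qed
  then show ?thesis using r by (simp add: completion_def)
qed

theorem star_algebra_completion: "star_algebra Compl"
proof (rule star_algebraI)
qed ((elim completionE)?; simp add: one_completion zero_completion add_completion mult_completion
    smult_completion star_completion cauchy_const add_cauchy mult_cauchy smult_cauchy star_cauchy
    cauchyD a_rules add_smult smult_add smult_smult smult_mult_left smult_mult_right
    star_star star_add star_smult star_mult)+

end

lemma Metric_space_cdist:
  assumes "star_algebra A" "cstar_seminorm A (cnorm A)"
    and definite: "\<And>x. \<lbrakk>x \<in> carrier A; cnorm A x = 0\<rbrakk> \<Longrightarrow> x = \<zero>\<^bsub>A\<^esub>"
  shows "Metric_space (carrier A) (cdist A)"
proof -
  interpret cstar_seminormed A "cnorm A"
    using assms(1,2) by (intro cstar_seminormedI)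
  show ?thesis
  proof
    fix x y z
    show "0 \<le> cdist A x y" by (simp add: cdist_def p_nonneg)
    show "cdist A x y = cdist A y x" by (auto simp: cdist_def p_minus_commute)
    show "cdist A x y = 0 \<longleftrightarrow> x = y" if "x \<in> carrier A" "y \<in> carrier A"
      using that definite[of "x \<ominus>\<^bsub>A\<^esub> y"] minus_eq_zero_iff[OF that] by (auto simp: cdist_def)
    show "cdist A x z \<le> cdist A x y + cdist A y z"
      if "x \<in> carrier A" "y \<in> carrier A" "z \<in> carrier A"
      using that p_minus_triangle by (simp add: cdist_def)
  qed
qed

context cstar_seminormed
begin

lemma minus_completion:
  "\<lbrakk>X \<in> Cauchy_A; Y \<in> Cauchy_A\<rbrakk> \<Longrightarrow> cls X \<ominus>\<^bsub>Compl\<^esub> cls Y = cls (\<lambda>n. X n \<ominus> Y n)"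
  by (simp add: star_algebra.minus_conv[OF star_algebra_completion] minus_conv cauchyD
      add_completion smult_completion smult_cauchy)

lemma minus_cauchy: "\<lbrakk>X \<in> Cauchy_A; Y \<in> Cauchy_A\<rbrakk> \<Longrightarrow> (\<lambda>n. X n \<ominus> Y n) \<in> Cauchy_A"
  by (simp add: minus_conv cauchyD add_cauchy smult_cauchy)

lemma cnorm_minus_completion:
  "\<lbrakk>X \<in> Cauchy_A; Y \<in> Cauchy_A\<rbrakk> \<Longrightarrow>
    (\<lambda>n. p (X n \<ominus> Y n)) \<longlonglongrightarrow> cnorm Compl (cls X \<ominus>\<^bsub>Compl\<^esub> cls Y)"
  using cnorm_completion[OF minus_cauchy] by (simp add: minus_completion)

lemma to_completion_closed [simp, intro]: "a \<in> carrier A \<Longrightarrow> \<iota> a \<in> carrier Compl"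
  by (simp add: to_completion_cls cauchy_const)

lemma cnorm_to_completion: "a \<in> carrier A \<Longrightarrow> cnorm Compl (\<iota> a) = p a"
  using LIMSEQ_unique[OF cnorm_completion[OF cauchy_const[of a]] tendsto_const]
  by (simp add: to_completion_cls)

lemma to_completion_add:
    "\<lbrakk>x \<in> carrier A; y \<in> carrier A\<rbrakk> \<Longrightarrow>
      \<iota> (x \<oplus> y) = \<iota> x \<oplus>\<^bsub>Compl\<^esub> \<iota> y"
  and to_completion_mult:
    "\<lbrakk>x \<in> carrier A; y \<in> carrier A\<rbrakk> \<Longrightarrow>
      \<iota> (x \<otimes> y) = \<iota> x \<otimes>\<^bsub>Compl\<^esub> \<iota> y"
  and to_completion_minus:
    "\<lbrakk>x \<in> carrier A; y \<in> carrier A\<rbrakk> \<Longrightarrow>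
      \<iota> (x \<ominus> y) = \<iota> x \<ominus>\<^bsub>Compl\<^esub> \<iota> y"
  and to_completion_smult:
    "x \<in> carrier A \<Longrightarrow> \<iota> (c \<odot> x) = c \<odot>\<^bsub>Compl\<^esub> \<iota> x"
  and to_completion_star:
    "x \<in> carrier A \<Longrightarrow> \<iota> (star A x) = star Compl (\<iota> x)"
  and to_completion_one: "\<iota> \<one> = \<one>\<^bsub>Compl\<^esub>"
  and to_completion_zero: "\<iota> \<zero> = \<zero>\<^bsub>Compl\<^esub>"
  by (simp_all add: to_completion_cls cauchy_const add_completion mult_completion minus_completion
      smult_completion star_completion one_completion zero_completion)

lemma to_completion_eq_zero:
  assumes "x \<in> carrier A" "p x = 0" shows "\<iota> x = \<zero>\<^bsub>Compl\<^esub>"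
  using assms by (simp add: to_completion_cls zero_completion cls_eq_iff cauchy_const a_rules)

lemma cstar_seminorm_completion: "cstar_seminorm Compl (cnorm Compl)"
proof -
  have nonneg: "0 \<le> cnorm Compl (cls X)" if "X \<in> Cauchy_A" for X
    using that by (intro LIMSEQ_le_const[OF cnorm_completion]) (auto simp: p_nonneg cauchyD)
  have add: "cnorm Compl (cls X \<oplus>\<^bsub>Compl\<^esub> cls Y) \<le> cnorm Compl (cls X) + cnorm Compl (cls Y)"
    if "X \<in> Cauchy_A" "Y \<in> Cauchy_A" for X Y
    unfolding add_completion[OF that] using that
    by (intro LIMSEQ_le[OF cnorm_completion tendsto_add[OF cnorm_completion cnorm_completion]])
       (auto simp: add_cauchy cauchyD p_add)
  have mult: "cnorm Compl (cls X \<otimes>\<^bsub>Compl\<^esub> cls Y) \<le> cnorm Compl (cls X) * cnorm Compl (cls Y)"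
    if "X \<in> Cauchy_A" "Y \<in> Cauchy_A" for X Y
    unfolding mult_completion[OF that] using that
    by (intro LIMSEQ_le[OF cnorm_completion tendsto_mult[OF cnorm_completion cnorm_completion]])
       (auto simp: mult_cauchy cauchyD p_mult)
  have smult: "cnorm Compl (c \<odot>\<^bsub>Compl\<^esub> cls X) = cmod c * cnorm Compl (cls X)" if X: "X \<in> Cauchy_A" for c X
    using LIMSEQ_unique[OF cnorm_completion[OF smult_cauchy[OF X, of c]]
        tendsto_mult_left[OF cnorm_completion[OF X], of "cmod c", folded p_smult[OF cauchyD[OF X]]]]
    by (simp add: smult_completion X)
  have star: "cnorm Compl (star Compl (cls X) \<otimes>\<^bsub>Compl\<^esub> cls X) = (cnorm Compl (cls X))\<^sup>2"
    if X: "X \<in> Cauchy_A" for X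
  proof -
    have "(\<lambda>n. p (star A (X n) \<otimes> X n)) \<longlonglongrightarrow> (cnorm Compl (cls X))\<^sup>2"
      using tendsto_power[OF cnorm_completion[OF X], of 2] by (simp add: p_star_mult cauchyD X)
    then show ?thesis
      using LIMSEQ_unique[OF cnorm_completion[OF mult_cauchy[OF star_cauchy[OF X] X]]]
      by (simp add: star_completion mult_completion star_cauchy X)
  qed
  show ?thesis
    unfolding cstar_seminorm_def carrier_completion using nonneg add mult smult star by simp
qed

lemma cnorm_completion_definite:
  assumes "S \<in> carrier Compl" "cnorm Compl S = 0" shows "S = \<zero>\<^bsub>Compl\<^esub>"
proof -
  obtain X where X: "X \<in> Cauchy_A" "S = cls X" using assms(1) by (rule completionE)
  then have "(\<lambda>n. p (X n \<ominus> \<zero>)) \<longlonglongrightarrow> 0"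
    using cnorm_completion[OF X(1)] assms(2) by (simp add: cauchyD a_rules)
  then show ?thesis using X by (simp add: zero_completion cls_eq_iff cauchy_const)
qed

lemmas Metric_space_completion =
  Metric_space_cdist[OF star_algebra_completion cstar_seminorm_completion cnorm_completion_definite]

section \<open>Completeness, and extension of states\<close>

lemma cstar_seminormed_completion: "cstar_seminormed Compl (cnorm Compl)"
  by (intro cstar_seminormedI star_algebra_completion
      cstar_seminorm_completion)

lemma to_completion_approx:
  assumes X: "X \<in> Cauchy_A" and e: "0 < e"
  shows "\<exists>N. \<forall>n\<ge>N. cnorm Compl (cls X \<ominus>\<^bsub>Compl\<^esub> \<iota> (X n)) \<le> e"
proof -
  obtain N where N: "\<forall>m\<ge>N. \<forall>n\<ge>N. p (X m \<ominus> X n) < e" using cauchyD2[OF X e] by blast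
  have "cnorm Compl (cls X \<ominus>\<^bsub>Compl\<^esub> \<iota> (X n)) \<le> e" if "n \<ge> N" for n
  proof (rule LIMSEQ_le_const2)
    show "(\<lambda>m. p (X m \<ominus> X n)) \<longlonglongrightarrow> cnorm Compl (cls X \<ominus>\<^bsub>Compl\<^esub> \<iota> (X n))"
      unfolding to_completion_cls
      by (rule cnorm_minus_completion[OF X cauchy_const]) (rule cauchyD[OF X])
    show "\<exists>N. \<forall>m\<ge>N. p (X m \<ominus> X n) \<le> e" using N that by (meson less_imp_le)
  qed
  then show ?thesis by blast
qed

text \<open>The terms of a Cauchy sequence of classes are replaced by elements \<open>Y k\<close> of
  \<open>A\<close> at a distance of at most 1 / (k + 1). These form a Cauchy sequence in
  \<open>A\<close>, and its class is the limit.\<close>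

theorem cstar_algebra_completion: "cstar_algebra Compl"
proof -
  interpret M: Metric_space "carrier Compl" "cdist Compl" by (rule Metric_space_completion)
  interpret C: cstar_seminormed Compl "cnorm Compl" by (rule cstar_seminormed_completion)
  let ?d = "\<lambda>S T. cnorm Compl (S \<ominus>\<^bsub>Compl\<^esub> T)"
  have "\<exists>S. limitin M.mtopology \<sigma> S sequentially" if "M.MCauchy \<sigma>" for \<sigma>
  proof -
    have \<sigma>: "\<sigma> k \<in> carrier Compl" for k using that by (auto simp: M.MCauchy_def)
    have \<sigma>C: "\<exists>N. \<forall>m n. N \<le> m \<longrightarrow> N \<le> n \<longrightarrow> ?d (\<sigma> m) (\<sigma> n) < e" if "0 < e" for e
      using \<open>M.MCauchy \<sigma>\<close> that \<sigma> by (simp add: M.MCauchy_def cdist_def)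
    have "\<exists>a. a \<in> carrier A \<and> ?d (\<sigma> k) (\<iota> a) \<le> 1 / real (Suc k)" for k
    proof -
      obtain X where X: "X \<in> Cauchy_A" "\<sigma> k = cls X" using \<sigma>[of k] by (rule completionE)
      then show ?thesis
        using to_completion_approx[OF X(1), of "1 / real (Suc k)"] cauchyD[OF X(1)] by auto
    qed
    then obtain Y where Y: "\<And>k. Y k \<in> carrier A"
      and YD: "\<And>k. ?d (\<sigma> k) (\<iota> (Y k)) \<le> 1 / real (Suc k)" by metis
    have tY: "\<iota> (Y k) \<in> carrier Compl" for k using Y by simp
    have small: "\<exists>N. \<forall>k\<ge>N. 1 / real (Suc k) < e" if e: "0 < e" for e :: real
    proof -
      obtain N where N: "1 / real (Suc N) < e" using reals_Archimedean[OF e] by (auto simp: inverse_eq_divide)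
      have "1 / real (Suc k) \<le> 1 / real (Suc N)" if "k \<ge> N" for k
        using that by (intro divide_left_mono) auto
      then show ?thesis using N by (meson order_le_less_trans)
    qed
    have YC: "Y \<in> Cauchy_A"
    proof (rule cauchyI[OF Y])
      fix e :: real assume "0 < e"
      then obtain M N where M: "\<forall>k\<ge>M. 1 / real (Suc k) < e / 3"
        and N: "\<forall>m n. N \<le> m \<longrightarrow> N \<le> n \<longrightarrow> ?d (\<sigma> m) (\<sigma> n) < e / 3"
        using small[of "e / 3"] \<sigma>C[of "e / 3"] by auto
      have "p (Y m \<ominus> Y n) < e" if "m \<ge> max M N" "n \<ge> max M N" for m n
      proof -
        have "p (Y m \<ominus> Y n) = ?d (\<iota> (Y m)) (\<iota> (Y n))"
          using Y by (simp add: cnorm_to_completion flip: to_completion_minus)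
        also have "\<dots> \<le> ?d (\<iota> (Y m)) (\<sigma> m) + ?d (\<sigma> m) (\<iota> (Y n))"
          by (rule C.p_minus_triangle[OF tY \<sigma> tY])
        also have "\<dots> \<le> ?d (\<iota> (Y m)) (\<sigma> m) +
            (?d (\<sigma> m) (\<sigma> n) + ?d (\<sigma> n) (\<iota> (Y n)))"
          using C.p_minus_triangle[OF \<sigma>[of m] \<sigma>[of n] tY] by simp
        also have "\<dots> < e"
        proof -
          have "1 / real (Suc m) < e / 3" "1 / real (Suc n) < e / 3" "?d (\<sigma> m) (\<sigma> n) < e / 3"
            using M N that by auto
          then show ?thesis
            using YD[of m] YD[of n] C.p_minus_commute[OF \<sigma>[of m] tY[of m]] by linarith
        qed
        finally show ?thesis .
      qed
      then show "\<exists>N. \<forall>m\<ge>N. \<forall>n\<ge>N. p (Y m \<ominus> Y n) < e" by blast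
    qed
    have "limitin M.mtopology \<sigma> (cls Y) sequentially"
      unfolding M.limitin_metric
    proof (intro conjI allI impI)
      show cY: "cls Y \<in> carrier Compl" using YC by simp
      fix e :: real assume "0 < e"
      then obtain M N where M: "\<forall>k\<ge>M. 1 / real (Suc k) < e / 2"
        and N: "\<forall>n\<ge>N. ?d (cls Y) (\<iota> (Y n)) \<le> e / 2"
        using small[of "e / 2"] to_completion_approx[OF YC, of "e / 2"] by auto
      have "?d (\<sigma> k) (cls Y) < e" if "k \<ge> max M N" for k
      proof -
        have "1 / real (Suc k) < e / 2" "?d (cls Y) (\<iota> (Y k)) \<le> e / 2"
          using M N that by auto
        then show ?thesis
          using C.p_minus_triangle[OF \<sigma>[of k] tY[of k] cY] YD[of k]
            C.p_minus_commute[OF cY tY[of k]] by linarith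
      qed
      then show "\<forall>\<^sub>F k in sequentially. \<sigma> k \<in> carrier Compl \<and> cdist Compl (\<sigma> k) (cls Y) < e"
        unfolding eventually_sequentially using \<sigma> cY
        by (intro exI[of _ "max M N"]) (simp add: cdist_def)
    qed
    then show ?thesis by blast
  qed
  then have "M.mcomplete" by (simp add: M.mcomplete_def)
  then show ?thesis
    unfolding cstar_algebra_def
    using star_algebra_completion cstar_seminorm_completion cnorm_completion_definite by blast
qed

text \<open>A functional bounded by the seminorm extends by continuity. It stays positive because
  the set of nonnegative reals is closed in the complex plane.\<close>

lemma state_extension:
  assumes pos: "positive_functional A \<omega>" and unit: "\<omega> \<one> = 1"
    and bound: "\<And>x. x \<in> carrier A \<Longrightarrow> cmod (\<omega> x) \<le> K * p x"
  obtains \<phi> where "state Compl \<phi>" "\<And>a. a \<in> carrier A \<Longrightarrow> \<phi> (\<iota> a) = \<omega> a"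
proof -
  interpret star_algebra_functional A \<omega>
    by (intro star_algebra_functionalI star_algebra_axioms pos)
  \<comment> \<open>The representative is an arbitrary choice. The fact \<open>\<phi>\<close> below
    shows, from the bound on \<open>\<omega>\<close>, that the limit does not depend on it.\<close>
  define \<phi> where "\<phi> S = lim (\<lambda>n. \<omega> ((SOME X. X \<in> Cauchy_A \<and> S = cls X) n))" for S
  have conv: "convergent (\<lambda>n. \<omega> (X n))" if X: "X \<in> Cauchy_A" for X
  proof (rule Cauchy_convergent, rule CauchyI)
    fix e :: real assume e: "0 < e"
    \<comment> \<open>\<open>K\<close> may be 0 or negative, so \<open>\<bar>K\<bar> + 1\<close>
      serves as the positive constant.\<close>
    obtain N where N: "\<forall>m\<ge>N. \<forall>n\<ge>N. p (X m \<ominus> X n) < e / (\<bar>K\<bar> + 1)"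
      using cauchyD2[OF X, of "e / (\<bar>K\<bar> + 1)"] e by auto
    have "cmod (\<omega> (X m) - \<omega> (X n)) < e" if "m \<ge> N" "n \<ge> N" for m n
    proof -
      have c: "X m \<ominus> X n \<in> carrier A" using cauchyD[OF X] by simp
      have "cmod (\<omega> (X m) - \<omega> (X n)) = cmod (\<omega> (X m \<ominus> X n))"
        using cauchyD[OF X] by (simp add: minus)
      also have "\<dots> \<le> K * p (X m \<ominus> X n)" by (rule bound[OF c])
      also have "\<dots> \<le> (\<bar>K\<bar> + 1) * p (X m \<ominus> X n)"
        using p_nonneg[OF c] by (intro mult_right_mono) auto
      also have "\<dots> < e" using N that by (simp add: pos_less_divide_eq mult.commute)
      finally show ?thesis .
    qed
    then show "\<exists>M. \<forall>m\<ge>M. \<forall>n\<ge>M. cmod (\<omega> (X m) - \<omega> (X n)) < e" by blast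
  qed
  have \<phi>: "(\<lambda>n. \<omega> (X n)) \<longlonglongrightarrow> \<phi> (cls X)" if X: "X \<in> Cauchy_A" for X
  proof -
    define Y where "Y = (SOME Y. Y \<in> Cauchy_A \<and> cls X = cls Y)"
    have Y: "Y \<in> Cauchy_A" "cls X = cls Y"
      unfolding Y_def using someI[of "\<lambda>Y. Y \<in> Cauchy_A \<and> cls X = cls Y" X] X by auto
    have "(\<lambda>n. \<omega> (Y n)) \<longlonglongrightarrow> \<phi> (cls X)"
      unfolding \<phi>_def using conv[OF Y(1)] by (simp add: convergent_LIMSEQ_iff Y_def)
    moreover have "(\<lambda>n. \<omega> (X n) - \<omega> (Y n)) \<longlonglongrightarrow> 0"
    proof (rule Lim_null_comparison)
      show "(\<lambda>n. K * p (X n \<ominus> Y n)) \<longlonglongrightarrow> 0"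
        using Y X by (intro tendsto_mult_right_zero) (simp add: cls_eq_iff)
      show "\<forall>\<^sub>F n in sequentially. cmod (\<omega> (X n) - \<omega> (Y n)) \<le> K * p (X n \<ominus> Y n)"
        using bound cauchyD[OF X] cauchyD[OF Y(1)] by (simp flip: minus)
    qed
    ultimately have "(\<lambda>n. \<omega> (Y n) + (\<omega> (X n) - \<omega> (Y n))) \<longlonglongrightarrow> \<phi> (cls X) + 0"
      by (rule tendsto_add)
    then show ?thesis by simp
  qed
  have "state Compl \<phi>"
    unfolding state_def carrier_completion
  proof (safe)
    fix X Y assume X: "X \<in> Cauchy_A" and Y: "Y \<in> Cauchy_A"
    show "\<phi> (cls X \<oplus>\<^bsub>Compl\<^esub> cls Y) = \<phi> (cls X) + \<phi> (cls Y)"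
      using LIMSEQ_unique[OF \<phi>[OF add_cauchy[OF X Y]]] tendsto_add[OF \<phi>[OF X] \<phi>[OF Y]] X Y
      by (simp add: add_completion add cauchyD)
  next
    fix c X assume X: "X \<in> Cauchy_A"
    show "\<phi> (c \<odot>\<^bsub>Compl\<^esub> cls X) = c * \<phi> (cls X)"
      using LIMSEQ_unique[OF \<phi>[OF smult_cauchy[OF X, of c]]] tendsto_mult_left[OF \<phi>[OF X], of c] X
      by (simp add: smult_completion smult cauchyD)
  next
    fix X assume X: "X \<in> Cauchy_A"
    have "(\<lambda>n. \<omega> (star A (X n) \<otimes> X n)) \<longlonglongrightarrow> \<phi> (star Compl (cls X) \<otimes>\<^bsub>Compl\<^esub> cls X)"
      using \<phi>[OF mult_cauchy[OF star_cauchy[OF X] X]] X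
      by (simp add: star_completion mult_completion star_cauchy)
    from closed_sequentially[OF closed_nonneg_Reals_complex star_mult_nonneg[OF cauchyD[OF X]] this]
    show "\<phi> (star Compl (cls X) \<otimes>\<^bsub>Compl\<^esub> cls X) \<in> \<real>\<^sub>\<ge>\<^sub>0" .
  next
    show "\<phi> \<one>\<^bsub>Compl\<^esub> = 1"
      using LIMSEQ_unique[OF \<phi>[OF cauchy_const[of \<one>]] tendsto_const] unit
      by (simp add: one_completion)
  qed
  moreover have "\<phi> (\<iota> a) = \<omega> a" if "a \<in> carrier A" for a
    using LIMSEQ_unique[OF \<phi>[OF cauchy_const[OF that]] tendsto_const] by (simp add: to_completion_cls)
  ultimately show thesis by (rule that)
qed

end


section \<open>States on C*-algebras\<close>

locale cstar = cstar_seminormed A "cnorm A" for A :: "('a, 'z) cstar_alg_scheme" (structure) +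
  assumes definite: "\<lbrakk>x \<in> carrier A; cnorm A x = 0\<rbrakk> \<Longrightarrow> x = \<zero>"
    and complete: "Metric_space.mcomplete (carrier A) (cdist A)"
begin

lemma Metric_space: "Metric_space (carrier A) (cdist A)"
  by (rule Metric_space_cdist[OF star_algebra_axioms cstar_seminorm definite])

text \<open>A square root \<open>1 - s\<close> of \<open>1 - h\<close>, where \<open>s\<close> is the fixed point of the contraction
  \<open>s \<mapsto> (h + s\<^sup>2) / 2\<close>.\<close>

lemma ex_sqrt_one_minus:
  assumes h: "h \<in> carrier A" "star A h = h" "cnorm A h \<le> 1 / 4"
  obtains t where "t \<in> carrier A" "star A t \<otimes> t = \<one> \<ominus> h"
proof -
  let ?p = "cnorm A"
  interpret M: Metric_space "carrier A" "cdist A" by (rule Metric_space)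
  \<comment> \<open>The radius fits the bound 1 / 4 on \<open>h\<close>. The map \<open>f\<close>
    stays in the ball because (1/4 + 1/4) / 2 \<le> 1/2. It contracts by 1 / 2 because squaring does
    not increase distances between elements of norm at most 1 / 2.\<close>
  define B where "B = M.mcball \<zero> (1 / 2)"
  have B: "s \<in> B \<longleftrightarrow> s \<in> carrier A \<and> ?p s \<le> 1 / 2" for s
    using p_uminus[of s] by (auto simp: B_def cdist_def a_rules)
  interpret S: Submetric "carrier A" "cdist A" B by unfold_locales (auto simp: B)
  have S: "S.sub.mcomplete"
    using S.closedin_mcomplete_imp_mcomplete complete by (simp add: B_def)
  define f where "f s = (1 / 2) \<odot> (h \<oplus> s \<otimes> s)" for s
  have fA: "f s \<in> carrier A" if "s \<in> carrier A" for s using that h by (simp add: f_def)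
  have fB: "f s \<in> B" if "s \<in> B" for s
  proof -
    have s: "s \<in> carrier A" "?p s \<le> 1 / 2" using that B by auto
    have "?p (s \<otimes> s) \<le> ?p s * ?p s" using s by (intro p_mult)
    also have "\<dots> \<le> 1 / 2 * (1 / 2)" using s p_nonneg[OF s(1)] by (intro mult_mono) auto
    finally have "?p (h \<oplus> s \<otimes> s) \<le> 1 / 4 + 1 / 4"
      using p_add[of h "s \<otimes> s"] s h by simp
    then show ?thesis using s h fA by (simp add: B f_def p_smult)
  qed
  have contr: "?p (f s \<ominus> f t) \<le> 1 / 2 * ?p (s \<ominus> t)" if "s \<in> B" "t \<in> B" for s t
  proof -
    have s: "s \<in> carrier A" "?p s \<le> 1 / 2" and t: "t \<in> carrier A" "?p t \<le> 1 / 2"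
      using that B by auto
    have "?p (f s \<ominus> f t) = 1 / 2 * ?p ((h \<oplus> s \<otimes> s) \<ominus> (h \<oplus> t \<otimes> t))"
      unfolding f_def using s t h by (subst p_smult_diff) auto
    also have "(h \<oplus> s \<otimes> s) \<ominus> (h \<oplus> t \<otimes> t) = (s \<otimes> s) \<ominus> (t \<otimes> t)"
      using s t h by (simp add: a_rules)
    also have "?p ((s \<otimes> s) \<ominus> (t \<otimes> t)) \<le> ?p (s \<ominus> t) * ?p s + ?p t * ?p (s \<ominus> t)"
      using s t by (intro p_mult_diff_le)
    also have "\<dots> \<le> ?p (s \<ominus> t) * (1 / 2) + 1 / 2 * ?p (s \<ominus> t)"
      using s t p_nonneg[of "s \<ominus> t"] by (intro add_mono mult_left_mono mult_right_mono) auto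
    finally show ?thesis by simp
  qed
  obtain s where s: "s \<in> B" "f s = s"
  proof (rule S.sub.Banach_fixedpoint_thm[OF S, of f "1 / 2"])
    show "B \<noteq> {}" using B[of \<zero>] by auto
    show "f \<in> B \<rightarrow> B" using fB by auto
    show "cdist A (f x) (f y) \<le> 1 / 2 * cdist A x y" if "x \<in> B" "y \<in> B" for x y
      using contr[OF that] that B fA by (simp add: cdist_def)
  qed auto
  have sA: "s \<in> carrier A" using s B by auto
  \<comment> \<open>\<open>star A s\<close> is a fixed point in the same ball, so by the contraction
    estimate it equals \<open>s\<close>.\<close>
  have "star A s \<in> B" using s B by (simp add: p_star)
  moreover have "f (star A s) = star A s"
  proof -
    have "f (star A s) = star A (f s)"
      using sA h by (simp add: f_def star_smult star_add star_mult)
    then show ?thesis using s by simp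
  qed
  ultimately have "?p (s \<ominus> star A s) \<le> 1 / 2 * ?p (s \<ominus> star A s)"
    using contr[of s "star A s"] s by simp
  then have "?p (s \<ominus> star A s) = 0"
    using p_nonneg[of "s \<ominus> star A s"] sA by simp
  then have star_s: "star A s = s"
    using definite[of "s \<ominus> star A s"] minus_eq_zero_iff[of s "star A s"] sA by simp
  have "h \<oplus> s \<otimes> s = s \<oplus> s"
  proof -
    have "2 \<odot> f s = h \<oplus> s \<otimes> s" using sA h by (simp add: f_def smult_smult)
    moreover have "2 \<odot> s = s \<oplus> s" using add_smult[OF sA, of 1 1] sA by simp
    ultimately show ?thesis using s by simp
  qed
  moreover have "s \<otimes> s = (h \<oplus> s \<otimes> s) \<ominus> h" using sA h by (simp add: a_rules)
  ultimately have ss: "s \<otimes> s = (s \<oplus> s) \<ominus> h" by simp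
  have "star A (\<one> \<ominus> s) = \<one> \<ominus> s"
    using sA star_s by (simp add: star_minus)
  then have "star A (\<one> \<ominus> s) \<otimes> (\<one> \<ominus> s) = \<one> \<ominus> (s \<oplus> s) \<oplus> s \<otimes> s"
    using sA by (simp add: a_rules)
  also have "\<dots> = \<one> \<ominus> h"
  proof -
    have "\<one> \<ominus> u \<oplus> (u \<ominus> h) = \<one> \<ominus> h" if "u \<in> carrier A" for u
      using that h by (simp add: a_rules(7,14,18))
    then show ?thesis unfolding ss using sA by simp
  qed
  finally show thesis using that[of "\<one> \<ominus> s"] sA by simp
qed

text \<open>Scaling \<open>star A x \<otimes> x\<close> by \<open>1 / r\<^sup>2\<close> with
  \<open>r = 2 * cnorm A x\<close> gives norm exactly 1 / 4, the limit in
  \<open>ex_sqrt_one_minus\<close>. This is the origin of the factor 2 in the later bounds.\<close>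

lemma ex_sqrt_norm_minus:
  assumes x: "x \<in> carrier A"
  obtains t where "t \<in> carrier A" "star A t \<otimes> t = of_real ((2 * cnorm A x)\<^sup>2) \<odot> \<one> \<ominus> star A x \<otimes> x"
proof (cases "cnorm A x = 0")
  case True
  then have "x = \<zero>" using definite[OF x] by simp
  then show thesis using True that[of \<zero>] by (simp add: a_rules)
next
  case False
  define r where "r = 2 * cnorm A x"
  have r: "0 < r" using False p_nonneg[OF x] by (simp add: r_def)
  define h where "h = of_real (1 / r\<^sup>2) \<odot> (star A x \<otimes> x)"
  have hA: "h \<in> carrier A" and hs: "star A h = h"
    using x by (simp_all add: h_def star_smult star_mult star_star)
  have "cnorm A h = 1 / r\<^sup>2 * (cnorm A x)\<^sup>2"
    using x by (simp add: h_def p_smult p_star_mult norm_divide norm_power)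
  then have "cnorm A h \<le> 1 / 4" using False by (simp add: r_def power_mult_distrib)
  then obtain t where t: "t \<in> carrier A" "star A t \<otimes> t = \<one> \<ominus> h"
    using ex_sqrt_one_minus[OF hA hs] by blast
  have "star A (of_real r \<odot> t) \<otimes> (of_real r \<odot> t) = of_real (r\<^sup>2) \<odot> (\<one> \<ominus> h)"
    using t hA by (simp add: star_smult smult_mult_left smult_mult_right smult_smult power2_eq_square)
  also have "\<dots> = of_real (r\<^sup>2) \<odot> \<one> \<ominus> of_real (r\<^sup>2) \<odot> h"
    using hA by (simp add: minus_conv smult_add smult_smult)
  also have "of_real (r\<^sup>2) \<odot> h = star A x \<otimes> x"
    using x r by (simp add: h_def smult_smult)
  finally show thesis using that[of "of_real r \<odot> t"] t by (simp add: r_def)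
qed

text \<open>\<open>t\<close> is the square root from \<open>ex_sqrt_norm_minus\<close>, the same for
  all \<open>\<omega>\<close>. Stated for two vectors \<open>y\<close> and \<open>z\<close>, the
  identity says that the defect of boundedness is itself a positive semidefinite kernel, which can
  be multiplied with kernels of another algebra.\<close>

lemma ex_norm_defect:
  assumes x: "x \<in> carrier A"
  obtains t where "t \<in> carrier A"
    "\<And>\<omega> y z. \<lbrakk>positive_functional A \<omega>; y \<in> carrier A; z \<in> carrier A\<rbrakk> \<Longrightarrow>
      \<omega> (star A (t \<otimes> y) \<otimes> (t \<otimes> z)) =
      of_real ((2 * cnorm A x)\<^sup>2) * \<omega> (star A y \<otimes> z) - \<omega> (star A (x \<otimes> y) \<otimes> (x \<otimes> z))"
proof -
  define c where "c = (2 * cnorm A x)\<^sup>2"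
  obtain t where t: "t \<in> carrier A" "star A t \<otimes> t = of_real c \<odot> \<one> \<ominus> star A x \<otimes> x"
    unfolding c_def using ex_sqrt_norm_minus[OF x] by blast
  have "\<omega> (star A (t \<otimes> y) \<otimes> (t \<otimes> z)) = of_real c * \<omega> (star A y \<otimes> z) - \<omega> (star A (x \<otimes> y) \<otimes> (x \<otimes> z))"
    if \<omega>: "positive_functional A \<omega>" and yz: "y \<in> carrier A" "z \<in> carrier A" for \<omega> y z
  proof -
    interpret star_algebra_functional A \<omega>
      by (intro star_algebra_functionalI star_algebra_axioms \<omega>)
    have "star A (t \<otimes> y) \<otimes> (t \<otimes> z) = star A y \<otimes> ((star A t \<otimes> t) \<otimes> z)"
      using t(1) yz by (simp add: star_mult a_rules)
    also have "\<dots> = of_real c \<odot> (star A y \<otimes> z) \<ominus> star A (x \<otimes> y) \<otimes> (x \<otimes> z)"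
      unfolding t(2) using yz x
      by (simp add: minus_conv star_mult a_rules smult_mult_left smult_mult_right)
    finally show ?thesis using x yz by (simp add: minus smult)
  qed
  then show thesis using that[OF t(1)] by (simp add: c_def)
qed

lemma gns_norm_mult_le:
  assumes \<omega>: "positive_functional A \<omega>" and x: "x \<in> carrier A" and y: "y \<in> carrier A"
  shows "gns_norm A \<omega> (x \<otimes> y) \<le> 2 * cnorm A x * gns_norm A \<omega> y"
proof -
  interpret star_algebra_functional A \<omega>
    by (intro star_algebra_functionalI star_algebra_axioms \<omega>)
  obtain t where t: "t \<in> carrier A" "\<omega> (star A (t \<otimes> y) \<otimes> (t \<otimes> y)) =
      of_real ((2 * cnorm A x)\<^sup>2) * \<omega> (star A y \<otimes> y) - \<omega> (star A (x \<otimes> y) \<otimes> (x \<otimes> y))"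
    using ex_norm_defect[OF x] \<omega> y by metis
  have "(gns_norm A \<omega> (t \<otimes> y))\<^sup>2 = (2 * cnorm A x)\<^sup>2 * (gns_norm A \<omega> y)\<^sup>2 - (gns_norm A \<omega> (x \<otimes> y))\<^sup>2"
    using t x y by (simp add: gns_norm_square del: of_real_power)
  then have "(gns_norm A \<omega> (x \<otimes> y))\<^sup>2 \<le> (2 * cnorm A x)\<^sup>2 * (gns_norm A \<omega> y)\<^sup>2"
    by (metis zero_le_power2 diff_ge_0_iff_ge)
  then have "(gns_norm A \<omega> (x \<otimes> y))\<^sup>2 \<le> (2 * cnorm A x * gns_norm A \<omega> y)\<^sup>2"
    by (simp only: power_mult_distrib)
  then show ?thesis
    by (rule power2_le_imp_le) (use p_nonneg[OF x] gns_norm_nonneg[OF y] in simp)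
qed

lemma cmod_state_le:
  assumes \<phi>: "state A \<phi>" and x: "x \<in> carrier A"
  shows "cmod (\<phi> x) \<le> 2 * cnorm A x"
proof -
  interpret star_algebra_functional A \<phi> using \<phi> by (rule state_functional)
  have "gns_norm A \<phi> \<one> = 1" using \<phi> by (simp add: gns_norm_def a_rules state_iff)
  then show ?thesis
    using cauchy_schwarz[of \<one> x] gns_norm_mult_le[OF pos x, of \<one>] x by (simp add: a_rules)
qed

end

lemma cstar_iff: "cstar_algebra A \<longleftrightarrow> cstar A"
  by (auto simp: cstar_algebra_def cstar_def cstar_axioms_def cstar_seminormed_def
      cstar_seminormed_axioms_def)


section \<open>Algebras of monoids with involution\<close>

locale star_monoid = monoid M for M :: "('m, 'z) star_monoid_scheme" (structure) +
  assumes invol_closed [simp, intro]: "x \<in> carrier M \<Longrightarrow> invol M x \<in> carrier M"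
    and invol_invol [simp]: "x \<in> carrier M \<Longrightarrow> invol M (invol M x) = x"
    and invol_mult: "\<lbrakk>x \<in> carrier M; y \<in> carrier M\<rbrakk> \<Longrightarrow> invol M (x \<otimes> y) = invol M y \<otimes> invol M x"

definition lin_ext :: "('m \<Rightarrow> complex) \<Rightarrow> ('m \<Rightarrow> complex) \<Rightarrow> complex" where
  "lin_ext h f = (\<Sum>x\<in>supp f. f x * h x)"

lemma lin_ext_superset:
  "\<lbrakk>finite F; supp f \<subseteq> F\<rbrakk> \<Longrightarrow> lin_ext h f = (\<Sum>x\<in>F. f x * h x)"
  unfolding lin_ext_def by (rule sum.mono_neutral_left) (auto simp: supp_def)

lemma lin_ext_add:
  assumes "finite (supp f)" "finite (supp g)"
  shows "lin_ext h (\<lambda>z. f z + g z) = lin_ext h f + lin_ext h g"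
proof -
  have "supp (\<lambda>z. f z + g z) \<subseteq> supp f \<union> supp g" by (auto simp: supp_def)
  then show ?thesis
    using assms by (simp add: lin_ext_superset[of "supp f \<union> supp g"] sum.distrib distrib_right)
qed

lemma lin_ext_smult:
  assumes "finite (supp f)" shows "lin_ext h (\<lambda>z. c * f z) = c * lin_ext h f"
proof -
  have "supp (\<lambda>z. c * f z) \<subseteq> supp f" by (auto simp: supp_def)
  then show ?thesis
    using assms by (simp add: lin_ext_superset[of "supp f"] sum_distrib_left mult.assoc)
qed

lemma supp_delta [simp]: "supp (delta m) = {m}"
  by (auto simp: supp_def delta_def)

lemma lin_ext_delta [simp]: "lin_ext h (delta m) = h m"
  by (simp add: lin_ext_def) (simp add: delta_def)

lemma lin_ext_eval: "finite (supp f) \<Longrightarrow> lin_ext (\<lambda>x. if x = z then 1 else 0) f = f z"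
  unfolding lin_ext_def
  by (simp add: if_distrib[of "(*) _"] sum.delta cong: if_cong) (simp add: supp_def)

context star_monoid
begin

abbreviation "MA \<equiv> monoid_algebra M"
abbreviation MA_mult_syntax (infixl "\<star>" 70) where "f \<star> g \<equiv> f \<otimes>\<^bsub>MA\<^esub> g"

lemma MA_carrier: "f \<in> carrier MA \<longleftrightarrow> finite (supp f) \<and> supp f \<subseteq> carrier M"
  by (simp add: monoid_algebra_def)

lemma MA_supp: "f \<in> carrier MA \<Longrightarrow> finite (supp f)" "\<lbrakk>f \<in> carrier MA; x \<in> supp f\<rbrakk> \<Longrightarrow> x \<in> carrier M"
  by (auto simp: MA_carrier)

lemma MA_simps:
  "\<one>\<^bsub>MA\<^esub> = delta \<one>" "\<zero>\<^bsub>MA\<^esub> = (\<lambda>_. 0)" "f \<oplus>\<^bsub>MA\<^esub> g = (\<lambda>z. f z + g z)" "c \<odot>\<^bsub>MA\<^esub> f = (\<lambda>z. c * f z)"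
  by (simp_all add: monoid_algebra_def)

lemma MA_mult: "f \<star> g = (\<lambda>z. \<Sum>x\<in>supp f. \<Sum>y\<in>supp g. if x \<otimes> y = z then f x * g y else 0)"
  and MA_star: "star MA f = (\<lambda>z. \<Sum>x\<in>supp f. if invol M x = z then cnj (f x) else 0)"
  by (simp_all add: monoid_algebra_def)

lemma supp_mult: "supp (f \<star> g) \<subseteq> (\<lambda>(x, y). x \<otimes> y) ` (supp f \<times> supp g)"
proof
  fix z assume "z \<in> supp (f \<star> g)"
  then have "(\<Sum>x\<in>supp f. \<Sum>y\<in>supp g. if x \<otimes> y = z then f x * g y else 0) \<noteq> 0"
    by (simp add: supp_def MA_mult)
  then obtain x where x: "x \<in> supp f" "(\<Sum>y\<in>supp g. if x \<otimes> y = z then f x * g y else 0) \<noteq> 0"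
    by (rule sum.not_neutral_contains_not_neutral)
  from x(2) obtain y where "y \<in> supp g" "(if x \<otimes> y = z then f x * g y else 0) \<noteq> 0"
    by (rule sum.not_neutral_contains_not_neutral)
  with x show "z \<in> (\<lambda>(x, y). x \<otimes> y) ` (supp f \<times> supp g)"
    by (auto split: if_splits)
qed

lemma supp_star: "supp (star MA f) \<subseteq> invol M ` supp f"
proof
  fix z assume "z \<in> supp (star MA f)"
  then have "(\<Sum>x\<in>supp f. if invol M x = z then cnj (f x) else 0) \<noteq> 0"
    by (simp add: supp_def MA_star)
  then obtain x where "x \<in> supp f" "(if invol M x = z then cnj (f x) else 0) \<noteq> 0"
    by (rule sum.not_neutral_contains_not_neutral)
  then show "z \<in> invol M ` supp f" by (auto split: if_splits)
qed

lemma MA_closed: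
  shows one_in_MA: "\<one>\<^bsub>MA\<^esub> \<in> carrier MA" and zero_in_MA: "\<zero>\<^bsub>MA\<^esub> \<in> carrier MA"
    and delta_in_MA: "m \<in> carrier M \<Longrightarrow> delta m \<in> carrier MA"
    and add_in_MA: "\<lbrakk>f \<in> carrier MA; g \<in> carrier MA\<rbrakk> \<Longrightarrow> f \<oplus>\<^bsub>MA\<^esub> g \<in> carrier MA"
    and smult_in_MA: "f \<in> carrier MA \<Longrightarrow> c \<odot>\<^bsub>MA\<^esub> f \<in> carrier MA"
    and mult_in_MA: "\<lbrakk>f \<in> carrier MA; g \<in> carrier MA\<rbrakk> \<Longrightarrow> f \<star> g \<in> carrier MA"
    and star_in_MA: "f \<in> carrier MA \<Longrightarrow> star MA f \<in> carrier MA"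
proof -
  show "\<one>\<^bsub>MA\<^esub> \<in> carrier MA" "\<zero>\<^bsub>MA\<^esub> \<in> carrier MA" "m \<in> carrier M \<Longrightarrow> delta m \<in> carrier MA"
    by (simp_all add: MA_carrier MA_simps) (simp add: supp_def)
  have "supp (\<lambda>z. f z + g z) \<subseteq> supp f \<union> supp g" by (auto simp: supp_def)
  then show "\<lbrakk>f \<in> carrier MA; g \<in> carrier MA\<rbrakk> \<Longrightarrow> f \<oplus>\<^bsub>MA\<^esub> g \<in> carrier MA"
    unfolding MA_carrier MA_simps by (meson finite_Un finite_subset le_sup_iff subset_trans)
  have "supp (\<lambda>z. c * f z) \<subseteq> supp f" by (auto simp: supp_def)
  then show "f \<in> carrier MA \<Longrightarrow> c \<odot>\<^bsub>MA\<^esub> f \<in> carrier MA"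
    unfolding MA_carrier MA_simps by (meson finite_subset subset_trans)
  show "f \<star> g \<in> carrier MA" if "f \<in> carrier MA" "g \<in> carrier MA"
  proof -
    have "finite ((\<lambda>(x, y). x \<otimes> y) ` (supp f \<times> supp g))" "(\<lambda>(x, y). x \<otimes> y) ` (supp f \<times> supp g) \<subseteq> carrier M"
      using that by (auto simp: MA_carrier)
    then show ?thesis
      unfolding MA_carrier using supp_mult[of f g] by (meson finite_subset subset_trans)
  qed
  show "star MA f \<in> carrier MA" if "f \<in> carrier MA"
  proof -
    have "finite (invol M ` supp f)" "invol M ` supp f \<subseteq> carrier M"
      using that by (auto simp: MA_carrier)
    then show ?thesis
      unfolding MA_carrier using supp_star[of f] by (meson finite_subset subset_trans)
  qed
qed

lemma lin_ext_mult:
  assumes "f \<in> carrier MA" "g \<in> carrier MA"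
  shows "lin_ext h (f \<star> g) = (\<Sum>x\<in>supp f. \<Sum>y\<in>supp g. f x * g y * h (x \<otimes> y))"
proof -
  define F where "F = (\<lambda>(x, y). x \<otimes> y) ` (supp f \<times> supp g)"
  have F: "finite F" "supp (f \<star> g) \<subseteq> F"
    using supp_mult assms by (auto simp: F_def MA_carrier)
  have "lin_ext h (f \<star> g) =
      (\<Sum>z\<in>F. \<Sum>x\<in>supp f. \<Sum>y\<in>supp g. if x \<otimes> y = z then f x * g y * h (x \<otimes> y) else 0)"
    unfolding lin_ext_superset[OF F]
    by (intro sum.cong refl) (auto simp: MA_mult sum_distrib_right intro!: sum.cong)
  also have "\<dots> = (\<Sum>x\<in>supp f. \<Sum>z\<in>F. \<Sum>y\<in>supp g. if x \<otimes> y = z then f x * g y * h (x \<otimes> y) else 0)"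
    by (rule sum.swap)
  also have "\<dots> = (\<Sum>x\<in>supp f. \<Sum>y\<in>supp g. \<Sum>z\<in>F. if x \<otimes> y = z then f x * g y * h (x \<otimes> y) else 0)"
    by (intro sum.cong refl sum.swap)
  also have "\<dots> = (\<Sum>x\<in>supp f. \<Sum>y\<in>supp g. f x * g y * h (x \<otimes> y))"
    using F(1) by (intro sum.cong refl) (auto simp: F_def)
  finally show ?thesis .
qed

lemma lin_ext_star:
  assumes "f \<in> carrier MA"
  shows "lin_ext h (star MA f) = (\<Sum>x\<in>supp f. cnj (f x) * h (invol M x))"
proof -
  define F where "F = invol M ` supp f"
  have F: "finite F" "supp (star MA f) \<subseteq> F"
    using supp_star assms by (auto simp: F_def MA_carrier)
  have "lin_ext h (star MA f) =
      (\<Sum>z\<in>F. \<Sum>x\<in>supp f. if invol M x = z then cnj (f x) * h (invol M x) else 0)"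
    unfolding lin_ext_superset[OF F]
    by (intro sum.cong refl) (auto simp: MA_star sum_distrib_right intro!: sum.cong)
  also have "\<dots> = (\<Sum>x\<in>supp f. \<Sum>z\<in>F. if invol M x = z then cnj (f x) * h (invol M x) else 0)"
    by (rule sum.swap)
  also have "\<dots> = (\<Sum>x\<in>supp f. cnj (f x) * h (invol M x))"
    using F(1) by (intro sum.cong refl) (auto simp: F_def)
  finally show ?thesis .
qed

text \<open>Point evaluations are linear extensions, so these functionals separate elements. Laws of
  the algebra thereby reduce to laws of \<open>M\<close> inside nested
  \<open>lin_ext\<close>.\<close>

lemma MA_eqI:
  assumes "f \<in> carrier MA" "g \<in> carrier MA" "\<And>h. lin_ext h f = lin_ext h g"
  shows "f = g"
proof
  fix z show "f z = g z"
    using assms lin_ext_eval[of f z] lin_ext_eval[of g z] by (simp add: MA_supp)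
qed

text \<open>Both orders of summation are provided because linearity is available in the outer
  argument: the first form serves laws about the left factor, the second those about the right
  factor.\<close>

lemma lin_ext_mult': 
  assumes "f \<in> carrier MA" "g \<in> carrier MA"
  shows "lin_ext h (f \<star> g) = lin_ext (\<lambda>x. lin_ext (\<lambda>y. h (x \<otimes> y)) g) f"
    and "lin_ext h (f \<star> g) = lin_ext (\<lambda>y. lin_ext (\<lambda>x. h (x \<otimes> y)) f) g"
proof -
  show "lin_ext h (f \<star> g) = lin_ext (\<lambda>x. lin_ext (\<lambda>y. h (x \<otimes> y)) g) f"
    unfolding lin_ext_mult[OF assms] by (simp add: lin_ext_def sum_distrib_left mult.assoc)
  show "lin_ext h (f \<star> g) = lin_ext (\<lambda>y. lin_ext (\<lambda>x. h (x \<otimes> y)) f) g"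
    unfolding lin_ext_mult[OF assms]
    by (subst sum.swap) (simp add: lin_ext_def sum_distrib_left ac_simps)
qed

lemma lin_ext_star': "f \<in> carrier MA \<Longrightarrow> lin_ext h (star MA f) = cnj (lin_ext (\<lambda>x. cnj (h (invol M x))) f)"
  by (simp add: lin_ext_star) (simp add: lin_ext_def)

lemma lin_ext_cong:
  "\<lbrakk>f = g; g \<in> carrier MA; \<And>x. x \<in> carrier M \<Longrightarrow> h x = k x\<rbrakk> \<Longrightarrow> lin_ext h f = lin_ext k g"
  unfolding lin_ext_def by (intro sum.cong) (auto simp: MA_supp)

lemma lin_ext_add': "\<lbrakk>f \<in> carrier MA; g \<in> carrier MA\<rbrakk> \<Longrightarrow> lin_ext h (f \<oplus>\<^bsub>MA\<^esub> g) = lin_ext h f + lin_ext h g"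
  and lin_ext_smult': "f \<in> carrier MA \<Longrightarrow> lin_ext h (c \<odot>\<^bsub>MA\<^esub> f) = c * lin_ext h f"
  by (simp_all add: MA_simps lin_ext_add lin_ext_smult MA_supp)

lemma lin_ext_fun_mult: "lin_ext (\<lambda>x. c * h x) f = c * lin_ext h f"
  by (simp add: lin_ext_def sum_distrib_left ac_simps)

theorem star_algebra_MA: "star_algebra MA"
proof (rule star_algebraI)
  fix f g k assume fgk: "f \<in> carrier MA" "g \<in> carrier MA" "k \<in> carrier MA"
  note cl = fgk MA_closed
  show "(f \<star> g) \<star> k = f \<star> (g \<star> k)"
  proof (rule MA_eqI)
    fix h
    show "lin_ext h ((f \<star> g) \<star> k) = lin_ext h (f \<star> (g \<star> k))"
      using cl by (simp add: lin_ext_mult'(1) m_assoc cong: lin_ext_cong)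
  qed (use cl in auto)
  show "(f \<oplus>\<^bsub>MA\<^esub> g) \<star> k = f \<star> k \<oplus>\<^bsub>MA\<^esub> g \<star> k"
    by (rule MA_eqI) (use cl in \<open>auto simp: lin_ext_mult'(1) lin_ext_add'\<close>)
  show "k \<star> (f \<oplus>\<^bsub>MA\<^esub> g) = k \<star> f \<oplus>\<^bsub>MA\<^esub> k \<star> g"
    by (rule MA_eqI) (use cl in \<open>auto simp: lin_ext_mult'(2) lin_ext_add'\<close>)
next
  fix f g assume fg: "f \<in> carrier MA" "g \<in> carrier MA"
  note cl = fg MA_closed
  show "star MA (f \<star> g) = star MA g \<star> star MA f"
  proof (rule MA_eqI)
    fix h
    have "lin_ext h (star MA (f \<star> g)) =
        cnj (lin_ext (\<lambda>x. lin_ext (\<lambda>y. cnj (h (invol M (x \<otimes> y)))) g) f)"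
      using cl by (simp add: lin_ext_star' lin_ext_mult'(1))
    also have "\<dots> = cnj (lin_ext (\<lambda>x. lin_ext (\<lambda>y. cnj (h (invol M y \<otimes> invol M x))) g) f)"
      using cl by (simp add: invol_mult cong: lin_ext_cong)
    also have "\<dots> = lin_ext h (star MA g \<star> star MA f)"
      using cl by (simp add: lin_ext_star' lin_ext_mult'(2))
    finally show "lin_ext h (star MA (f \<star> g)) = lin_ext h (star MA g \<star> star MA f)" .
  qed (use cl in auto)
  show "star MA (f \<oplus>\<^bsub>MA\<^esub> g) = star MA f \<oplus>\<^bsub>MA\<^esub> star MA g"
    by (rule MA_eqI) (use cl in \<open>auto simp: lin_ext_star' lin_ext_add'\<close>)
  fix c
  show "c \<odot>\<^bsub>MA\<^esub> f \<star> g = c \<odot>\<^bsub>MA\<^esub> (f \<star> g)"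
    by (rule MA_eqI) (use cl in \<open>auto simp: lin_ext_mult'(1) lin_ext_smult'\<close>)
  show "f \<star> (c \<odot>\<^bsub>MA\<^esub> g) = c \<odot>\<^bsub>MA\<^esub> (f \<star> g)"
    by (rule MA_eqI) (use cl in \<open>auto simp: lin_ext_mult'(2) lin_ext_smult'\<close>)
next
  fix f and c assume f: "f \<in> carrier MA"
  note cl = f MA_closed
  show "star MA (c \<odot>\<^bsub>MA\<^esub> f) = cnj c \<odot>\<^bsub>MA\<^esub> star MA f"
    by (rule MA_eqI) (use cl in \<open>auto simp: lin_ext_star' lin_ext_smult'\<close>)
  show "star MA (star MA f) = f"
    by (rule MA_eqI) (use cl in \<open>auto simp: lin_ext_star' cong: lin_ext_cong\<close>)
  show "\<one>\<^bsub>MA\<^esub> \<star> f = f"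
    by (rule MA_eqI) (use cl in \<open>auto simp: lin_ext_mult'(1) MA_simps(1) cong: lin_ext_cong\<close>)
  show "f \<star> \<one>\<^bsub>MA\<^esub> = f"
    by (rule MA_eqI) (use cl in \<open>auto simp: lin_ext_mult'(1) MA_simps(1) cong: lin_ext_cong\<close>)
qed (use MA_closed in \<open>auto simp: MA_simps algebra_simps\<close>)

lemma MA_induct [consumes 1, case_names zero add]:
  assumes f: "f \<in> carrier MA" and zero: "P \<zero>\<^bsub>MA\<^esub>"
    and add: "\<And>c m f. \<lbrakk>m \<in> carrier M; f \<in> carrier MA; P f\<rbrakk> \<Longrightarrow> P (c \<odot>\<^bsub>MA\<^esub> delta m \<oplus>\<^bsub>MA\<^esub> f)"
  shows "P f"
proof -
  have "finite F \<Longrightarrow> \<forall>f. supp f \<subseteq> F \<longrightarrow> F \<subseteq> carrier M \<longrightarrow> P f" for F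
  proof (induction F rule: finite_induct)
    case empty
    have "f = \<zero>\<^bsub>MA\<^esub>" if "supp f \<subseteq> {}" for f :: "'m \<Rightarrow> complex"
      using that by (auto simp: MA_simps supp_def)
    then show ?case using zero by blast
  next
    case (insert m F)
    show ?case
    proof (intro allI impI)
      fix f assume f: "supp f \<subseteq> insert m F" "insert m F \<subseteq> carrier M"
      define g where "g = f(m := 0)"
      have g: "supp g \<subseteq> F" using f insert.hyps by (auto simp: g_def supp_def)
      then have "P g" "g \<in> carrier MA"
        using insert f by (auto simp: MA_carrier intro: finite_subset)
      moreover have "f = f m \<odot>\<^bsub>MA\<^esub> delta m \<oplus>\<^bsub>MA\<^esub> g"
        by (auto simp: MA_simps g_def delta_def)
      ultimately show "P f" using add[of m g "f m"] f by auto
    qed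
  qed
  then show ?thesis using f by (auto simp: MA_carrier)
qed

lemma delta_mult: "\<lbrakk>m \<in> carrier M; n \<in> carrier M\<rbrakk> \<Longrightarrow> delta m \<star> delta n = delta (m \<otimes> n)"
  by (rule MA_eqI) (auto simp: MA_closed lin_ext_mult'(1))

lemma star_delta: "m \<in> carrier M \<Longrightarrow> star MA (delta m) = delta (invol M m)"
  by (rule MA_eqI) (auto simp: MA_closed lin_ext_star')

lemma lin_ext_star_mult:
  assumes "f \<in> carrier MA" "g \<in> carrier MA"
  shows "lin_ext h (star MA f \<star> g) = (\<Sum>x\<in>supp f. \<Sum>y\<in>supp g. cnj (f x) * g y * h (invol M x \<otimes> y))"
proof -
  have "lin_ext h (star MA f \<star> g) =
      (\<Sum>y\<in>supp g. \<Sum>x\<in>supp f. g y * (cnj (f x) * h (invol M x \<otimes> y)))"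
    using assms by (simp add: lin_ext_mult'(2) MA_closed lin_ext_star)
      (simp add: lin_ext_def sum_distrib_left)
  then show ?thesis by (subst (asm) sum.swap) (simp add: ac_simps)
qed

text \<open>The value at \<open>star MA f \<star> f\<close> is the quadratic form of the kernel with
  the coefficients of \<open>f\<close> as weights.\<close>

lemma positive_functional_lin_ext:
  assumes "psd_kernel (carrier M) (\<lambda>x y. h (invol M x \<otimes> y))"
  shows "positive_functional MA (lin_ext h)"
  unfolding positive_functional_def
  using psd_kernelD[OF assms] by (auto simp: lin_ext_add' lin_ext_smult' lin_ext_star_mult MA_supp subset_iff)

lemma invol_shift:
  "\<lbrakk>m \<in> carrier M; x \<in> carrier M; y \<in> carrier M\<rbrakk> \<Longrightarrow>
    invol M x \<otimes> (invol M m \<otimes> m \<otimes> y) = invol M (m \<otimes> x) \<otimes> (m \<otimes> y)"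
  by (simp add: invol_mult m_assoc)

abbreviation gns where "gns h \<equiv> gns_norm MA (lin_ext h)"

text \<open>Boundedness of left multiplication in the GNS construction only has to be checked for the
  elements of \<open>M\<close>, where it is an inequality between kernels.\<close>

lemma gns_norm_bounded:
  assumes psd: "\<And>h. h \<in> H \<Longrightarrow> psd_kernel (carrier M) (\<lambda>x y. h (invol M x \<otimes> y))"
    and le: "\<And>m. m \<in> carrier M \<Longrightarrow> \<exists>K\<ge>0. \<forall>h\<in>H. psd_kernel (carrier M)
      (\<lambda>x y. of_real K * h (invol M x \<otimes> y) - h (invol M (m \<otimes> x) \<otimes> (m \<otimes> y)))"
    and t: "t \<in> carrier MA"
  shows "\<exists>K. \<forall>h\<in>H. \<forall>y\<in>carrier MA. gns h (t \<star> y) \<le> K * gns h y"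
  using t
proof (induction rule: MA_induct)
  case zero
  interpret star_algebra MA by (rule star_algebra_MA)
  show ?case
    by (intro exI[of _ 0]) (simp add: gns_norm_def a_rules, simp add: MA_simps lin_ext_def supp_def)
next
  case (add c m f)
  interpret star_algebra MA by (rule star_algebra_MA)
  obtain L where L: "\<forall>h\<in>H. \<forall>y\<in>carrier MA. gns h (f \<star> y) \<le> L * gns h y"
    using add.IH by blast
  obtain K where K: "0 \<le> K" "\<And>h. h \<in> H \<Longrightarrow> psd_kernel (carrier M)
      (\<lambda>x y. of_real K * h (invol M x \<otimes> y) - h (invol M (m \<otimes> x) \<otimes> (m \<otimes> y)))"
    using le[OF add.hyps(1)] by blast
  have "gns h ((c \<odot>\<^bsub>MA\<^esub> delta m \<oplus>\<^bsub>MA\<^esub> f) \<star> y) \<le>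
      (cmod c * sqrt K + L) * gns h y"
    if h: "h \<in> H" and y: "y \<in> carrier MA" for h y
  proof -
    interpret star_algebra_functional MA "lin_ext h"
      by (intro star_algebra_functionalI
          star_algebra_MA positive_functional_lin_ext psd h)
    have d: "delta m \<in> carrier MA" using add.hyps by (simp add: MA_closed)
    have dy: "lin_ext h (star MA (delta m \<star> y) \<star> (delta m \<star> y)) =
        (\<Sum>x\<in>supp y. \<Sum>z\<in>supp y. cnj (y x) * y z * h (invol M (m \<otimes> x) \<otimes> (m \<otimes> z)))"
    proof -
      have eq: "star MA (delta m \<star> y) \<star> (delta m \<star> y) =
          star MA y \<star> (delta (invol M m \<otimes> m) \<star> y)"
        using y d add.hyps
        by (simp add: star_mult star_delta a_rules delta_in_MA flip: delta_mult)
      have "lin_ext h (star MA y \<star> (delta (invol M m \<otimes> m) \<star> y)) = (\<Sum>z\<in>supp y. y z *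
          (\<Sum>x\<in>supp y. cnj (y x) * h (invol M x \<otimes> (invol M m \<otimes> m \<otimes> z))))"
        using y add.hyps
        by (simp add: lin_ext_mult'(2) MA_closed lin_ext_star) (simp add: lin_ext_mult'(2) lin_ext_def)
      also have "\<dots> = (\<Sum>z\<in>supp y. y z *
          (\<Sum>x\<in>supp y. cnj (y x) * h (invol M (m \<otimes> x) \<otimes> (m \<otimes> z))))"
          using MA_supp(2)[OF y] add.hyps
        by (intro sum.cong refl arg_cong2[of _ _ _ _ "(*)"] arg_cong[of _ _ h]) (simp add: invol_shift)
      also have "\<dots> = (\<Sum>x\<in>supp y. \<Sum>z\<in>supp y. cnj (y x) * y z * h (invol M (m \<otimes> x) \<otimes> (m \<otimes> z)))"
        unfolding sum_distrib_left by (subst sum.swap) (simp add: ac_simps)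
      finally show ?thesis unfolding eq .
    qed
    \<comment> \<open>The kernel inequality for \<open>m\<close>, evaluated with the coefficients of
      \<open>y\<close>, bounds multiplication by \<open>delta m\<close> with the constant
      \<open>sqrt K\<close>.\<close>
    have "(\<Sum>x\<in>supp y. \<Sum>z\<in>supp y. cnj (y x) * y z *
        (of_real K * h (invol M x \<otimes> z) - h (invol M (m \<otimes> x) \<otimes> (m \<otimes> z)))) \<in> \<real>\<^sub>\<ge>\<^sub>0"
      using psd_kernelD[OF K(2)[OF h], of "supp y" y] y by (auto simp: MA_carrier)
    also have "(\<Sum>x\<in>supp y. \<Sum>z\<in>supp y. cnj (y x) * y z *
        (of_real K * h (invol M x \<otimes> z) - h (invol M (m \<otimes> x) \<otimes> (m \<otimes> z)))) =
        of_real K * lin_ext h (star MA y \<star> y) -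
        lin_ext h (star MA (delta m \<star> y) \<star> (delta m \<star> y))"
      unfolding dy lin_ext_star_mult[OF y y]
      by (simp add: right_diff_distrib sum_subtractf sum_distrib_left ac_simps)
    finally have "(gns h (delta m \<star> y))\<^sup>2 \<le> K * (gns h y)\<^sup>2"
      using y d by (simp add: gns_norm_square complex_nonneg_Reals_iff)
    also have "\<dots> = (sqrt K * gns h y)\<^sup>2"
      using K(1) by (simp add: power_mult_distrib)
    finally have "gns h (delta m \<star> y) \<le> sqrt K * gns h y"
      by (rule power2_le_imp_le) (use K(1) y gns_norm_nonneg in simp)
    then have "cmod c * gns h (delta m \<star> y) \<le> cmod c * (sqrt K * gns h y)"
      by (rule mult_left_mono) simp
    moreover have "gns h ((c \<odot>\<^bsub>MA\<^esub> delta m \<oplus>\<^bsub>MA\<^esub> f) \<star> y) \<le>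
        cmod c * gns h (delta m \<star> y) + gns h (f \<star> y)"
      using gns_norm_triangle[of "c \<odot>\<^bsub>MA\<^esub> (delta m \<star> y)" "f \<star> y"] y d add.hyps
      by (simp add: a_rules smult_mult_left gns_norm_smult)
    moreover have "gns h (f \<star> y) \<le> L * gns h y"
      using L h y by blast
    ultimately show ?thesis by (simp add: distrib_right mult.assoc)
  qed
  then show ?case by blast
qed

lemma functional_family_lin_ext:
  assumes psd: "\<And>h. h \<in> H \<Longrightarrow> psd_kernel (carrier M) (\<lambda>x y. h (invol M x \<otimes> y))"
    and le: "\<And>m. m \<in> carrier M \<Longrightarrow> \<exists>K\<ge>0. \<forall>h\<in>H. psd_kernel (carrier M)
      (\<lambda>x y. of_real K * h (invol M x \<otimes> y) - h (invol M (m \<otimes> x) \<otimes> (m \<otimes> y)))"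
    and unital: "\<exists>h\<in>H. h \<one> = 1"
  shows "functional_family MA (lin_ext ` H)"
proof (intro functional_family.intro functional_family_axioms.intro star_algebra_MA)
  show "positive_functional MA \<omega>" if "\<omega> \<in> lin_ext ` H" for \<omega>
    using that psd positive_functional_lin_ext by auto
  show "\<exists>K. \<forall>\<omega>\<in>lin_ext ` H. \<forall>y\<in>carrier MA. gns_norm MA \<omega> (t \<star> y) \<le> K * gns_norm MA \<omega> y"
    if "t \<in> carrier MA" for t
    using gns_norm_bounded[OF psd le that] by simp
  show "\<exists>\<omega>\<in>lin_ext ` H. \<omega> \<one>\<^bsub>MA\<^esub> = 1"
    using unital by (simp add: MA_simps)
qed

end


section \<open>Universal C*-seminorms\<close>

context cstar_seminormed
begin

text \<open>\<open>p \<one>\<close> is its own square, so it is 0 or 1. The value 0 belongs to the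
  zero seminorm.\<close>

lemma p_one_le: "p \<one> \<le> 1"
proof -
  have "(p \<one>)\<^sup>2 = p \<one>" using p_star_mult[of \<one>] by (simp add: a_rules)
  then show ?thesis by (auto simp: power2_eq_square)
qed

text \<open>By the C*-identity the square of \<open>p u\<close> is
  \<open>p (star A u \<otimes> u)\<close>, which equals \<open>p \<one>\<close> because the two
  elements are at distance 0.\<close>

lemma p_isometry_le: "\<lbrakk>u \<in> carrier A; p (star A u \<otimes> u \<ominus> \<one>) = 0\<rbrakk> \<Longrightarrow> p u \<le> 1"
proof -
  assume u: "u \<in> carrier A" "p (star A u \<otimes> u \<ominus> \<one>) = 0"
  have "(p u)\<^sup>2 \<le> 1"
    using p_diff_le[of "star A u \<otimes> u" \<one>] u p_one_le by (simp add: p_star_mult)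
  then show ?thesis using p_nonneg[OF u(1)] by (simp add: power2_le_iff_abs_le[of 1] power_le_one_iff)
qed

end

context star_algebra
begin

text \<open>\<open>universal_seminorm\<close> is a supremum of real numbers, so a bound on all
  competing seminorms has to come first. The zero seminorm is always among them, hence the set is
  not empty.\<close>

lemma
  assumes bound: "\<And>x. x \<in> carrier A \<Longrightarrow> \<exists>K. \<forall>p. cstar_seminorm A p \<longrightarrow> (\<forall>r\<in>R. p r = 0) \<longrightarrow> p x \<le> K"
  shows universal_seminorm_upper:
      "\<And>p x. \<lbrakk>cstar_seminorm A p; \<And>r. r \<in> R \<Longrightarrow> p r = 0; x \<in> carrier A\<rbrakk> \<Longrightarrow> p x \<le> universal_seminorm A R x"
    and cstar_seminorm_universal: "cstar_seminorm A (universal_seminorm A R)"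
    and universal_seminorm_relator: "\<And>r. r \<in> R \<Longrightarrow> universal_seminorm A R r = 0"
proof -
  let ?u = "universal_seminorm A R"
  define P where "P = {p. cstar_seminorm A p \<and> (\<forall>r\<in>R. p r = 0)}"
  have u_eq: "?u x = Sup ((\<lambda>p. p x) ` P)" for x
    unfolding universal_seminorm_def P_def by (rule arg_cong[of _ _ Sup]) auto
  have P0: "(\<lambda>_. 0) \<in> P" by (simp add: P_def cstar_seminorm_def)
  have upper: "p x \<le> ?u x" if p: "p \<in> P" and x: "x \<in> carrier A" for p x
    unfolding u_eq
  proof (rule cSup_upper)
    obtain K where K: "\<forall>p. cstar_seminorm A p \<longrightarrow> (\<forall>r\<in>R. p r = 0) \<longrightarrow> p x \<le> K" using bound[OF x] by blast
    then show "bdd_above ((\<lambda>p. p x) ` P)" by (intro bdd_aboveI[of _ K]) (auto simp: P_def)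
  qed (use p in auto)
  have least: "?u x \<le> K" if "\<And>p. p \<in> P \<Longrightarrow> p x \<le> K" for x K
    unfolding u_eq by (rule cSup_least) (use P0 that in auto)
  have P: "cstar_seminormed A p" if "p \<in> P" for p
    using that by (intro cstar_seminormedI star_algebra_axioms)
      (simp add: P_def)
  have nonneg: "0 \<le> ?u x" if "x \<in> carrier A" for x using upper[OF P0 that] by simp
  show "p x \<le> ?u x" if "cstar_seminorm A p" "\<And>r. r \<in> R \<Longrightarrow> p r = 0" "x \<in> carrier A" for p x
    using upper that by (simp add: P_def)
  show "?u r = 0" if "r \<in> R" for r
  proof -
    have "(\<lambda>p. p r) ` P = {0}" using P0 that by (auto simp: P_def)
    then show ?thesis by (simp add: u_eq)
  qed
  show "cstar_seminorm A ?u"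
  proof (rule cstar_seminormI[OF nonneg])
    fix x assume x: "x \<in> carrier A"
    have "?u x \<le> sqrt (?u (star A x \<otimes> x))"
    proof (rule least)
      fix p assume p: "p \<in> P"
      show "p x \<le> sqrt (?u (star A x \<otimes> x))"
        using cstar_seminormed.p_star_mult[OF P[OF p] x] upper[OF p, of "star A x \<otimes> x"] x
        by (intro real_le_rsqrt) simp
    qed
    then show "(?u x)\<^sup>2 \<le> ?u (star A x \<otimes> x)"
      using power_mono[of "?u x" "sqrt (?u (star A x \<otimes> x))" 2] nonneg[OF x]
        nonneg[of "star A x \<otimes> x"] x by simp
  next
    fix c x assume x: "x \<in> carrier A"
    show "?u (c \<odot> x) \<le> cmod c * ?u x"
    proof (rule least)
      fix p assume p: "p \<in> P"
      show "p (c \<odot> x) \<le> cmod c * ?u x"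
        using cstar_seminormed.p_smult[OF P[OF p] x] upper[OF p x] by (simp add: mult_left_mono)
    qed
  next
    fix x y assume x: "x \<in> carrier A" and y: "y \<in> carrier A"
    show "?u (x \<oplus> y) \<le> ?u x + ?u y"
    proof (rule least)
      fix p assume p: "p \<in> P"
      show "p (x \<oplus> y) \<le> ?u x + ?u y"
        using cstar_seminormed.p_add[OF P[OF p] x y] upper[OF p x] upper[OF p y] by simp
    qed
    show "?u (x \<otimes> y) \<le> ?u x * ?u y"
    proof (rule least)
      fix p assume p: "p \<in> P"
      have "p x * p y \<le> ?u x * ?u y"
        using upper[OF p x] upper[OF p y] cstar_seminormed.p_nonneg[OF P[OF p] y] nonneg[OF x]
        by (intro mult_mono) auto
      then show "p (x \<otimes> y) \<le> ?u x * ?u y"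
        using cstar_seminormed.p_mult[OF P[OF p] x y] by simp
    qed
  qed
qed

end

context star_monoid
begin

text \<open>Bounds on the basis elements carry over to finite linear combinations; the resulting
  \<open>K\<close> depends on \<open>f\<close> but not on \<open>p\<close>.\<close>

lemma cstar_seminorm_bounded:
  assumes R: "\<And>p m. \<lbrakk>cstar_seminorm MA p; \<And>r. r \<in> R \<Longrightarrow> p r = 0; m \<in> carrier M\<rbrakk> \<Longrightarrow> p (delta m) \<le> 1"
    and f: "f \<in> carrier MA"
  shows "\<exists>K. \<forall>p. cstar_seminorm MA p \<longrightarrow> (\<forall>r\<in>R. p r = 0) \<longrightarrow> p f \<le> K"
  using f
proof (induction rule: MA_induct)
  case zero
  have "p \<zero>\<^bsub>MA\<^esub> \<le> 0" if "cstar_seminorm MA p" for p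
    using cstar_seminormed.p_zero[of MA p] that
    by (simp add: cstar_seminormed_def cstar_seminormed_axioms_def star_algebra_MA)
  then show ?case by blast
next
  case (add c m f)
  then obtain K where K: "\<And>p. \<lbrakk>cstar_seminorm MA p; \<And>r. r \<in> R \<Longrightarrow> p r = 0\<rbrakk> \<Longrightarrow> p f \<le> K" by blast
  have "p (c \<odot>\<^bsub>MA\<^esub> delta m \<oplus>\<^bsub>MA\<^esub> f) \<le> cmod c + K"
    if p: "cstar_seminorm MA p" "\<And>r. r \<in> R \<Longrightarrow> p r = 0" for p
  proof -
    interpret cstar_seminormed MA p
      by (intro cstar_seminormedI star_algebra_MA p)
    have d: "delta m \<in> carrier MA" using add.hyps by (simp add: delta_in_MA)
    have "p (c \<odot>\<^bsub>MA\<^esub> delta m \<oplus>\<^bsub>MA\<^esub> f) \<le> cmod c * p (delta m) + p f"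
      using p_add[of "c \<odot>\<^bsub>MA\<^esub> delta m" f] d add.hyps by (simp add: p_smult)
    moreover have "cmod c * p (delta m) \<le> cmod c * 1"
      using R[OF p add.hyps(1)] by (intro mult_left_mono) auto
    ultimately show ?thesis using K[OF p] by simp
  qed
  then show ?case by blast
qed

end

text \<open>The image of \<open>A\<close> is dense in the completion, and states are continuous by
  \<open>cmod_state_le\<close>.\<close>

lemma (in cstar_seminormed) state_completion_eqI:
  assumes \<phi>: "state Compl \<phi>" and \<psi>: "state Compl \<psi>"
    and eq: "\<And>a. a \<in> carrier A \<Longrightarrow> \<phi> (to_completion A p a) = \<psi> (to_completion A p a)"
    and S: "S \<in> carrier Compl"
  shows "\<phi> S = \<psi> S"
proof -
  interpret C: cstar Compl
    using cstar_algebra_completion by (simp add: cstar_iff)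
  interpret F: star_algebra_functional Compl \<phi> using \<phi> by (rule C.state_functional)
  interpret G: star_algebra_functional Compl \<psi> using \<psi> by (rule C.state_functional)
  obtain X where X: "X \<in> Cauchy_A" "S = cls X" using S by (rule completionE)
  have "cmod (\<phi> S - \<psi> S) \<le> 0 + e" if e: "0 < e" for e
  proof -
    \<comment> \<open>Two states, each with the constant 2, turn e / 4 into e.\<close>
    obtain n where n: "cnorm Compl (S \<ominus>\<^bsub>Compl\<^esub> to_completion A p (X n)) \<le> e / 4"
      using to_completion_approx[OF X(1), of "e / 4"] e X(2) by auto
    have Xn: "X n \<in> carrier A" using cauchyD[OF X(1)] .
    let ?d = "S \<ominus>\<^bsub>Compl\<^esub> to_completion A p (X n)"
    have d: "?d \<in> carrier Compl" using S Xn by simp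
    have "\<phi> S - \<psi> S = \<phi> ?d - \<psi> ?d"
      using S Xn eq[OF Xn] by (simp add: F.minus G.minus)
    then have "cmod (\<phi> S - \<psi> S) \<le> cmod (\<phi> ?d) + cmod (\<psi> ?d)" by (simp add: norm_triangle_ineq4)
    then show ?thesis
      using C.cmod_state_le[OF \<phi> d] C.cmod_state_le[OF \<psi> d] n by simp
  qed
  then have "cmod (\<phi> S - \<psi> S) \<le> 0" by (rule field_le_epsilon)
  then show ?thesis by simp
qed


section \<open>Discrete group duals and minimal tensor products\<close>

text \<open>Elements of \<open>M\<close> act isometrically, so with K = 1 the difference of the two
  kernels is zero. Both the trace of a group and the state of the rotation algebra are of this
  kind.\<close>

lemma (in star_monoid) functional_family_isometric:
  assumes "psd_kernel (carrier M) (\<lambda>x y. h (invol M x \<otimes> y))" "h \<one> = 1"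
    and "\<And>m x y. \<lbrakk>m \<in> carrier M; x \<in> carrier M; y \<in> carrier M\<rbrakk> \<Longrightarrow>
      h (invol M (m \<otimes> x) \<otimes> (m \<otimes> y)) = h (invol M x \<otimes> y)"
  shows "functional_family MA {lin_ext h}"
proof -
  have "psd_kernel (carrier M) (\<lambda>x y. of_real 1 * h (invol M x \<otimes> y) - h (invol M (m \<otimes> x) \<otimes> (m \<otimes> y)))"
    if "m \<in> carrier M" for m
    using psd_kernel_mult_const[OF assms(1), of 0] by (rule psd_kernel_cong) (use that in \<open>simp, subst assms(3), simp_all\<close>)
  then have "\<exists>K\<ge>0. \<forall>h\<in>{h}. psd_kernel (carrier M)
      (\<lambda>x y. of_real K * h (invol M x \<otimes> y) - h (invol M (m \<otimes> x) \<otimes> (m \<otimes> y)))"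
    if "m \<in> carrier M" for m
    using that by (intro exI[of _ 1]) simp
  from functional_family_lin_ext[OF _ this] show ?thesis using assms(1,2) by simp
qed

section \<open>The C*-algebra of a discrete group and its trace\<close>

locale discrete_group = group G for G :: "'g monoid" (structure)
begin

abbreviation "GA \<equiv> monoid_algebra (group_star_monoid G)"
abbreviation "GS \<equiv> universal_seminorm GA {}"
abbreviation "GC \<equiv> group_cstar G"

lemma star_monoid_group: "star_monoid (group_star_monoid G)"
proof -
  have "monoid (group_star_monoid G)"
    by (rule monoidI) (auto simp: group_star_monoid_def m_assoc)
  then show ?thesis
    by (intro star_monoid.intro star_monoid_axioms.intro)
       (auto simp: group_star_monoid_def inv_mult_group)
qed

sublocale M: star_monoid "group_star_monoid G"
  by (rule star_monoid_group)

lemma group_simps: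
  "carrier (group_star_monoid G) = carrier G" "x \<otimes>\<^bsub>group_star_monoid G\<^esub> y = x \<otimes> y"
  "\<one>\<^bsub>group_star_monoid G\<^esub> = \<one>" "invol (group_star_monoid G) x = inv x"
  by (simp_all add: group_star_monoid_def)

lemma group_seminorm_delta_le:
  assumes p: "cstar_seminorm GA p" and g: "g \<in> carrier G"
  shows "p (delta g) \<le> 1"
proof -
  interpret cstar_seminormed GA p
    by (intro cstar_seminormedI M.star_algebra_MA p)
  have "star GA (delta g) \<otimes>\<^bsub>GA\<^esub> delta g = \<one>\<^bsub>GA\<^esub>"
    using g by (simp add: M.star_delta M.delta_mult M.MA_simps(1) group_simps)
  then show ?thesis
    using g by (intro p_isometry_le) (auto simp: M.delta_in_MA group_simps)
qed

lemma
  shows cstar_seminormed_group: "cstar_seminormed GA GS"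
    and group_seminorm_upper: "\<And>p f. \<lbrakk>cstar_seminorm GA p; f \<in> carrier GA\<rbrakk> \<Longrightarrow> p f \<le> GS f"
proof -
  interpret star_algebra GA by (rule M.star_algebra_MA)
  have b: "\<exists>K. \<forall>p. cstar_seminorm GA p \<longrightarrow> (\<forall>r\<in>{}. p r = 0) \<longrightarrow> p f \<le> K" if "f \<in> carrier GA" for f
    by (rule M.cstar_seminorm_bounded[OF _ that]) (auto simp: group_seminorm_delta_le group_simps)
  show "cstar_seminormed GA GS"
    by (intro cstar_seminormedI M.star_algebra_MA
        cstar_seminorm_universal b)
  show "p f \<le> GS f" if "cstar_seminorm GA p" "f \<in> carrier GA" for p f
    using universal_seminorm_upper[OF b that(1) _ that(2)] by simp
qed

lemma group_cstar_eq: "GC = completion GA GS"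
  and group_unitary_eq: "group_unitary G g = to_completion GA GS (delta g)"
  by (simp_all add: group_cstar_def group_unitary_def Let_def)

lemma cstar_group_cstar: "cstar GC"
  using cstar_seminormed.cstar_algebra_completion[OF cstar_seminormed_group]
  by (simp add: group_cstar_eq cstar_iff)

lemma delta_closed: "g \<in> carrier G \<Longrightarrow> delta g \<in> carrier GA"
  using star_monoid.delta_in_MA[OF star_monoid_group] by (simp add: group_simps)

lemma group_unitary_closed: "g \<in> carrier G \<Longrightarrow> group_unitary G g \<in> carrier GC"
  using cstar_seminormed.to_completion_closed[OF cstar_seminormed_group delta_closed]
  by (simp add: group_cstar_eq group_unitary_eq)

lemma group_unitary_mult:
  "\<lbrakk>g \<in> carrier G; h \<in> carrier G\<rbrakk> \<Longrightarrow>
    group_unitary G g \<otimes>\<^bsub>GC\<^esub> group_unitary G h = group_unitary G (g \<otimes> h)"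
  using cstar_seminormed.to_completion_mult[OF cstar_seminormed_group delta_closed delta_closed, of g h]
    star_monoid.delta_mult[OF star_monoid_group, of g h]
  by (simp add: group_cstar_eq group_unitary_eq group_simps)

text \<open>The group elements span a dense subspace, and states are linear and continuous.\<close>

lemma group_state_eqI:
  assumes \<phi>: "state GC \<phi>" and \<psi>: "state GC \<psi>"
    and eq: "\<And>g. g \<in> carrier G \<Longrightarrow> \<phi> (group_unitary G g) = \<psi> (group_unitary G g)"
    and S: "S \<in> carrier GC"
  shows "\<phi> S = \<psi> S"
proof -
  interpret cstar_seminormed GA GS by (rule cstar_seminormed_group)
  interpret C: cstar "GC" by (rule cstar_group_cstar)
  interpret F: star_algebra_functional "GC" \<phi> using \<phi> by (rule C.state_functional)
  interpret G: star_algebra_functional "GC" \<psi> using \<psi> by (rule C.state_functional)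
  have "\<phi> (to_completion GA GS f) = \<psi> (to_completion GA GS f)" if "f \<in> carrier GA" for f
    using that
  proof (induction rule: M.MA_induct)
    case zero
    show ?case using F.zero G.zero by (simp add: to_completion_zero group_cstar_eq)
  next
    case (add c g f)
    note d = M.delta_in_MA[OF add.hyps(1)]
    have "to_completion GA GS (c \<odot>\<^bsub>GA\<^esub> delta g \<oplus>\<^bsub>GA\<^esub> f) =
        c \<odot>\<^bsub>GC\<^esub> group_unitary G g \<oplus>\<^bsub>GC\<^esub> to_completion GA GS f"
      using d add.hyps by (simp add: to_completion_add to_completion_smult group_unitary_eq group_cstar_eq)
    moreover have "to_completion GA GS f \<in> carrier GC"
      using add.hyps by (simp add: group_cstar_eq)
    moreover have "g \<in> carrier G" using add.hyps by (simp add: group_simps)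
    ultimately show ?case
      using add.IH eq[of g] group_unitary_closed[of g]
      by (simp add: F.add G.add F.smult G.smult)
  qed
  with \<phi> \<psi> S show ?thesis
    unfolding group_cstar_eq by (intro state_completion_eqI[of \<phi> \<psi> S]) auto
qed

text \<open>The kernel of \<open>h\<close> on the group is the identity matrix, hence positive
  semidefinite. The functional is dominated by the C*-seminorm that it generates, and this one by
  the universal seminorm, so that it extends.\<close>

lemma ex_group_trace:
  obtains \<tau> where "state GC \<tau>"
    "\<And>g. g \<in> carrier G \<Longrightarrow> \<tau> (group_unitary G g) = of_bool (g = \<one>)"
proof -
  define h :: "'g \<Rightarrow> complex" where "h x = of_bool (x = \<one>)" for x
  have h: "h (inv x \<otimes> y) = of_bool (x = y)" if "x \<in> carrier G" "y \<in> carrier G" for x y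
    using that by (auto simp: h_def) (metis inv_equality inv_inv inv_closed)
  interpret F: functional_family GA "{lin_ext h}"
  proof (rule M.functional_family_isometric)
    show "psd_kernel (carrier (group_star_monoid G))
        (\<lambda>x y. h (invol (group_star_monoid G) x \<otimes>\<^bsub>group_star_monoid G\<^esub> y))"
      by (rule psd_kernel_cong[OF psd_kernel_of_bool_eq]) (simp add: group_simps h)
  qed (auto simp: group_simps h, simp add: h_def)
  interpret cstar_seminormed GA GS by (rule cstar_seminormed_group)
  have "cmod (lin_ext h f) \<le> 1 * GS f" if f: "f \<in> carrier GA" for f
    using F.cmod_le[of "lin_ext h" f] group_seminorm_upper[OF F.cstar_seminorm_functional f] f F.unital
    by simp
  then obtain \<tau> where \<tau>: "state GC \<tau>"
    "\<And>f. f \<in> carrier GA \<Longrightarrow> \<tau> (to_completion GA GS f) = lin_ext h f"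
    using state_extension[of "lin_ext h" 1] F.positive F.unital by (auto simp: group_cstar_eq)
  then show thesis
    using that[of \<tau>] by (simp add: group_unitary_eq delta_closed h_def)
qed

lemma group_cstar_commute:
  assumes comm: "\<And>g h. \<lbrakk>g \<in> carrier G; h \<in> carrier G\<rbrakk> \<Longrightarrow> g \<otimes> h = h \<otimes> g"
    and S: "S \<in> carrier GC" and T: "T \<in> carrier GC"
  shows "S \<otimes>\<^bsub>GC\<^esub> T = T \<otimes>\<^bsub>GC\<^esub> S"
proof -
  interpret cstar_seminormed GA GS by (rule cstar_seminormed_group)
  have "f \<otimes>\<^bsub>GA\<^esub> k = k \<otimes>\<^bsub>GA\<^esub> f" if "f \<in> carrier GA" "k \<in> carrier GA" for f k
  proof (rule M.MA_eqI)
    fix h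
    have "lin_ext h (f \<otimes>\<^bsub>GA\<^esub> k) = lin_ext (\<lambda>x. lin_ext (\<lambda>y. h (x \<otimes> y)) k) f"
      using that by (simp add: M.lin_ext_mult'(1) group_simps)
    also have "\<dots> = lin_ext (\<lambda>x. lin_ext (\<lambda>y. h (y \<otimes> x)) k) f"
      using that comm by (intro M.lin_ext_cong refl) (auto simp: group_simps)
    also have "\<dots> = lin_ext h (k \<otimes>\<^bsub>GA\<^esub> f)"
      using that by (simp add: M.lin_ext_mult'(2) group_simps)
    finally show "lin_ext h (f \<otimes>\<^bsub>GA\<^esub> k) = lin_ext h (k \<otimes>\<^bsub>GA\<^esub> f)" .
  qed (use that in auto)
  then show ?thesis
    using S T unfolding group_cstar_eq by (auto elim!: completionE simp: mult_completion cauchyD)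
qed

end

section \<open>The spatial norm and product states\<close>

locale cstar_pair = A: cstar A + B: cstar B
  for A :: "('a, 'y) cstar_alg_scheme" and B :: "('b, 'z) cstar_alg_scheme" +
  assumes states: "\<exists>\<phi>. state A \<phi>" "\<exists>\<psi>. state B \<psi>"
begin

abbreviation "PT \<equiv> pre_tensor A B"

lemma star_monoid_prod: "star_monoid (prod_star_monoid A B)"
proof -
  have "monoid (prod_star_monoid A B)"
    by (rule monoidI) (auto simp: prod_star_monoid_def A.a_rules B.a_rules)
  then show ?thesis
    by (intro star_monoid.intro star_monoid_axioms.intro)
       (auto simp: prod_star_monoid_def A.star_star B.star_star A.star_mult B.star_mult)
qed

text \<open>The locale assumption \<open>states\<close> makes this set nonempty, so that the spatial
  seminorm is not a supremum over the empty set.\<close>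

definition product_weights :: "('a \<times> 'b \<Rightarrow> complex) set" where
  "product_weights = {\<lambda>(a, b). \<phi> a * \<psi> b | \<phi> \<psi>. state A \<phi> \<and> state B \<psi>}"

lemma tensor_functional_eq: "tensor_functional \<phi> \<psi> = lin_ext (\<lambda>(a, b). \<phi> a * \<psi> b)"
  by (auto simp: tensor_functional_def lin_ext_def fun_eq_iff mult.assoc intro!: sum.cong)

lemma spatial_seminorm_eq:
  "spatial_seminorm A B = functional_seminorm (PT) (lin_ext ` product_weights)"
proof
  fix t
  have "{sqrt (Re (tensor_functional \<phi> \<psi> (star (PT) (t \<otimes>\<^bsub>PT\<^esub> y)
        \<otimes>\<^bsub>PT\<^esub> (t \<otimes>\<^bsub>PT\<^esub> y)))) | \<phi> \<psi> y.
      state A \<phi> \<and> state B \<psi> \<and> y \<in> carrier (PT) \<and>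
      tensor_functional \<phi> \<psi> (star (PT) y \<otimes>\<^bsub>PT\<^esub> y) = 1} =
    {gns_norm (PT) \<omega> (t \<otimes>\<^bsub>PT\<^esub> y) | \<omega> y. \<omega> \<in> lin_ext ` product_weights \<and>
      y \<in> carrier (PT) \<and> \<omega> (star (PT) y \<otimes>\<^bsub>PT\<^esub> y) = 1}"
    unfolding gns_norm_def product_weights_def tensor_functional_eq by blast
  then show "spatial_seminorm A B t = functional_seminorm (PT) (lin_ext ` product_weights) t"
    by (simp add: spatial_seminorm_def functional_seminorm_def Let_def)
qed

text \<open>A product of states has as its kernel the product of two positive semidefinite kernels,
  so Schur's theorem gives positivity. Multiplication by \<open>(a, b)\<close> is bounded with
  \<open>K * L\<close>, the product of the two constants from \<open>ex_norm_defect\<close>.\<close>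

lemma functional_family_tensor:
  "functional_family (PT) (lin_ext ` product_weights)"
proof -
  interpret M: star_monoid "prod_star_monoid A B" by (rule star_monoid_prod)
  let ?M = "prod_star_monoid A B"
  have M: "carrier ?M = carrier A \<times> carrier B" "\<one>\<^bsub>?M\<^esub> = (\<one>\<^bsub>A\<^esub>, \<one>\<^bsub>B\<^esub>)"
    "x \<otimes>\<^bsub>?M\<^esub> y = (fst x \<otimes>\<^bsub>A\<^esub> fst y, snd x \<otimes>\<^bsub>B\<^esub> snd y)"
    "invol ?M x = (star A (fst x), star B (snd x))" for x y
    by (simp_all add: prod_star_monoid_def case_prod_beta)
  have psd_A: "psd_kernel (carrier ?M) (\<lambda>x y. \<phi> (star A (f (fst x)) \<otimes>\<^bsub>A\<^esub> f (fst y)))"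
    if "state A \<phi>" "\<And>x. x \<in> carrier A \<Longrightarrow> f x \<in> carrier A" for \<phi> f
  proof -
    have "(\<lambda>x. f (fst x)) ` carrier ?M \<subseteq> carrier A"
    proof (rule image_subsetI)
      fix x assume "x \<in> carrier ?M"
      then have "fst x \<in> carrier A" by (simp add: M(1) mem_Times_iff)
      then show "f (fst x) \<in> carrier A" by (rule that(2))
    qed
    from psd_kernel_pullback[OF star_algebra_functional.psd_kernel[OF A.state_functional[OF that(1)]] this]
    show ?thesis .
  qed
  have psd_B: "psd_kernel (carrier ?M) (\<lambda>x y. \<psi> (star B (f (snd x)) \<otimes>\<^bsub>B\<^esub> f (snd y)))"
    if "state B \<psi>" "\<And>x. x \<in> carrier B \<Longrightarrow> f x \<in> carrier B" for \<psi> f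
  proof -
    have "(\<lambda>x. f (snd x)) ` carrier ?M \<subseteq> carrier B"
    proof (rule image_subsetI)
      fix x assume "x \<in> carrier ?M"
      then have "snd x \<in> carrier B" by (simp add: M(1) mem_Times_iff)
      then show "f (snd x) \<in> carrier B" by (rule that(2))
    qed
    from psd_kernel_pullback[OF star_algebra_functional.psd_kernel[OF B.state_functional[OF that(1)]] this]
    show ?thesis .
  qed
  show ?thesis
    unfolding pre_tensor_def
  proof (rule M.functional_family_lin_ext)
    fix h assume "h \<in> product_weights"
    then obtain \<phi> \<psi> where h: "h = (\<lambda>(a, b). \<phi> a * \<psi> b)" "state A \<phi>" "state B \<psi>"
      by (auto simp: product_weights_def)
    show "psd_kernel (carrier ?M) (\<lambda>x y. h (invol ?M x \<otimes>\<^bsub>?M\<^esub> y))"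
      using psd_kernel_schur_product[OF psd_A[OF h(2), of id] psd_B[OF h(3), of id]] by (simp add: h(1) M)
  next
    fix m assume "m \<in> carrier ?M"
    then obtain a b where m: "m = (a, b)" "a \<in> carrier A" "b \<in> carrier B" by (auto simp: M)
    define K L where "K = (2 * cnorm A a)\<^sup>2" "L = (2 * cnorm B b)\<^sup>2"
    obtain s where s: "s \<in> carrier A"
      "\<And>\<phi> x y. \<lbrakk>positive_functional A \<phi>; x \<in> carrier A; y \<in> carrier A\<rbrakk> \<Longrightarrow>
        \<phi> (star A (s \<otimes>\<^bsub>A\<^esub> x) \<otimes>\<^bsub>A\<^esub> (s \<otimes>\<^bsub>A\<^esub> y)) =
        of_real K * \<phi> (star A x \<otimes>\<^bsub>A\<^esub> y) - \<phi> (star A (a \<otimes>\<^bsub>A\<^esub> x) \<otimes>\<^bsub>A\<^esub> (a \<otimes>\<^bsub>A\<^esub> y))"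
      unfolding K_L_def by (rule A.ex_norm_defect[OF m(2)]) blast
    obtain t where t: "t \<in> carrier B"
      "\<And>\<psi> x y. \<lbrakk>positive_functional B \<psi>; x \<in> carrier B; y \<in> carrier B\<rbrakk> \<Longrightarrow>
        \<psi> (star B (t \<otimes>\<^bsub>B\<^esub> x) \<otimes>\<^bsub>B\<^esub> (t \<otimes>\<^bsub>B\<^esub> y)) =
        of_real L * \<psi> (star B x \<otimes>\<^bsub>B\<^esub> y) - \<psi> (star B (b \<otimes>\<^bsub>B\<^esub> x) \<otimes>\<^bsub>B\<^esub> (b \<otimes>\<^bsub>B\<^esub> y))"
      unfolding K_L_def by (rule B.ex_norm_defect[OF m(3)]) blast
    have KL: "0 \<le> K" "0 \<le> L" by (simp_all add: K_L_def)
    have "psd_kernel (carrier ?M) (\<lambda>x y. of_real (K * L) * h (invol ?M x \<otimes>\<^bsub>?M\<^esub> y) -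
        h (invol ?M (m \<otimes>\<^bsub>?M\<^esub> x) \<otimes>\<^bsub>?M\<^esub> (m \<otimes>\<^bsub>?M\<^esub> y)))" if hW: "h \<in> product_weights" for h
    proof -
      obtain \<phi> \<psi> where h: "h = (\<lambda>(a, b). \<phi> a * \<psi> b)" "state A \<phi>" "state B \<psi>"
        using hW by (auto simp: product_weights_def)
      note st = s(2)[of \<phi>] t(2)[of \<psi>]
      \<comment> \<open>Write k, l for the kernels of \<open>\<phi>\<close>, \<open>\<psi>\<close>
        and k_a, l_b for these kernels after multiplication by \<open>a\<close>, \<open>b\<close>.
        Then K L k l - k_a l_b = L (K k - k_a) l + k_a (L l - l_b), and \<open>s\<close> and
        \<open>t\<close> exhibit the two differences as kernels.\<close>
      note psd = psd_kernel_add[OF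
          psd_kernel_mult_const[OF psd_kernel_schur_product[OF
            psd_A[OF h(2), of "\<lambda>x. s \<otimes>\<^bsub>A\<^esub> x"] psd_B[OF h(3), of id]] KL(2)]
          psd_kernel_schur_product[OF
            psd_A[OF h(2), of "\<lambda>x. a \<otimes>\<^bsub>A\<^esub> x"] psd_B[OF h(3), of "\<lambda>x. t \<otimes>\<^bsub>B\<^esub> x"]]]
      show ?thesis
        by (rule psd_kernel_cong[OF psd]) (use m s(1) t(1) h(2,3) in \<open>auto simp: h(1) M st state_iff algebra_simps\<close>)
    qed
    then show "\<exists>K\<ge>0. \<forall>h\<in>product_weights. psd_kernel (carrier ?M)
        (\<lambda>x y. of_real K * h (invol ?M x \<otimes>\<^bsub>?M\<^esub> y) - h (invol ?M (m \<otimes>\<^bsub>?M\<^esub> x) \<otimes>\<^bsub>?M\<^esub> (m \<otimes>\<^bsub>?M\<^esub> y)))"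
      using KL by (intro exI[of _ "K * L"]) simp
  next
    show "\<exists>h\<in>product_weights. h \<one>\<^bsub>?M\<^esub> = 1"
      using states by (fastforce simp: M product_weights_def state_iff)
  qed
qed

lemma cstar_seminormed_tensor: "cstar_seminormed (PT) (spatial_seminorm A B)"
proof -
  interpret functional_family "PT" "lin_ext ` product_weights"
    by (rule functional_family_tensor)
  show ?thesis
    by (intro cstar_seminormedI star_algebra_axioms)
      (simp add: spatial_seminorm_eq cstar_seminorm_functional)
qed

lemma star_algebra_min_tensor: "star_algebra (min_tensor A B)"
  unfolding min_tensor_def by (rule cstar_seminormed.star_algebra_completion[OF cstar_seminormed_tensor])

lemma delta_in_pre_tensor:
  "\<lbrakk>a \<in> carrier A; b \<in> carrier B\<rbrakk> \<Longrightarrow> delta (a, b) \<in> carrier (PT)"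
  unfolding pre_tensor_def using star_monoid.delta_in_MA[OF star_monoid_prod]
  by (simp add: prod_star_monoid_def)

lemma elem_tensor_closed:
  "\<lbrakk>a \<in> carrier A; b \<in> carrier B\<rbrakk> \<Longrightarrow> elem_tensor A B a b \<in> carrier (min_tensor A B)"
  unfolding min_tensor_def elem_tensor_def
  by (intro cstar_seminormed.to_completion_closed[OF cstar_seminormed_tensor] delta_in_pre_tensor)

text \<open>The functional is among those over which the spatial seminorm is a supremum, so it is
  bounded by that seminorm with constant 1 and extends to the completion.\<close>

lemma ex_product_state:
  assumes \<phi>: "state A \<phi>" and \<psi>: "state B \<psi>"
  obtains \<rho> where "state (min_tensor A B) \<rho>"
    "\<And>a b. \<lbrakk>a \<in> carrier A; b \<in> carrier B\<rbrakk> \<Longrightarrow> \<rho> (elem_tensor A B a b) = \<phi> a * \<psi> b"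
proof -
  interpret functional_family "PT" "lin_ext ` product_weights"
    by (rule functional_family_tensor)
  interpret S: cstar_seminormed "PT" "spatial_seminorm A B"
    by (rule cstar_seminormed_tensor)
  let ?\<omega> = "lin_ext (\<lambda>(a, b). \<phi> a * \<psi> b)"
  have \<omega>: "?\<omega> \<in> lin_ext ` product_weights" using \<phi> \<psi> by (auto simp: product_weights_def)
  have unit: "?\<omega> \<one>\<^bsub>PT\<^esub> = 1"
    using \<phi> \<psi> by (simp add: pre_tensor_def monoid_algebra_def prod_star_monoid_def state_iff)
  have "cmod (?\<omega> t) \<le> 1 * spatial_seminorm A B t" if "t \<in> carrier (PT)" for t
    using cmod_le[OF \<omega> unit that] by (simp add: spatial_seminorm_eq)
  then obtain \<rho> where \<rho>: "state (min_tensor A B) \<rho>"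
    "\<And>t. t \<in> carrier (PT) \<Longrightarrow>
      \<rho> (to_completion (PT) (spatial_seminorm A B) t) = ?\<omega> t"
    unfolding min_tensor_def using S.state_extension[OF positive[OF \<omega>] unit] by blast
  then show thesis
    using that[of \<rho>] by (simp add: elem_tensor_def delta_in_pre_tensor)
qed

end

lemma state_comp_star_hom:
  assumes f: "f \<in> star_hom A B" and \<rho>: "state B \<rho>" and A: "star_algebra A"
  shows "state A (\<lambda>x. \<rho> (f x))"
proof -
  interpret star_algebra A by (rule A)
  have h: "\<And>x. x \<in> carrier A \<Longrightarrow> f x \<in> carrier B"
    "\<And>x y. \<lbrakk>x \<in> carrier A; y \<in> carrier A\<rbrakk> \<Longrightarrow> f (x \<oplus>\<^bsub>A\<^esub> y) = f x \<oplus>\<^bsub>B\<^esub> f y"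
    "\<And>x y. \<lbrakk>x \<in> carrier A; y \<in> carrier A\<rbrakk> \<Longrightarrow> f (x \<otimes>\<^bsub>A\<^esub> y) = f x \<otimes>\<^bsub>B\<^esub> f y"
    "f \<one>\<^bsub>A\<^esub> = \<one>\<^bsub>B\<^esub>" "\<And>c x. x \<in> carrier A \<Longrightarrow> f (c \<odot>\<^bsub>A\<^esub> x) = c \<odot>\<^bsub>B\<^esub> f x"
    "\<And>x. x \<in> carrier A \<Longrightarrow> f (star A x) = star B (f x)"
    using f by (auto simp: star_hom_def ring_hom_def)
  then show ?thesis using \<rho> unfolding state_def by auto
qed


section \<open>The rotation algebra\<close>

text \<open>Words act on \<open>\<ell>\<^sup>2(\<int>)\<close> with basis \<open>e\<^sub>k\<close> by \<open>B e\<^sub>k = e\<^sub>k\<^sub>+\<^sub>1\<close> and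
  \<open>C e\<^sub>k = exp (- \<i>\<theta>k) e\<^sub>k\<close>. A word \<open>w\<close> maps \<open>e\<^sub>k\<close> to \<open>word_phase \<theta> w k\<close> times the
  basis vector with index \<open>k + word_shift w\<close>.\<close>

type_synonym rot_word = "(rot_gen \<times> bool) list"

fun letter_shift :: "rot_gen \<times> bool \<Rightarrow> int" where
  "letter_shift (GenB, b) = (if b then - 1 else 1)"
| "letter_shift (GenC, b) = 0"

fun letter_phase :: "real \<Rightarrow> rot_gen \<times> bool \<Rightarrow> int \<Rightarrow> complex" where
  "letter_phase \<theta> (GenB, b) k = 1"
| "letter_phase \<theta> (GenC, b) k = cis (if b then \<theta> * of_int k else - (\<theta> * of_int k))"

fun word_shift :: "rot_word \<Rightarrow> int" where
  "word_shift [] = 0"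
| "word_shift (l # w) = letter_shift l + word_shift w"

fun word_phase :: "real \<Rightarrow> rot_word \<Rightarrow> int \<Rightarrow> complex" where
  "word_phase \<theta> [] k = 1"
| "word_phase \<theta> (l # w) k = letter_phase \<theta> l (k + word_shift w) * word_phase \<theta> w k"

definition word_invol :: "('s \<times> bool) list \<Rightarrow> ('s \<times> bool) list" where
  "word_invol w = rev (map (\<lambda>(s, b). (s, \<not> b)) w)"

lemma free_simps:
  "carrier free_star_monoid = UNIV" "x \<otimes>\<^bsub>free_star_monoid\<^esub> y = x @ y"
  "\<one>\<^bsub>free_star_monoid\<^esub> = []" "invol free_star_monoid = word_invol"
  by (simp_all add: free_star_monoid_def word_invol_def fun_eq_iff)

lemma word_invol_simps [simp]:
  "word_invol [] = []" "word_invol (x @ y) = word_invol y @ word_invol x"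
  "word_invol ((s, b) # w) = word_invol w @ [(s, \<not> b)]"
  by (simp_all add: word_invol_def)

lemma word_invol_invol [simp]: "word_invol (word_invol w) = w"
  by (induction w) auto

lemma star_monoid_free: "star_monoid free_star_monoid"
proof -
  have "monoid free_star_monoid"
    by (rule monoidI) (auto simp: free_simps)
  then show ?thesis
    by (intro star_monoid.intro star_monoid_axioms.intro) (auto simp: free_simps)
qed

interpretation free: star_monoid "free_star_monoid :: rot_word star_monoid"
  by (rule star_monoid_free)

lemma word_shift_append [simp]: "word_shift (x @ y) = word_shift x + word_shift y"
  by (induction x) auto

lemma word_phase_append: "word_phase \<theta> (x @ y) k = word_phase \<theta> x (k + word_shift y) * word_phase \<theta> y k"
  by (induction x) (auto simp: add_ac)

lemma letter_shift_invol: "letter_shift (s, \<not> b) = - letter_shift (s, b)"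
  by (cases s) auto

lemma letter_phase_invol:
  "letter_phase \<theta> (s, \<not> b) (k + letter_shift (s, b)) = cnj (letter_phase \<theta> (s, b) k)"
  by (cases s) (auto simp: cis_cnj)

lemma word_shift_invol [simp]: "word_shift (word_invol x) = - word_shift x"
  by (induction x) (auto simp: letter_shift_invol)

lemma word_phase_invol: "word_phase \<theta> (word_invol x) (k + word_shift x) = cnj (word_phase \<theta> x k)"
proof (induction x)
  case (Cons l x)
  obtain s b where l: "l = (s, b)" by (cases l)
  have "k + (letter_shift (s, b) + word_shift x) + letter_shift (s, \<not> b) = k + word_shift x"
    by (simp add: letter_shift_invol)
  then show ?case
    using Cons letter_phase_invol[of \<theta> s b "k + word_shift x"]
    by (simp add: l word_phase_append add_ac mult.commute)
qed simp

lemma cnj_word_phase_mult: "cnj (word_phase \<theta> x k) * word_phase \<theta> x k = 1"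
proof (induction x)
  case (Cons l x)
  have "cnj (letter_phase \<theta> l j) * letter_phase \<theta> l j = 1" for j
    by (cases l rule: letter_shift.cases) (auto simp: cis_cnj cis_mult)
  with Cons show ?case by (simp add: algebra_simps)
qed simp

text \<open>The vector state of \<open>e\<^sub>0\<close> in this representation. In general it is
  not a trace: it is 1 on every power of \<open>C\<close>, but exp (i \<theta>) on
  \<open>B C B*\<close>.\<close>

definition rot_trace :: "real \<Rightarrow> rot_word \<Rightarrow> complex" where
  "rot_trace \<theta> w = of_bool (word_shift w = 0) * word_phase \<theta> w 0"

text \<open>This is the inner product of the vectors that \<open>x\<close> and \<open>y\<close> make
  of \<open>e\<^sub>0\<close>, in the shape of \<open>psd_kernel_index\<close>.\<close>

lemma rot_trace_invol_append:
  "rot_trace \<theta> (word_invol x @ y) =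
    of_bool (word_shift x = word_shift y) * (cnj (word_phase \<theta> x 0) * word_phase \<theta> y 0)"
  using word_phase_invol[of \<theta> x 0] by (auto simp: rot_trace_def word_phase_append)

lemma functional_family_rot: "functional_family free_rot_alg {lin_ext (rot_trace \<theta>)}"
proof (rule free.functional_family_isometric)
  show "psd_kernel (carrier free_star_monoid)
      (\<lambda>x y. rot_trace \<theta> (invol free_star_monoid x \<otimes>\<^bsub>free_star_monoid\<^esub> y))"
    unfolding free_simps rot_trace_invol_append by (rule psd_kernel_index)
  show "rot_trace \<theta> \<one>\<^bsub>free_star_monoid\<^esub> = 1"
    by (simp add: free_simps rot_trace_def)
  fix m x y :: "rot_word"
  have "cnj (word_phase \<theta> m k * u) * (word_phase \<theta> m k * v) = cnj u * v" for k u v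
    using cnj_word_phase_mult[of \<theta> m k] by (simp add: algebra_simps)
  then show "rot_trace \<theta> (invol free_star_monoid (m \<otimes>\<^bsub>free_star_monoid\<^esub> x) \<otimes>\<^bsub>free_star_monoid\<^esub>
      (m \<otimes>\<^bsub>free_star_monoid\<^esub> y)) = rot_trace \<theta> (invol free_star_monoid x \<otimes>\<^bsub>free_star_monoid\<^esub> y)"
    unfolding free_simps rot_trace_invol_append by (auto simp: word_phase_append)
qed

text \<open>Every relator becomes a word minus a scalar multiple of a word, so that one argument
  covers unitarity and commutation alike. The two unitarity relators of a generator correspond to
  the two values of \<open>b\<close>.\<close>

lemma rot_relators_eq:
  "rot_relators \<theta> =
    (\<Union>s. \<Union>b. {delta [(s, b), (s, \<not> b)] \<ominus>\<^bsub>free_rot_alg\<^esub> 1 \<odot>\<^bsub>free_rot_alg\<^esub> delta []}) \<union>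
    {delta [(GenB, False), (GenC, False)] \<ominus>\<^bsub>free_rot_alg\<^esub>
      exp (\<i> * of_real \<theta>) \<odot>\<^bsub>free_rot_alg\<^esub> delta [(GenC, False), (GenB, False)]}"
proof -
  interpret star_algebra free_rot_alg by (rule free.star_algebra_MA)
  have mult: "delta v \<otimes>\<^bsub>free_rot_alg\<^esub> delta w = delta (v @ w)" for v w
    using free.delta_mult[of v w] by (simp add: free_simps)
  have star: "star free_rot_alg (delta w) = delta (word_invol w)" for w
    using free.star_delta[of w] by (simp add: free_simps)
  have one: "\<one>\<^bsub>free_rot_alg\<^esub> = 1 \<odot>\<^bsub>free_rot_alg\<^esub> delta []"
    using free.MA_simps(1) free.one_in_MA by (simp add: free_simps)
  have U: "(UNIV :: rot_gen set) = {GenB, GenC}" using rot_gen.exhaust by auto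
  have s: "(\<Union>s. f s) = f GenB \<union> f GenC" for f :: "rot_gen \<Rightarrow> (rot_word \<Rightarrow> complex) set"
    unfolding U by simp
  show ?thesis
    unfolding rot_relators_def unitary_relators_def free_gen_def Let_def star mult one s UN_bool_eq
    by auto
qed

text \<open>Both sides of a relation act in the same way on every basis vector, hence also inside
  every longer word. So the functional vanishes on all products \<open>z r y\<close>, and the GNS
  norm of \<open>r y\<close> is 0 for all \<open>y\<close>.\<close>

lemma seminorm_rot_relators:
  assumes "r \<in> rot_relators \<theta>"
  shows "functional_seminorm free_rot_alg {lin_ext (rot_trace \<theta>)} r = 0"
proof -
  interpret functional_family free_rot_alg "{lin_ext (rot_trace \<theta>)}"
    by (rule functional_family_rot)
  let ?A = free_rot_alg
  have d: "delta w \<in> carrier ?A" for w using free.delta_in_MA by (simp add: free_simps)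
  have p0: "p (delta u \<ominus>\<^bsub>?A\<^esub> c \<odot>\<^bsub>?A\<^esub> delta v) = 0"
    if shift: "word_shift u = word_shift v"
      and phase: "\<And>k. word_phase \<theta> u k = c * word_phase \<theta> v k" for u v c
  proof -
    let ?r = "delta u \<ominus>\<^bsub>?A\<^esub> c \<odot>\<^bsub>?A\<^esub> delta v"
    have tr: "rot_trace \<theta> (x @ u @ y) = c * rot_trace \<theta> (x @ v @ y)" for x y
      using shift phase by (simp add: rot_trace_def word_phase_append)
    have r: "?r \<in> carrier ?A" using d by simp
    have zero: "lin_ext (rot_trace \<theta>) (z \<otimes>\<^bsub>?A\<^esub> (?r \<otimes>\<^bsub>?A\<^esub> y)) = 0"
      if zy: "z \<in> carrier ?A" "y \<in> carrier ?A" for z y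
    proof -
      interpret F: star_algebra_functional ?A "lin_ext (rot_trace \<theta>)" by (rule functional) simp
      have *: "lin_ext (rot_trace \<theta>) (z \<otimes>\<^bsub>?A\<^esub> (delta w \<otimes>\<^bsub>?A\<^esub> y)) =
          lin_ext (\<lambda>a. lin_ext (\<lambda>b. rot_trace \<theta> (a @ w @ b)) y) z" for w
        using zy d by (simp add: free.lin_ext_mult'(1) free_simps)
      have "z \<otimes>\<^bsub>?A\<^esub> (?r \<otimes>\<^bsub>?A\<^esub> y) =
          z \<otimes>\<^bsub>?A\<^esub> (delta u \<otimes>\<^bsub>?A\<^esub> y) \<ominus>\<^bsub>?A\<^esub> c \<odot>\<^bsub>?A\<^esub> (z \<otimes>\<^bsub>?A\<^esub> (delta v \<otimes>\<^bsub>?A\<^esub> y))"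
        using zy d by (simp add: minus_conv a_rules smult_mult_left smult_mult_right)
      then show ?thesis
        using zy d by (simp add: F.minus F.smult * tr free.lin_ext_fun_mult)
    qed
    have "p ?r \<le> 0"
    proof (rule seminorm_le[OF r])
      fix \<omega> y assume "\<omega> \<in> {lin_ext (rot_trace \<theta>)}" and y: "y \<in> carrier ?A"
      then show "gns_norm ?A \<omega> (?r \<otimes>\<^bsub>?A\<^esub> y) \<le> 0 * gns_norm ?A \<omega> y"
        using zero[of "star ?A (?r \<otimes>\<^bsub>?A\<^esub> y)" y] r by (simp add: gns_norm_def)
    qed
    then show ?thesis using seminorm_nonneg[OF r] by simp
  qed
  have ph1: "word_phase \<theta> [(s, b), (s, \<not> b)] k = 1 * word_phase \<theta> [] k" for s b k
    by (cases s) (auto simp: cis_mult)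
  \<comment> \<open>In \<open>C B\<close> the letter \<open>C\<close> meets the index
    \<open>k + 1\<close> in place of \<open>k\<close> and contributes an extra exp (- i \<theta>),
    which the factor compensates.\<close>
  have ph2: "word_phase \<theta> [(GenB, False), (GenC, False)] k =
      exp (\<i> * of_real \<theta>) * word_phase \<theta> [(GenC, False), (GenB, False)] k" for k
    by (simp add: cis_mult algebra_simps flip: cis_conv_exp)
  show ?thesis
    using assms p0[OF _ ph1] p0[OF _ ph2] unfolding rot_relators_eq
    by (auto simp: letter_shift_invol)
qed

text \<open>Modulo the relators, letters are isometries or adjoints of isometries; words follow by
  submultiplicativity.\<close>

lemma rot_seminorm_delta_le:
  assumes p: "cstar_seminorm free_rot_alg p" "\<And>r. r \<in> rot_relators \<theta> \<Longrightarrow> p r = 0"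
  shows "p (delta w) \<le> 1"
proof -
  interpret cstar_seminormed free_rot_alg p
    by (intro cstar_seminormedI free.star_algebra_MA p)
  let ?A = free_rot_alg
  have d: "delta w \<in> carrier ?A" for w using free.delta_in_MA by (simp add: free_simps)
  have gen: "p (delta [(s, False)]) \<le> 1" for s
  proof (rule p_isometry_le[OF d])
    have "star ?A (free_gen s) \<otimes>\<^bsub>?A\<^esub> free_gen s \<ominus>\<^bsub>?A\<^esub> \<one>\<^bsub>?A\<^esub> \<in> rot_relators \<theta>"
      by (cases s) (auto simp: rot_relators_def unitary_relators_def Let_def)
    then show "p (star ?A (delta [(s, False)]) \<otimes>\<^bsub>?A\<^esub> delta [(s, False)] \<ominus>\<^bsub>?A\<^esub> \<one>\<^bsub>?A\<^esub>) = 0"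
      using p(2) by (simp add: free_gen_def)
  qed
  have letter: "p (delta [l]) \<le> 1" for l
  proof -
    obtain s b where l: "l = (s, b)" by (cases l)
    have "star ?A (delta [(s, False)]) = delta [(s, True)]"
      using free.star_delta[of "[(s, False)]"] by (simp add: free_simps)
    then show ?thesis
      using gen[of s] p_star[OF d[of "[(s, False)]"]] by (cases b) (simp_all add: l)
  qed
  show ?thesis
  proof (induction w)
    case Nil
    show ?case using p_one_le free.MA_simps(1) by (simp add: free_simps)
  next
    case (Cons l w)
    have "delta (l # w) = delta [l] \<otimes>\<^bsub>?A\<^esub> delta w"
      using free.delta_mult[of "[l]" w] by (simp add: free_simps)
    then have "p (delta (l # w)) \<le> p (delta [l]) * p (delta w)"
      using p_mult[OF d d] by simp
    also have "\<dots> \<le> 1 * 1"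
      using letter[of l] Cons p_nonneg[OF d] by (intro mult_mono) auto
    finally show ?case by simp
  qed
qed

abbreviation "rot_seminorm \<theta> \<equiv> universal_seminorm free_rot_alg (rot_relators \<theta>)"

text \<open>For the last claim: the concrete seminorm from \<open>rot_trace\<close> kills the
  relators and is at least 1 at the unit, and the universal one dominates it. This is why the
  rotation algebra is not zero.\<close>

lemma
  shows cstar_seminormed_rot: "cstar_seminormed free_rot_alg (rot_seminorm \<theta>)"
    and rot_seminorm_relator: "r \<in> rot_relators \<theta> \<Longrightarrow> rot_seminorm \<theta> r = 0"
    and rot_seminorm_one: "rot_seminorm \<theta> \<one>\<^bsub>free_rot_alg\<^esub> \<noteq> 0"
proof -
  interpret functional_family free_rot_alg "{lin_ext (rot_trace \<theta>)}"
    by (rule functional_family_rot)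
  have b: "\<exists>K. \<forall>p. cstar_seminorm free_rot_alg p \<longrightarrow> (\<forall>r\<in>rot_relators \<theta>. p r = 0) \<longrightarrow> p f \<le> K"
    if "f \<in> carrier free_rot_alg" for f
    by (rule free.cstar_seminorm_bounded[OF _ that]) (rule rot_seminorm_delta_le)
  show "cstar_seminormed free_rot_alg (rot_seminorm \<theta>)"
    by (intro cstar_seminormedI free.star_algebra_MA
        cstar_seminorm_universal b)
  show "rot_seminorm \<theta> r = 0" if "r \<in> rot_relators \<theta>"
    by (rule universal_seminorm_relator[OF b that])
  have one: "\<one>\<^bsub>free_rot_alg\<^esub> \<in> carrier free_rot_alg" by (rule free.one_in_MA)
  have "1 \<le> p \<one>\<^bsub>free_rot_alg\<^esub>"
    using cmod_le[of "lin_ext (rot_trace \<theta>)" "\<one>\<^bsub>free_rot_alg\<^esub>"] unital one by simp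
  also have "\<dots> \<le> rot_seminorm \<theta> \<one>\<^bsub>free_rot_alg\<^esub>"
    by (rule universal_seminorm_upper[OF b cstar_seminorm_functional seminorm_rot_relators one])
  finally show "rot_seminorm \<theta> \<one>\<^bsub>free_rot_alg\<^esub> \<noteq> 0" by simp
qed

lemma star_algebra_rotation: "star_algebra (rotation_alg \<theta>)"
  unfolding rotation_alg_def by (rule cstar_seminormed.star_algebra_completion[OF cstar_seminormed_rot])

lemma rotation_one_neq_zero: "\<one>\<^bsub>rotation_alg \<theta>\<^esub> \<noteq> \<zero>\<^bsub>rotation_alg \<theta>\<^esub>"
proof -
  interpret cstar_seminormed free_rot_alg "rot_seminorm \<theta>" by (rule cstar_seminormed_rot)
  have "cnorm (rotation_alg \<theta>) \<one>\<^bsub>rotation_alg \<theta>\<^esub> = rot_seminorm \<theta> \<one>\<^bsub>free_rot_alg\<^esub>"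
    using cnorm_to_completion[of "\<one>\<^bsub>free_rot_alg\<^esub>"] by (simp add: rotation_alg_def to_completion_one)
  moreover have "cnorm (rotation_alg \<theta>) \<zero>\<^bsub>rotation_alg \<theta>\<^esub> = 0"
    using cnorm_to_completion[of "\<zero>\<^bsub>free_rot_alg\<^esub>"] by (simp add: rotation_alg_def to_completion_zero)
  ultimately show ?thesis using rot_seminorm_one by metis
qed

lemma
  shows rot_unitary_closed: "rot_unitary \<theta> s \<in> carrier (rotation_alg \<theta>)"
    and rot_unitary_star_mult:
      "star (rotation_alg \<theta>) (rot_unitary \<theta> s) \<otimes>\<^bsub>rotation_alg \<theta>\<^esub> rot_unitary \<theta> s = \<one>\<^bsub>rotation_alg \<theta>\<^esub>"
    and rot_unitary_mult_star:
      "rot_unitary \<theta> s \<otimes>\<^bsub>rotation_alg \<theta>\<^esub> star (rotation_alg \<theta>) (rot_unitary \<theta> s) = \<one>\<^bsub>rotation_alg \<theta>\<^esub>"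
    and rot_unitary_commutation:
      "rot_unitary \<theta> GenB \<otimes>\<^bsub>rotation_alg \<theta>\<^esub> rot_unitary \<theta> GenC =
        exp (\<i> * of_real \<theta>) \<odot>\<^bsub>rotation_alg \<theta>\<^esub> (rot_unitary \<theta> GenC \<otimes>\<^bsub>rotation_alg \<theta>\<^esub> rot_unitary \<theta> GenB)"
proof -
  interpret cstar_seminormed free_rot_alg "rot_seminorm \<theta>" by (rule cstar_seminormed_rot)
  let ?A = free_rot_alg and ?t = "to_completion free_rot_alg (rot_seminorm \<theta>)"
  interpret R: star_algebra "rotation_alg \<theta>" by (rule star_algebra_rotation)
  have g: "free_gen s \<in> carrier ?A" for s
    using free.delta_in_MA by (simp add: free_gen_def free_simps)
  have R: "completion ?A (rot_seminorm \<theta>) = rotation_alg \<theta>" by (simp add: rotation_alg_def)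
  have eqI: "?t x = ?t y" if "x \<ominus>\<^bsub>?A\<^esub> y \<in> rot_relators \<theta>" "x \<in> carrier ?A" "y \<in> carrier ?A" for x y
  proof -
    have "?t (x \<ominus>\<^bsub>?A\<^esub> y) = \<zero>\<^bsub>rotation_alg \<theta>\<^esub>"
      using to_completion_eq_zero[of "x \<ominus>\<^bsub>?A\<^esub> y"] rot_seminorm_relator[OF that(1)] that R by simp
    then show ?thesis
      using that R.minus_eq_zero_iff[of "?t x" "?t y"] to_completion_closed R
      by (simp add: to_completion_minus)
  qed
  show "rot_unitary \<theta> s \<in> carrier (rotation_alg \<theta>)"
    using to_completion_closed[OF g] R by (simp add: rot_unitary_def)
  have "?t (star ?A (free_gen s) \<otimes>\<^bsub>?A\<^esub> free_gen s) = ?t \<one>\<^bsub>?A\<^esub>"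
    by (rule eqI) (use g in \<open>cases s; auto simp: rot_relators_def unitary_relators_def Let_def\<close>)+
  then show "star (rotation_alg \<theta>) (rot_unitary \<theta> s) \<otimes>\<^bsub>rotation_alg \<theta>\<^esub> rot_unitary \<theta> s = \<one>\<^bsub>rotation_alg \<theta>\<^esub>"
    using g by (simp add: to_completion_mult to_completion_star to_completion_one R rot_unitary_def)
  have "?t (free_gen s \<otimes>\<^bsub>?A\<^esub> star ?A (free_gen s)) = ?t \<one>\<^bsub>?A\<^esub>"
    by (rule eqI) (use g in \<open>cases s; auto simp: rot_relators_def unitary_relators_def Let_def\<close>)+
  then show "rot_unitary \<theta> s \<otimes>\<^bsub>rotation_alg \<theta>\<^esub> star (rotation_alg \<theta>) (rot_unitary \<theta> s) = \<one>\<^bsub>rotation_alg \<theta>\<^esub>"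
    using g by (simp add: to_completion_mult to_completion_star to_completion_one R rot_unitary_def)
  have "?t (free_gen GenB \<otimes>\<^bsub>?A\<^esub> free_gen GenC) =
      ?t (exp (\<i> * of_real \<theta>) \<odot>\<^bsub>?A\<^esub> (free_gen GenC \<otimes>\<^bsub>?A\<^esub> free_gen GenB))"
    by (rule eqI) (use g in \<open>auto simp: rot_relators_def Let_def\<close>)
  then show "rot_unitary \<theta> GenB \<otimes>\<^bsub>rotation_alg \<theta>\<^esub> rot_unitary \<theta> GenC =
        exp (\<i> * of_real \<theta>) \<odot>\<^bsub>rotation_alg \<theta>\<^esub> (rot_unitary \<theta> GenC \<otimes>\<^bsub>rotation_alg \<theta>\<^esub> rot_unitary \<theta> GenB)"
    using g by (simp add: to_completion_mult to_completion_smult R rot_unitary_def)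
qed


section \<open>The quantum double torus\<close>

lemma qdt_simps:
  "carrier (qdt_alg \<theta>) = carrier torus_alg \<times> carrier (rotation_alg \<theta>)"
  "(a, b) \<otimes>\<^bsub>qdt_alg \<theta>\<^esub> (a', b') = (a \<otimes>\<^bsub>torus_alg\<^esub> a', b \<otimes>\<^bsub>rotation_alg \<theta>\<^esub> b')"
  "(a, b) \<oplus>\<^bsub>qdt_alg \<theta>\<^esub> (a', b') = (a \<oplus>\<^bsub>torus_alg\<^esub> a', b \<oplus>\<^bsub>rotation_alg \<theta>\<^esub> b')"
  "c \<odot>\<^bsub>qdt_alg \<theta>\<^esub> (a, b) = (c \<odot>\<^bsub>torus_alg\<^esub> a, c \<odot>\<^bsub>rotation_alg \<theta>\<^esub> b)"
  "star (qdt_alg \<theta>) (a, b) = (star torus_alg a, star (rotation_alg \<theta>) b)"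
  "\<one>\<^bsub>qdt_alg \<theta>\<^esub> = (\<one>\<^bsub>torus_alg\<^esub>, \<one>\<^bsub>rotation_alg \<theta>\<^esub>)"
  "\<zero>\<^bsub>qdt_alg \<theta>\<^esub> = (\<zero>\<^bsub>torus_alg\<^esub>, \<zero>\<^bsub>rotation_alg \<theta>\<^esub>)"
  by (simp_all add: qdt_alg_def direct_sum_def)

lemma torus_simps:
  "f \<otimes>\<^bsub>torus_alg\<^esub> g = (\<lambda>z. f z * g z)" "f \<oplus>\<^bsub>torus_alg\<^esub> g = (\<lambda>z. f z + g z)"
  "c \<odot>\<^bsub>torus_alg\<^esub> f = (\<lambda>z. c * f z)" "star torus_alg f = (\<lambda>z. cnj (f z))"
  "\<one>\<^bsub>torus_alg\<^esub> = indicator torus2" "\<zero>\<^bsub>torus_alg\<^esub> = (\<lambda>_. 0)"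
  by (simp_all add: torus_alg_def)

lemma torus_closed:
  "torus_fst \<in> carrier torus_alg" "\<zero>\<^bsub>torus_alg\<^esub> \<in> carrier torus_alg"
proof -
  have "continuous_on torus2 torus_fst"
    by (rule continuous_on_eq[of _ fst]) (auto intro!: continuous_intros simp: torus_fst_def)
  then show "torus_fst \<in> carrier torus_alg" "\<zero>\<^bsub>torus_alg\<^esub> \<in> carrier torus_alg"
    by (auto simp: torus_alg_def torus_fst_def)
qed

lemma qdt_closed:
  "qdt_A \<theta> \<in> carrier (qdt_alg \<theta>)" "qdt_B \<theta> \<in> carrier (qdt_alg \<theta>)"
  "qdt_C \<theta> \<in> carrier (qdt_alg \<theta>)"
proof -
  interpret R: star_algebra "rotation_alg \<theta>" by (rule star_algebra_rotation)
  show "qdt_A \<theta> \<in> carrier (qdt_alg \<theta>)" "qdt_B \<theta> \<in> carrier (qdt_alg \<theta>)"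
    "qdt_C \<theta> \<in> carrier (qdt_alg \<theta>)"
    by (auto simp: qdt_A_def qdt_B_def qdt_C_def qdt_simps torus_closed rot_unitary_closed)
qed

text \<open>Evaluation at a point of the torus. It makes \<open>cstar_pair\<close> applicable to two
  copies of the algebra.\<close>

lemma ex_state_qdt: "\<exists>\<phi>. state (qdt_alg \<theta>) \<phi>"
proof -
  have "state (qdt_alg \<theta>) (\<lambda>(f, x). f (1, 1))"
    by (auto simp: state_def qdt_simps torus_simps complex_nonneg_Reals_iff)
  then show ?thesis by blast
qed

text \<open>The central projection onto the second summand. Its image under \<open>\<Phi>\<close>
  controls the images of all commutators.\<close>

definition qdt_rot_unit :: "real \<Rightarrow> qdt" where
  "qdt_rot_unit \<theta> = (\<zero>\<^bsub>torus_alg\<^esub>, \<one>\<^bsub>rotation_alg \<theta>\<^esub>)"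

lemma qdt_rot_unit_closed: "qdt_rot_unit \<theta> \<in> carrier (qdt_alg \<theta>)"
proof -
  interpret R: star_algebra "rotation_alg \<theta>" by (rule star_algebra_rotation)
  show ?thesis by (auto simp: qdt_rot_unit_def qdt_simps torus_closed)
qed

lemma qdt_commutation:
  "qdt_B \<theta> \<otimes>\<^bsub>qdt_alg \<theta>\<^esub> qdt_C \<theta> = exp (\<i> * of_real \<theta>) \<odot>\<^bsub>qdt_alg \<theta>\<^esub> (qdt_C \<theta> \<otimes>\<^bsub>qdt_alg \<theta>\<^esub> qdt_B \<theta>)"
  by (simp add: qdt_B_def qdt_C_def qdt_simps torus_simps rot_unitary_commutation)

text \<open>\<open>B\<close> and \<open>C\<close> are unitary in the second summand. The product is
  arranged as \<open>y \<otimes> (x \<otimes> z)\<close> with \<open>C B\<close> for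
  \<open>x\<close>, the form of \<open>state_null_mult\<close>: an ideal that contains the image of
  \<open>C B\<close> contains the image of the projection.\<close>

lemma qdt_rot_unit_eq:
  "qdt_rot_unit \<theta> = star (qdt_alg \<theta>) (qdt_C \<theta>) \<otimes>\<^bsub>qdt_alg \<theta>\<^esub>
    ((qdt_C \<theta> \<otimes>\<^bsub>qdt_alg \<theta>\<^esub> qdt_B \<theta>) \<otimes>\<^bsub>qdt_alg \<theta>\<^esub> star (qdt_alg \<theta>) (qdt_B \<theta>))"
proof -
  interpret R: star_algebra "rotation_alg \<theta>" by (rule star_algebra_rotation)
  let ?R = "rotation_alg \<theta>" and ?B = "rot_unitary \<theta> GenB" and ?C = "rot_unitary \<theta> GenC"
  have "star ?R ?C \<otimes>\<^bsub>?R\<^esub> ((?C \<otimes>\<^bsub>?R\<^esub> ?B) \<otimes>\<^bsub>?R\<^esub> star ?R ?B) =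
      (star ?R ?C \<otimes>\<^bsub>?R\<^esub> ?C) \<otimes>\<^bsub>?R\<^esub> (?B \<otimes>\<^bsub>?R\<^esub> star ?R ?B)"
    by (simp add: R.a_rules rot_unitary_closed)
  then show ?thesis
    by (simp add: qdt_rot_unit_def qdt_B_def qdt_C_def qdt_simps torus_simps rot_unitary_star_mult
        rot_unitary_mult_star R.a_rules)
qed

text \<open>Commutators live in the second summand because the first one is commutative.\<close>

lemma qdt_commutator:
  assumes Q: "star_algebra (qdt_alg \<theta>)" and x: "x \<in> carrier (qdt_alg \<theta>)" and y: "y \<in> carrier (qdt_alg \<theta>)"
  shows "x \<otimes>\<^bsub>qdt_alg \<theta>\<^esub> y \<ominus>\<^bsub>qdt_alg \<theta>\<^esub> y \<otimes>\<^bsub>qdt_alg \<theta>\<^esub> x =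
    qdt_rot_unit \<theta> \<otimes>\<^bsub>qdt_alg \<theta>\<^esub> (x \<otimes>\<^bsub>qdt_alg \<theta>\<^esub> y \<ominus>\<^bsub>qdt_alg \<theta>\<^esub> y \<otimes>\<^bsub>qdt_alg \<theta>\<^esub> x)"
proof -
  interpret Q: star_algebra "qdt_alg \<theta>" by (rule Q)
  interpret R: star_algebra "rotation_alg \<theta>" by (rule star_algebra_rotation)
  obtain f r g s where "x = (f, r)" "y = (g, s)" "r \<in> carrier (rotation_alg \<theta>)" "s \<in> carrier (rotation_alg \<theta>)"
    using x y by (auto simp: qdt_simps)
  moreover have "x \<otimes>\<^bsub>qdt_alg \<theta>\<^esub> y \<ominus>\<^bsub>qdt_alg \<theta>\<^esub> y \<otimes>\<^bsub>qdt_alg \<theta>\<^esub> x =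
      x \<otimes>\<^bsub>qdt_alg \<theta>\<^esub> y \<oplus>\<^bsub>qdt_alg \<theta>\<^esub> (- 1) \<odot>\<^bsub>qdt_alg \<theta>\<^esub> (y \<otimes>\<^bsub>qdt_alg \<theta>\<^esub> x)"
    using x y by (simp add: Q.minus_conv)
  ultimately show ?thesis
    by (simp add: qdt_rot_unit_def qdt_simps torus_simps R.a_rules mult.commute)
qed

lemma (in star_algebra) phase_commutation_eq_zero:
  assumes "x \<in> carrier A" "y \<in> carrier A" "x \<otimes> y = c \<odot> (y \<otimes> x)" "x \<otimes> y = y \<otimes> x" "c \<noteq> 1"
  shows "y \<otimes> x = \<zero>"
proof -
  have "(c - 1) \<odot> (y \<otimes> x) = c \<odot> (y \<otimes> x) \<ominus> y \<otimes> x"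
    using add_smult[of "y \<otimes> x" c "- 1"] assms(1,2) by (simp add: minus_conv)
  also have "\<dots> = \<zero>" using assms by simp
  finally have "(inverse (c - 1) * (c - 1)) \<odot> (y \<otimes> x) = \<zero>"
    using assms(1,2) by (simp flip: smult_smult)
  then show ?thesis using assms by simp
qed

text \<open>If \<open>B\<close> and \<open>C\<close> commuted, the relation with a phase different
  from 1 would force \<open>C B\<close> to be zero. The projection \<open>qdt_rot_unit\<close> would
  then vanish, against \<open>rotation_one_neq_zero\<close>.\<close>

lemma qdt_not_commutative:
  assumes Q: "star_algebra (qdt_alg \<theta>)" and \<theta>: "exp (\<i> * of_real \<theta>) \<noteq> 1"
  shows "qdt_B \<theta> \<otimes>\<^bsub>qdt_alg \<theta>\<^esub> qdt_C \<theta> \<noteq> qdt_C \<theta> \<otimes>\<^bsub>qdt_alg \<theta>\<^esub> qdt_B \<theta>"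
proof
  interpret star_algebra "qdt_alg \<theta>" by (rule Q)
  assume "qdt_B \<theta> \<otimes>\<^bsub>qdt_alg \<theta>\<^esub> qdt_C \<theta> = qdt_C \<theta> \<otimes>\<^bsub>qdt_alg \<theta>\<^esub> qdt_B \<theta>"
  then have "qdt_C \<theta> \<otimes>\<^bsub>qdt_alg \<theta>\<^esub> qdt_B \<theta> = \<zero>\<^bsub>qdt_alg \<theta>\<^esub>"
    using phase_commutation_eq_zero[OF qdt_closed(2,3) qdt_commutation] \<theta> by blast
  then have "qdt_rot_unit \<theta> = \<zero>\<^bsub>qdt_alg \<theta>\<^esub>"
    using qdt_closed by (simp add: qdt_rot_unit_eq a_rules)
  then show False
    using rotation_one_neq_zero by (simp add: qdt_rot_unit_def qdt_simps)
qed

text \<open>The two product states composed with the comultiplication are states of the group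
  C*-algebra, and both send \<open>group_unitary G g\<close> to the product of the values of
  \<open>\<phi>\<close> and \<open>\<psi>\<close> there. Hence they agree at
  \<open>x\<close>.\<close>

lemma (in discrete_group) dual_cocommutative:
  assumes H: "is_group_dual G H" and \<phi>: "state GC \<phi>" and \<psi>: "state GC \<psi>"
    and x: "x \<in> carrier GC"
    and abcd: "a \<in> carrier GC" "b \<in> carrier GC"
      "c \<in> carrier GC" "d \<in> carrier GC"
    and eq: "comult H x = elem_tensor GC GC a b
      \<oplus>\<^bsub>min_tensor GC GC\<^esub> elem_tensor GC GC c d"
  shows "\<phi> a * \<psi> b + \<phi> c * \<psi> d = \<psi> a * \<phi> b + \<psi> c * \<phi> d"
proof -
  interpret C: cstar GC by (rule cstar_group_cstar)
  interpret P: cstar_pair GC GC by unfold_locales (use \<phi> in auto)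
  have hom: "comult H \<in> star_hom GC (min_tensor GC GC)"
    and gu: "\<And>g. g \<in> carrier G \<Longrightarrow> comult H (group_unitary G g) = elem_tensor GC GC (group_unitary G g) (group_unitary G g)"
    using H by (auto simp: is_group_dual_def)
  obtain \<rho> where \<rho>: "state (min_tensor GC GC) \<rho>"
    "\<And>a b. \<lbrakk>a \<in> carrier GC; b \<in> carrier GC\<rbrakk> \<Longrightarrow> \<rho> (elem_tensor GC GC a b) = \<phi> a * \<psi> b"
    by (rule P.ex_product_state[OF \<phi> \<psi>]) blast
  obtain \<sigma> where \<sigma>: "state (min_tensor GC GC) \<sigma>"
    "\<And>a b. \<lbrakk>a \<in> carrier GC; b \<in> carrier GC\<rbrakk> \<Longrightarrow> \<sigma> (elem_tensor GC GC a b) = \<psi> a * \<phi> b"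
    by (rule P.ex_product_state[OF \<psi> \<phi>]) blast
  interpret T: star_algebra "min_tensor GC GC" by (rule P.star_algebra_min_tensor)
  interpret R: star_algebra_functional "min_tensor GC GC" \<rho> using \<rho>(1) by (rule T.state_functional)
  interpret S: star_algebra_functional "min_tensor GC GC" \<sigma> using \<sigma>(1) by (rule T.state_functional)
  have "\<rho> (comult H x) = \<sigma> (comult H x)"
    by (rule group_state_eqI[OF state_comp_star_hom[OF hom \<rho>(1) C.star_algebra_axioms]
          state_comp_star_hom[OF hom \<sigma>(1) C.star_algebra_axioms] _ x])
       (simp add: gu group_unitary_closed \<rho>(2) \<sigma>(2))
  then show ?thesis
    using abcd by (simp add: eq R.add S.add P.elem_tensor_closed \<rho>(2) \<sigma>(2))
qed

text \<open>Multiplication by the unitary of the inverse of \<open>h \<otimes> g\<close> moves the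
  commutator to a difference of two group unitaries, the second of which belongs to the neutral
  element. The trace is 0 on the difference, so the first belongs to the neutral element
  too.\<close>

lemma (in discrete_group) commute_of_state_null:
  assumes g: "g \<in> carrier G" and h: "h \<in> carrier G"
    and null: "group_unitary G g \<otimes>\<^bsub>GC\<^esub> group_unitary G h \<ominus>\<^bsub>GC\<^esub>
      group_unitary G h \<otimes>\<^bsub>GC\<^esub> group_unitary G g \<in> state_null GC"
  shows "g \<otimes> h = h \<otimes> g"
proof -
  let ?u = "group_unitary G" and ?k = "inv (h \<otimes> g)"
  let ?x = "?k \<otimes> (g \<otimes> h)" and ?y = "?k \<otimes> (h \<otimes> g)"
  interpret C: cstar GC by (rule cstar_group_cstar)
  obtain \<tau> where \<tau>: "state GC \<tau>"
    "\<And>g. g \<in> carrier G \<Longrightarrow> \<tau> (?u g) = of_bool (g = \<one>)"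
    by (rule ex_group_trace) blast
  interpret T: star_algebra_functional GC \<tau> using \<tau>(1) by (rule C.state_functional)
  have k: "?k \<in> carrier G" using g h by simp
  have "?u (g \<otimes> h) \<ominus>\<^bsub>GC\<^esub> ?u (h \<otimes> g) \<in> state_null GC"
    using null g h by (simp add: group_unitary_mult)
  from C.state_null_mult[OF this group_unitary_closed[OF k], of "\<one>\<^bsub>GC\<^esub>"]
  have "?u ?k \<otimes>\<^bsub>GC\<^esub> (?u (g \<otimes> h) \<ominus>\<^bsub>GC\<^esub> ?u (h \<otimes> g)) \<in> state_null GC"
    using g h by (simp add: group_unitary_closed)
  moreover have "?u ?k \<otimes>\<^bsub>GC\<^esub> (?u (g \<otimes> h) \<ominus>\<^bsub>GC\<^esub> ?u (h \<otimes> g)) =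
      ?u ?x \<ominus>\<^bsub>GC\<^esub> ?u ?y"
    using g h k by (simp add: C.minus_conv C.a_rules(23) C.smult_mult_right group_unitary_closed
        group_unitary_mult)
  ultimately have "?u ?x \<ominus>\<^bsub>GC\<^esub> ?u ?y \<in> state_null GC"
    by (simp only:)
  then have "\<tau> (?u ?x \<ominus>\<^bsub>GC\<^esub> ?u ?y) = 0"
    using \<tau>(1) unfolding state_null_def by blast
  moreover have "\<tau> (?u ?x \<ominus>\<^bsub>GC\<^esub> ?u ?y) =
      \<tau> (?u ?x) - \<tau> (?u ?y)"
    using g h k by (intro T.minus group_unitary_closed) auto
  ultimately have "\<tau> (?u ?x) = \<tau> (?u ?y)" by simp
  then have "?x = \<one>"
    using g h k by (simp add: \<tau>(2) split: if_splits)
  then show ?thesis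
    using g h inv_solve_left'[of "\<one>" "h \<otimes> g" "g \<otimes> h"] by simp
qed

text \<open>If some state \<open>\<psi>\<close> has \<open>\<psi> b \<noteq> 0\<close>, the
  hypothesis says that \<open>c\<close> differs from \<open>k \<odot> b\<close> by an element killed
  by all states, and \<open>b\<close> commutes with \<open>k \<odot> b\<close>. Otherwise
  \<open>b\<close> itself lies in the ideal.\<close>

lemma (in star_algebra) state_null_commutator:
  assumes b: "b \<in> carrier A" and c: "c \<in> carrier A"
    and sym: "\<And>\<phi> \<psi>. \<lbrakk>state A \<phi>; state A \<psi>\<rbrakk> \<Longrightarrow> \<phi> c * \<psi> b = \<psi> c * \<phi> b"
  shows "b \<otimes> c \<ominus> c \<otimes> b \<in> state_null A"
proof (cases "b \<in> state_null A")
  case True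
  have "\<one> \<otimes> (b \<otimes> c) \<in> state_null A" "c \<otimes> (b \<otimes> \<one>) \<in> state_null A"
    using state_null_mult[OF True] c by blast+
  then show ?thesis using b c state_null_minus by (simp add: a_rules(12) ring.ring_simprules(13))
next
  case False
  then obtain \<psi> where \<psi>: "state A \<psi>" "\<psi> b \<noteq> 0" using b by (auto simp: state_null_def)
  define k where "k = \<psi> c / \<psi> b"
  define n where "n = c \<ominus> k \<odot> b"
  have n: "n \<in> state_null A"
  proof -
    have "\<phi> n = 0" if \<phi>: "state A \<phi>" for \<phi>
    proof -
      interpret star_algebra_functional A \<phi> using \<phi> by (rule state_functional)
      show ?thesis
        using sym[OF \<phi> \<psi>(1)] b c \<psi>(2) by (simp add: n_def k_def minus smult field_simps)
    qed
    then show ?thesis using b c by (simp add: state_null_def n_def)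
  qed
  have nA: "n \<in> carrier A" using b c by (simp add: n_def)
  have c_eq: "c = k \<odot> b \<oplus> n" using b c by (simp add: n_def a_rules)
  have "b \<otimes> c \<ominus> c \<otimes> b = b \<otimes> n \<ominus> n \<otimes> b"
    unfolding c_eq using b nA by (simp add: a_rules smult_mult_left smult_mult_right)
  moreover have "b \<otimes> (n \<otimes> \<one>) \<in> state_null A" "\<one> \<otimes> (n \<otimes> b) \<in> state_null A"
    using state_null_mult[OF n] b by blast+
  ultimately show ?thesis using state_null_minus[of "b \<otimes> n" "n \<otimes> b"] b nA by (simp add: a_rules)
qed

theorem theorem4p6:
  fixes \<theta> :: real and G :: "qdt quantum_group"
  assumes "is_quantum_double_torus \<theta> G"
    and "\<theta> \<notin> {2 * pi * real_of_int k | k. True}"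
  shows "strange TYPE('g) G"
proof -
  let ?Q = "qdt_alg \<theta>" and ?e = "exp (\<i> * of_real \<theta>)"
  have e: "?e \<noteq> 1"
    using assms(2) by (auto simp: exp_eq_1)
  have GQ: "fun_alg G = ?Q" and "compact_quantum_group G"
    and V: "\<And>i j. \<lbrakk>i \<in> {1, 2}; j \<in> {1, 2}\<rbrakk> \<Longrightarrow> comult G (qdt_V \<theta> i j) =
       (\<Oplus>\<^bsub>min_tensor ?Q ?Q\<^esub>k\<in>{1, 2}. elem_tensor ?Q ?Q (qdt_V \<theta> i k) (qdt_V \<theta> k j))"
    using assms(1) by (auto simp: is_quantum_double_torus_def)
  then have "cstar_algebra ?Q" by (simp add: compact_quantum_group_def Let_def)
  then interpret Q: cstar ?Q by (simp add: cstar_iff)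
  interpret QQ: cstar_pair ?Q ?Q by unfold_locales (rule ex_state_qdt)+
  interpret QT: star_algebra "min_tensor ?Q ?Q" by (rule QQ.star_algebra_min_tensor)
  note cl = qdt_closed[of \<theta>]
  let ?A = "qdt_A \<theta>" and ?B = "qdt_B \<theta>" and ?C = "qdt_C \<theta>"
  \<comment> \<open>The first row of \<open>V\<close> is (A, C) and the first column is (A, B), so
    the index 2 contributes C \<otimes> B.\<close>
  have comult_A: "comult G ?A = elem_tensor ?Q ?Q ?A ?A \<oplus>\<^bsub>min_tensor ?Q ?Q\<^esub> elem_tensor ?Q ?Q ?C ?B"
    using V[of 1 1] cl QQ.elem_tensor_closed
    by (simp add: qdt_V_def QT.finsum_insert Pi_def)
  have "\<not> classical G"
    using qdt_not_commutative[OF Q.star_algebra_axioms e] cl by (auto simp: classical_def GQ)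
  moreover have "classical H"
    if "group \<Lambda>" and H: "is_group_dual \<Lambda> H" and sub: "closed_subgroup H G" for \<Lambda> :: "'g monoid" and H
  proof -
    interpret L: discrete_group \<Lambda> using \<open>group \<Lambda>\<close> by (rule discrete_group.intro)
    let ?L = "group_cstar \<Lambda>"
    have HL: "fun_alg H = ?L" using H by (simp add: is_group_dual_def)
    interpret C: cstar ?L by (rule L.cstar_group_cstar)
    obtain \<Phi> F where \<Phi>: "\<Phi> \<in> star_hom ?Q ?L" and surj: "\<Phi> ` carrier ?Q = carrier ?L"
      and F: "is_tensor_map ?Q ?Q ?L ?L \<Phi> \<Phi> F"
      and F\<Phi>: "\<And>x. x \<in> carrier ?Q \<Longrightarrow> F (comult G x) = comult H (\<Phi> x)"
      using sub by (auto simp: closed_subgroup_def hopf_morphism_def GQ HL)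
    have \<Phi>_hom: "\<And>x. x \<in> carrier ?Q \<Longrightarrow> \<Phi> x \<in> carrier ?L"
      "\<And>x y. \<lbrakk>x \<in> carrier ?Q; y \<in> carrier ?Q\<rbrakk> \<Longrightarrow> \<Phi> (x \<oplus>\<^bsub>?Q\<^esub> y) = \<Phi> x \<oplus>\<^bsub>?L\<^esub> \<Phi> y"
      "\<And>x y. \<lbrakk>x \<in> carrier ?Q; y \<in> carrier ?Q\<rbrakk> \<Longrightarrow> \<Phi> (x \<otimes>\<^bsub>?Q\<^esub> y) = \<Phi> x \<otimes>\<^bsub>?L\<^esub> \<Phi> y"
      "\<And>c x. x \<in> carrier ?Q \<Longrightarrow> \<Phi> (c \<odot>\<^bsub>?Q\<^esub> x) = c \<odot>\<^bsub>?L\<^esub> \<Phi> x"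
      "\<And>x. x \<in> carrier ?Q \<Longrightarrow> \<Phi> (star ?Q x) = star ?L (\<Phi> x)"
      using \<Phi> by (auto simp: star_hom_def ring_hom_def)
    have \<Phi>_minus: "\<Phi> (x \<ominus>\<^bsub>?Q\<^esub> y) = \<Phi> x \<ominus>\<^bsub>?L\<^esub> \<Phi> y" if "x \<in> carrier ?Q" "y \<in> carrier ?Q" for x y
      using that by (simp add: Q.minus_conv C.minus_conv \<Phi>_hom)
    have F_add: "F (x \<oplus>\<^bsub>min_tensor ?Q ?Q\<^esub> y) = F x \<oplus>\<^bsub>min_tensor ?L ?L\<^esub> F y"
      if "x \<in> carrier (min_tensor ?Q ?Q)" "y \<in> carrier (min_tensor ?Q ?Q)" for x y
      using F that by (auto simp: is_tensor_map_def star_hom_def ring_hom_def)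
    have F_elem: "F (elem_tensor ?Q ?Q x y) = elem_tensor ?L ?L (\<Phi> x) (\<Phi> y)"
      if "x \<in> carrier ?Q" "y \<in> carrier ?Q" for x y
      using F that by (simp add: is_tensor_map_def)
    let ?a = "\<Phi> ?A" and ?b = "\<Phi> ?B" and ?c = "\<Phi> ?C"
    have abc: "?a \<in> carrier ?L" "?b \<in> carrier ?L" "?c \<in> carrier ?L" using cl \<Phi>_hom(1) by auto
    have comult_a: "comult H ?a = elem_tensor ?L ?L ?a ?a \<oplus>\<^bsub>min_tensor ?L ?L\<^esub> elem_tensor ?L ?L ?c ?b"
      using F\<Phi>[OF cl(1)] cl by (simp add: comult_A F_add F_elem QQ.elem_tensor_closed)
    \<comment> \<open>The terms from \<open>?a\<close> are symmetric in the two states and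
      cancel.\<close>
    have "\<phi> ?c * \<psi> ?b = \<psi> ?c * \<phi> ?b" if "state ?L \<phi>" "state ?L \<psi>" for \<phi> \<psi>
      using L.dual_cocommutative[OF H that abc(1) abc(1) abc(1) abc(3) abc(2) comult_a]
      by (simp add: mult.commute)
    from C.state_null_commutator[OF abc(2,3) this]
    have "?b \<otimes>\<^bsub>?L\<^esub> ?c \<ominus>\<^bsub>?L\<^esub> ?c \<otimes>\<^bsub>?L\<^esub> ?b \<in> state_null ?L" .
    moreover have "?b \<otimes>\<^bsub>?L\<^esub> ?c = ?e \<odot>\<^bsub>?L\<^esub> (?c \<otimes>\<^bsub>?L\<^esub> ?b)"
      using arg_cong[OF qdt_commutation[of \<theta>], of \<Phi>] cl by (simp add: \<Phi>_hom)
    \<comment> \<open>Modulo the ideal, the product of \<open>?b\<close> and \<open>?c\<close> is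
      both \<open>?c\<close> times \<open>?b\<close> and \<open>?e\<close> times that
      product.\<close>
    ultimately have "(?e - 1) \<odot>\<^bsub>?L\<^esub> (?c \<otimes>\<^bsub>?L\<^esub> ?b) \<in> state_null ?L"
      using C.add_smult[of "?c \<otimes>\<^bsub>?L\<^esub> ?b" ?e "- 1"] abc by (simp add: C.minus_conv)
    from C.state_null_smult[OF this, of "inverse (?e - 1)"]
    have "?c \<otimes>\<^bsub>?L\<^esub> ?b \<in> state_null ?L"
      using e abc by (simp add: C.smult_smult)
    from C.state_null_mult[OF this, of "star ?L ?c" "star ?L ?b"]
    have unit: "\<Phi> (qdt_rot_unit \<theta>) \<in> state_null ?L"
      using abc cl by (simp add: qdt_rot_unit_eq \<Phi>_hom)
    have null: "s \<otimes>\<^bsub>?L\<^esub> t \<ominus>\<^bsub>?L\<^esub> t \<otimes>\<^bsub>?L\<^esub> s \<in> state_null ?L"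
      if st: "s \<in> carrier ?L" "t \<in> carrier ?L" for s t
    proof -
      \<comment> \<open>Surjectivity of \<open>\<Phi>\<close> enters here: every commutator in the
        quotient is the image of a commutator in \<open>?Q\<close>.\<close>
      obtain x y where xy: "x \<in> carrier ?Q" "y \<in> carrier ?Q" "s = \<Phi> x" "t = \<Phi> y"
        using st unfolding surj[symmetric] by blast
      let ?d = "x \<otimes>\<^bsub>?Q\<^esub> y \<ominus>\<^bsub>?Q\<^esub> y \<otimes>\<^bsub>?Q\<^esub> x"
      have d: "?d \<in> carrier ?Q" using xy by simp
      have "s \<otimes>\<^bsub>?L\<^esub> t \<ominus>\<^bsub>?L\<^esub> t \<otimes>\<^bsub>?L\<^esub> s = \<Phi> ?d"
        using xy by (simp add: \<Phi>_minus \<Phi>_hom)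
      also have "\<dots> = \<Phi> (qdt_rot_unit \<theta> \<otimes>\<^bsub>?Q\<^esub> ?d)"
        using qdt_commutator[OF Q.star_algebra_axioms xy(1,2)] by (rule arg_cong)
      \<comment> \<open>The unit in front brings the product into the form of
        \<open>state_null_mult\<close>.\<close>
      also have "\<dots> = \<one>\<^bsub>?L\<^esub> \<otimes>\<^bsub>?L\<^esub> (\<Phi> (qdt_rot_unit \<theta>) \<otimes>\<^bsub>?L\<^esub> \<Phi> ?d)"
        using d qdt_rot_unit_closed by (simp add: \<Phi>_hom C.a_rules(12))
      also have "\<dots> \<in> state_null ?L"
        using d by (intro C.state_null_mult unit) (auto simp: \<Phi>_hom)
      finally show ?thesis .
    qed
    show ?thesis
      unfolding classical_def HL using null
      by (intro ballI L.group_cstar_commute L.commute_of_state_null)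
        (auto simp: L.group_unitary_closed)
  qed
  ultimately show ?thesis by (auto simp: strange_def)
qed

end
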